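(* Assume the standing conditions on $F$ and $\sigma$ written out in the context. Let $\mathcal{A}=\{\mathcal{A}(\omega^-)\}_{\omega^-\in\mathcal{B}}$ be a $\mathrm{P}$-weak point attractor for $\varphi$. Then $$\mu_{\omega^-}\big(\mathcal{A}(\omega^-)\big)=1\qquad\mathbf{P}\text{-a.s.},$$ which in particular implies that $\mathrm{supp}(\mu_{\omega^-})\subseteq\mathcal{A}(\omega^-)$ $\mathbf{P}$-a.s.
   Context: **Noise.** Fix $d\ge1$, $H\in(0,1)$. For $h\in(0,1)$ let $\mathcal{B}_h$ be the closure of $C_0^\infty(\mathbb{R}^-,\mathbb{R}^d)$ (smooth compactly supported $\omega:\mathbb{R}^-=(-\infty,0]\to\mathbb{R}^d$ with $\omega(0)=0$) under $\|\omega\|_{\mathcal{B}_h}:=\sup_{s,t\in\mathbb{R}^-}\frac{|\omega(t)-\omega(s)|}{\sqrt{1+|t|+|s|}\,|t-s|^{(1-h)/2}}$ (a separable Banach space), and write $\mathcal{B}:=\mathcal{B}_H$. $\mathbf{P}$ is the Gaussian measure on $\mathcal{B}$ under which the canonical process is a time-reversed Brownian motion. $\mathcal{D}_H:\mathcal{B}_H\to\mathcal{B}_{1-H}$ is the continuous extension of $\mathcal{D}_H\omega(t)=\frac1{\alpha_H}\int_{-\infty}^0(-r)^{H-1/2}(\dot\omega(t+r)-\dot\omega(r))\,dr$, where $\alpha_H$ is the normalizing constant for which the canonical process under $(\mathcal{D}_H)_*\mathbf{P}$ is a time-reversed fractional Brownian motion with Hurst parameter $H$. For $t\ge0$ put $\vartheta_t\omega(s):=\omega(s-t)-\omega(-t)$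 ($s\le0$) and $P_t(\omega^-,\omega^+)(s):=\omega^+(-s-t)-\omega^+(-t)$ for $-t\le s\le0$, $:=\omega^-(s+t)-\omega^+(-t)$ for $s\le-t$. Let $\Omega:=\mathcal{B}\times\mathcal{B}$, $\mathbb{P}:=\mathbf{P}\times\mathbf{P}$, $\theta_t(\omega^-,\omega^+):=(P_t(\omega^-,\omega^+),\vartheta_t\omega^+)$ for $t\ge0$ and $\theta_t(\omega^-,\omega^+):=(\vartheta_{-t}\omega^-,P_{-t}(\omega^+,\omega^-))$ for $t<0$. Then $B^H_t(\omega):=-(\mathcal{D}_HP_t(\omega^-,\omega^+))(-t)$, $t\ge0$, is a fractional Brownian motion under $\mathbb{P}$. **SDE and standing conditions.** Consider $dY_t=F(Y_t)\,dt+\sigma\,dB^H_t$, $Y_0=x\in\mathbb{R}^d$, with: (1) $\sigma$ an invertible $d\times d$ matrix; (2) for some $C_1^F,C_2^F,C_3^F>0$ and all $\xi_1,\xi_2\in\mathbb{R}^d$, $\langle F(\xi_2)-F(\xi_1),\xi_2-\xi_1\rangle\le\min\{C_1^F-C_2^F|\xi_2-\xi_1|^2,\;C_3^F|\xi_2-\xi_1|^2\}$; (3) $F$ is differentiable and for some $C_F>0$, $N\ge1$: $|F(\xi)|\le C_F(1+|\xi|)^N$ and $|D_\xi F|\le C_F(1+|\xi|)^N$ for all $\xi$; (4) if $H>1/2$, the derivative of $F$ is globally bounded. Let $\Phi^t_\omega(x)$ be the solution: $\Phi^t_\omega(x)=x+\int_0^tF(\Phi^s_\omega(x))\,ds+\sigma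 B^H_t(\omega)$. Set $\varphi^t_{\omega^-}(x):=\Phi^t_{\theta_{-t}(\omega^-,\omega^+)}(x)$, which depends only on $\omega^-$; then $\Phi^t_{(\omega^-,\omega^+)}(x)=\varphi^t_{P_t(\omega^-,\omega^+)}(x)$. **Invariant measure.** $\mu$ is the (known to exist and be) unique probability measure on $\mathbb{R}^d\times\mathcal{B}$ with $\mathcal{B}$-marginal $\mathbf{P}$ that is invariant under the Feller transition semigroup $\mathcal{Q}_t((x,\omega^-);\Gamma):=\int_{\mathcal{B}}\chi_\Gamma\big(\varphi^t_{P_t(\omega^-,\omega^+)}(x),P_t(\omega^-,\omega^+)\big)\mathbf{P}(d\omega^+)$. **Disintegration.** Fix a measurable $\tilde{\mathcal{B}}\subseteq\mathcal{B}$ with $\mathbf{P}(\tilde{\mathcal{B}})=1$ and probability measures $\{\mu_{\omega^-}\}$ on $\mathbb{R}^d$ (known to exist) such that $\omega^-\mapsto\mu_{\omega^-}(A)$ is measurable and $\mu(A\times D)=\int_D\mu_{\omega^-}(A)\,\mathbf{P}(d\omega^-)$ for Borel $A,D$, and such that for all $(\omega^-,\omega^+)\in\tilde{\mathcal{B}}\times\mathcal{B}$, $t\ge0$: $P_t(\omega^-,\omega^+)\in\tilde{\mathcal{B}}$ and $(\Phi^t_{(\omega^-,\omega^+)})_*\mu_{\omega^-}=\mu_{P_t(\omega^-,\omega^+)}$. **$\mathrm{P}$-weak point attractor.** A random compact set is a family $\{\mathcal{A}(\omega^-)\}_{\omega^-\in\mathcal{B}}$ of non-empty subsets of $\mathbb{R}^d$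 such that with probability one each $\mathcal{A}(\omega^-)$ is compact and $\omega^-\mapsto d(x,\mathcal{A}(\omega^-))$ is measurable for each $x\in\mathbb{R}^d$. It is a $\mathrm{P}$-weak point attractor for $\varphi$ if (i) for every $\omega^-,\omega^+\in\mathcal{B}$ (and $t\ge0$), $\Phi^t_{(\omega^-,\omega^+)}(\mathcal{A}(\omega^-))=\mathcal{A}(P_t(\omega^-,\omega^+))$; and (ii) for every $x\in\mathbb{R}^d$, $d(\varphi^t_{\omega^-}(x),\mathcal{A}(\omega^-))\to0$ in $\mathbf{P}$-probability as $t\to\infty$. *)

theory Defs
  imports "HOL-Probability.Probability"
begin

text \<open>A path on the half line of nonpositive reals is a total function on the reals that is set to
  0 on the positive reals, so that equality of functions is equality of paths.\<close>

definition test_paths :: "(real \<Rightarrow> real ^ 'n) set" where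
  "test_paths = {\<omega>. (\<forall>t\<ge>0. \<omega> t = 0) \<and> bounded {t. \<omega> t \<noteq> 0} \<and>
     (\<exists>D :: nat \<Rightarrow> real \<Rightarrow> real ^ 'n. D 0 = \<omega> \<and>
        (\<forall>k. \<forall>t\<le>0. (D k has_vector_derivative D (Suc k) t) (at t within {..0})))}"

definition holder_norm :: "real \<Rightarrow> (real \<Rightarrow> real ^ 'n) \<Rightarrow> ennreal" where
  "holder_norm h \<omega> = (SUP s\<in>{..0}. SUP t\<in>{..0}.
     ennreal (norm (\<omega> t - \<omega> s) / (sqrt (1 + \<bar>t\<bar> + \<bar>s\<bar>) * \<bar>t - s\<bar> powr ((1 - h) / 2))))"

definition holder_space :: "real \<Rightarrow> (real \<Rightarrow> real ^ 'n) set" where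
  "holder_space h = {\<omega>. (\<forall>t\<ge>0. \<omega> t = 0) \<and> holder_norm h \<omega> < \<infinity>}"

definition holder_dist :: "real \<Rightarrow> (real \<Rightarrow> real ^ 'n) \<Rightarrow> (real \<Rightarrow> real ^ 'n) \<Rightarrow> real" where
  "holder_dist h \<omega> \<eta> = enn2real (holder_norm h (\<lambda>t. \<omega> t - \<eta> t))"

text \<open>The norm dominates every evaluation map, so the abstract completion of the test paths is
  realised as their closure among all paths of finite norm.\<close>

definition path_space :: "real \<Rightarrow> (real \<Rightarrow> real ^ 'n) set" where
  "path_space h =
     Metric_space.mtopology (holder_space h) (holder_dist h) closure_of test_paths"

definition path_topology :: "real \<Rightarrow> (real \<Rightarrow> real ^ 'n) topology" where
  "path_topology h = Metric_space.mtopology (path_space h) (holder_dist h)"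

definition path_borel :: "real \<Rightarrow> (real \<Rightarrow> real ^ 'n) measure" where
  "path_borel h = sigma (path_space h) {U. openin (path_topology h) U}"

lemma holder_norm_triangle:
  "holder_norm h (\<lambda>t. \<omega> t - \<eta> t) \<le>
     holder_norm h (\<lambda>t. \<omega> t - \<zeta> t) + holder_norm h (\<lambda>t. \<zeta> t - \<eta> t)"
proof -
  have "ennreal (norm ((\<omega> t - \<eta> t) - (\<omega> s - \<eta> s)) / w)
      \<le> ennreal (norm ((\<omega> t - \<zeta> t) - (\<omega> s - \<zeta> s)) / w)
        + ennreal (norm ((\<zeta> t - \<eta> t) - (\<zeta> s - \<eta> s)) / w)" if "w \<ge> 0" for s t w
  proof -
    have "norm ((\<omega> t - \<eta> t) - (\<omega> s - \<eta> s))
      \<le> norm ((\<omega> t - \<zeta> t) - (\<omega> s - \<zeta> s)) + norm ((\<zeta> t - \<eta> t) - (\<zeta> s - \<eta> s))"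
      by (rule order_trans[OF _ norm_triangle_ineq]) (simp add: algebra_simps)
    then show ?thesis
      using that by (simp add: ennreal_plus[symmetric] add_divide_distrib[symmetric]
          divide_right_mono del: ennreal_plus)
  qed
  note tri = this
  have up: "ennreal (norm (\<omega> t - \<omega> s) / (sqrt (1 + \<bar>t\<bar> + \<bar>s\<bar>) * \<bar>t - s\<bar> powr ((1 - h) / 2)))
      \<le> holder_norm h \<omega>" if "s \<le> 0" "t \<le> 0" for s t and \<omega> :: "real \<Rightarrow> real ^ 'n"
    unfolding holder_norm_def using that by (intro SUP_upper2[of s] SUP_upper2[of t]) auto
  show ?thesis
    unfolding holder_norm_def[of h "\<lambda>t. \<omega> t - \<eta> t"]
    by (intro SUP_least order_trans[OF tri add_mono[OF up up]]) auto
qed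

lemma holder_norm_eq_0_imp:
  assumes "holder_norm h \<omega> = 0" "\<omega> 0 = 0" "t \<le> 0"
  shows "\<omega> t = 0"
proof (cases "t = 0")
  case False
  have "ennreal (norm (\<omega> t - \<omega> 0) / (sqrt (1 + \<bar>t\<bar> + \<bar>0\<bar>) * \<bar>t - 0\<bar> powr ((1 - h) / 2)))
      \<le> holder_norm h \<omega>"
    unfolding holder_norm_def using assms(3) by (intro SUP_upper2[of 0] SUP_upper2[of t]) auto
  then have "norm (\<omega> t) / (sqrt (1 + \<bar>t\<bar>) * \<bar>t\<bar> powr ((1 - h) / 2)) \<le> 0"
    using assms by (simp add: ennreal_eq_0_iff)
  moreover have "sqrt (1 + \<bar>t\<bar>) * \<bar>t\<bar> powr ((1 - h) / 2) > 0"
    using False by simp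
  ultimately show ?thesis
    by (simp add: divide_le_0_iff)
qed (use assms in simp)

lemma Metric_space_holder_space: "Metric_space (holder_space h) (holder_dist h)"
proof
  fix \<omega> \<eta> :: "real \<Rightarrow> real ^ 'n"
  show "0 \<le> holder_dist h \<omega> \<eta>" by (simp add: holder_dist_def)
  have comm: "holder_norm h (\<lambda>t. \<omega> t - \<eta> t) = holder_norm h (\<lambda>t. \<eta> t - \<omega> t)"
    for \<omega> \<eta> :: "real \<Rightarrow> real ^ 'n"
  proof -
    have "norm (\<omega> t - \<eta> t - (\<omega> s - \<eta> s)) = norm (\<eta> t - \<omega> t - (\<eta> s - \<omega> s))" for s t
      by (subst norm_minus_cancel[symmetric]) (simp add: algebra_simps)
    then show ?thesis by (simp add: holder_norm_def)
  qed
  show "holder_dist h \<omega> \<eta> = holder_dist h \<eta> \<omega>"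
    unfolding holder_dist_def by (rule arg_cong[OF comm])
  have fin: "holder_norm h (\<lambda>t. \<omega> t - \<eta> t) < \<infinity>"
    if "\<omega> \<in> holder_space h" "\<eta> \<in> holder_space h" for \<omega> \<eta> :: "real \<Rightarrow> real ^ 'n"
    using holder_norm_triangle[of h \<omega> \<eta> "\<lambda>_. 0"] comm[of "\<lambda>_. 0" \<eta>] that
    by (auto simp: holder_space_def ennreal_add_less_top intro: le_less_trans)
  show "holder_dist h \<omega> \<eta> = 0 \<longleftrightarrow> \<omega> = \<eta>"
    if *: "\<omega> \<in> holder_space h" "\<eta> \<in> holder_space h"
  proof
    assume "holder_dist h \<omega> \<eta> = 0"
    then have "holder_norm h (\<lambda>t. \<omega> t - \<eta> t) = 0"
      using fin[OF *] by (auto simp: holder_dist_def enn2real_eq_0_iff)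
    from holder_norm_eq_0_imp[OF this] * have "\<omega> t = \<eta> t" for t
      by (cases "t \<le> 0") (auto simp: holder_space_def)
    then show "\<omega> = \<eta>" by blast
  qed (simp add: holder_dist_def holder_norm_def SUP_constant bot_ennreal)
  fix \<zeta> :: "real \<Rightarrow> real ^ 'n"
  show "holder_dist h \<omega> \<zeta> \<le> holder_dist h \<omega> \<eta> + holder_dist h \<eta> \<zeta>"
    if *: "\<omega> \<in> holder_space h" "\<eta> \<in> holder_space h" "\<zeta> \<in> holder_space h"
    using enn2real_mono[OF holder_norm_triangle[of h \<omega> \<zeta> \<eta>]] fin[OF *(1,2)] fin[OF *(2,3)]
    by (simp add: holder_dist_def enn2real_plus ennreal_add_less_top)
qed

text \<open>Point masses count as (degenerate) Gaussian laws.\<close>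

definition gaussian_rv :: "'w measure \<Rightarrow> ('w \<Rightarrow> real) \<Rightarrow> bool" where
  "gaussian_rv M X \<longleftrightarrow> X \<in> borel_measurable M \<and>
     (\<exists>m. (AE w in M. X w = m) \<or>
       (\<exists>s>0. distributed M lborel X (\<lambda>x. ennreal (normal_density m s x))))"

definition gaussian_process ::
    "'w measure \<Rightarrow> real set \<Rightarrow> (real \<Rightarrow> 'w \<Rightarrow> real ^ 'n) \<Rightarrow> bool" where
  "gaussian_process M T X \<longleftrightarrow> prob_space M \<and>
     (\<forall>I a. finite I \<and> I \<subseteq> T \<longrightarrow> gaussian_rv M (\<lambda>w. \<Sum>t\<in>I. a t \<bullet> X t w))"

text \<open>Independent components, each centered with covariance function \<open>R\<close>.\<close>

definition centered_gaussian_process_cov ::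
    "'w measure \<Rightarrow> real set \<Rightarrow> (real \<Rightarrow> real \<Rightarrow> real) \<Rightarrow> (real \<Rightarrow> 'w \<Rightarrow> real ^ 'n) \<Rightarrow> bool" where
  "centered_gaussian_process_cov M T R X \<longleftrightarrow> gaussian_process M T X \<and>
     (\<forall>t\<in>T. \<forall>i. (LINT w|M. X t w $ i) = 0) \<and>
     (\<forall>s\<in>T. \<forall>t\<in>T. \<forall>i j. (LINT w|M. X s w $ i * X t w $ j) = (if i = j then R s t else 0))"

definition reversed_brownian_motion ::
    "'w measure \<Rightarrow> (real \<Rightarrow> 'w \<Rightarrow> real ^ 'n) \<Rightarrow> bool" where
  "reversed_brownian_motion M X \<longleftrightarrow>
     centered_gaussian_process_cov M {..0} (\<lambda>s t. min (- s) (- t)) X"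

definition reversed_fbm ::
    "real \<Rightarrow> 'w measure \<Rightarrow> (real \<Rightarrow> 'w \<Rightarrow> real ^ 'n) \<Rightarrow> bool" where
  "reversed_fbm H M X \<longleftrightarrow>
     centered_gaussian_process_cov M {..0}
       (\<lambda>s t. (\<bar>s\<bar> powr (2 * H) + \<bar>t\<bar> powr (2 * H) - \<bar>t - s\<bar> powr (2 * H)) / 2) X"

definition noise_measure :: "real \<Rightarrow> (real \<Rightarrow> real ^ 'n) measure \<Rightarrow> bool" where
  "noise_measure H P \<longleftrightarrow> prob_space P \<and> space P = path_space H \<and> sets P = sets (path_borel H) \<and>
     reversed_brownian_motion P (\<lambda>t \<omega>. \<omega> t)"

text \<open>Since the test paths are dense, continuity and the formula on test paths determine the
  operator up to the factor \<open>1 / \<alpha>\<close>, which is then fixed by the law of the image process.\<close>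

definition fractional_operator :: "real \<Rightarrow> (real \<Rightarrow> real ^ 'n) measure \<Rightarrow>
    ((real \<Rightarrow> real ^ 'n) \<Rightarrow> (real \<Rightarrow> real ^ 'n)) \<Rightarrow> bool" where
  "fractional_operator H P D \<longleftrightarrow>
     continuous_map (path_topology H) (path_topology (1 - H)) D \<and>
     (\<exists>\<alpha>>0. \<forall>\<omega>\<in>test_paths. \<forall>t\<le>0.
        D \<omega> t = (1 / \<alpha>) *\<^sub>R (LINT r:{..0}|lborel. ((- r) powr (H - 1/2)) *\<^sub>R
          (vector_derivative \<omega> (at (t + r) within {..0}) -
           vector_derivative \<omega> (at r within {..0})))) \<and>
     reversed_fbm H (distr P (path_borel (1 - H)) D) (\<lambda>t \<omega>. \<omega> t)"

definition past_shift :: "real \<Rightarrow> (real \<Rightarrow> real ^ 'n) \<Rightarrow> real \<Rightarrow> real ^ 'n" where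
  "past_shift t \<omega> s = (if s \<le> 0 then \<omega> (s - t) - \<omega> (- t) else 0)"

definition glue :: "real \<Rightarrow> (real \<Rightarrow> real ^ 'n) \<Rightarrow> (real \<Rightarrow> real ^ 'n) \<Rightarrow> real \<Rightarrow> real ^ 'n" where
  "glue t \<omega>m \<omega>p s =
     (if s > 0 then 0
      else if - t \<le> s then \<omega>p (- s - t) - \<omega>p (- t)
      else \<omega>m (s + t) - \<omega>p (- t))"

definition theta :: "real \<Rightarrow> (real \<Rightarrow> real ^ 'n) \<times> (real \<Rightarrow> real ^ 'n) \<Rightarrow>
    (real \<Rightarrow> real ^ 'n) \<times> (real \<Rightarrow> real ^ 'n)" where
  "theta t = (\<lambda>(\<omega>m, \<omega>p).
     if 0 \<le> t then (glue t \<omega>m \<omega>p, past_shift t \<omega>p)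
     else (past_shift (- t) \<omega>m, glue (- t) \<omega>p \<omega>m))"

definition forward_fbm :: "((real \<Rightarrow> real ^ 'n) \<Rightarrow> (real \<Rightarrow> real ^ 'n)) \<Rightarrow> real \<Rightarrow>
    (real \<Rightarrow> real ^ 'n) \<times> (real \<Rightarrow> real ^ 'n) \<Rightarrow> real ^ 'n" where
  "forward_fbm D t = (\<lambda>(\<omega>m, \<omega>p). - D (glue t \<omega>m \<omega>p) (- t))"

definition standing_conditions ::
    "real \<Rightarrow> (real ^ 'n \<Rightarrow> real ^ 'n) \<Rightarrow> real ^ 'n ^ 'n \<Rightarrow> bool" where
  "standing_conditions H F \<sigma> \<longleftrightarrow>
     invertible \<sigma> \<and>
     (\<exists>C1>0. \<exists>C2>0. \<exists>C3>0. \<forall>\<xi>1 \<xi>2.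
        (F \<xi>2 - F \<xi>1) \<bullet> (\<xi>2 - \<xi>1)
          \<le> min (C1 - C2 * (norm (\<xi>2 - \<xi>1))\<^sup>2) (C3 * (norm (\<xi>2 - \<xi>1))\<^sup>2)) \<and>
     (\<forall>\<xi>. F differentiable (at \<xi>)) \<and>
     (\<exists>CF>0. \<exists>N::nat. N \<ge> 1 \<and> (\<forall>\<xi>.
        norm (F \<xi>) \<le> CF * (1 + norm \<xi>) ^ N \<and>
        onorm (frechet_derivative F (at \<xi>)) \<le> CF * (1 + norm \<xi>) ^ N)) \<and>
     (H > 1/2 \<longrightarrow> (\<exists>K. \<forall>\<xi>. onorm (frechet_derivative F (at \<xi>)) \<le> K))"

text \<open>The conditions on \<open>F\<close> make the solution unique, so this determines \<open>\<Phi> t \<omega> x\<close> for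
  nonnegative \<open>t\<close>.\<close>

definition solution_flow :: "real \<Rightarrow> ((real \<Rightarrow> real ^ 'n) \<Rightarrow> (real \<Rightarrow> real ^ 'n)) \<Rightarrow>
    (real ^ 'n \<Rightarrow> real ^ 'n) \<Rightarrow> real ^ 'n ^ 'n \<Rightarrow>
    (real \<Rightarrow> (real \<Rightarrow> real ^ 'n) \<times> (real \<Rightarrow> real ^ 'n) \<Rightarrow> real ^ 'n \<Rightarrow> real ^ 'n) \<Rightarrow> bool" where
  "solution_flow H D F \<sigma> \<Phi> \<longleftrightarrow>
     (\<forall>\<omega> \<in> path_space H \<times> path_space H. \<forall>x.
        continuous_on {0..} (\<lambda>t. \<Phi> t \<omega> x) \<and>
        (\<forall>t\<ge>0. \<Phi> t \<omega> x =
           x + integral {0..t} (\<lambda>s. F (\<Phi> s \<omega> x)) + \<sigma> *v forward_fbm D t \<omega>))"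

text \<open>The pullback dynamics does not depend on the future path (see the lemma below for the
  noise); the zero path is used for it.\<close>

definition pullback :: "(real \<Rightarrow> (real \<Rightarrow> real ^ 'n) \<times> (real \<Rightarrow> real ^ 'n) \<Rightarrow> real ^ 'n \<Rightarrow> real ^ 'n) \<Rightarrow>
    real \<Rightarrow> (real \<Rightarrow> real ^ 'n) \<Rightarrow> real ^ 'n \<Rightarrow> real ^ 'n" where
  "pullback \<Phi> t \<omega>m = \<Phi> t (theta (- t) (\<omega>m, \<lambda>_. 0))"

lemma pullback_noise_independent_of_future:
  assumes "0 \<le> s" "s \<le> t" "\<omega>p 0 = 0"
  shows "forward_fbm D s (theta (- t) (\<omega>m, \<omega>p)) = forward_fbm D s (theta (- t) (\<omega>m, \<lambda>_. 0))"
proof -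
  have "glue s (fst (theta (- t) (\<omega>m, \<omega>p))) (snd (theta (- t) (\<omega>m, \<omega>p)))
      = glue s (fst (theta (- t) (\<omega>m, \<lambda>_. 0))) (snd (theta (- t) (\<omega>m, \<lambda>_. 0)))"
  proof (cases "t = 0")
    case True
    with assms have "s = 0" by simp
    with True assms(3) show ?thesis
      by (intro ext) (auto simp: theta_def glue_def past_shift_def)
  next
    case False
    with assms(1,2) show ?thesis
      by (intro ext) (auto simp: theta_def glue_def past_shift_def)
  qed
  then show ?thesis by (simp add: forward_fbm_def case_prod_beta)
qed

definition transition_prob :: "(real \<Rightarrow> real ^ 'n) measure \<Rightarrow>
    (real \<Rightarrow> (real \<Rightarrow> real ^ 'n) \<times> (real \<Rightarrow> real ^ 'n) \<Rightarrow> real ^ 'n \<Rightarrow> real ^ 'n) \<Rightarrow> real \<Rightarrow>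
    (real ^ 'n) \<times> (real \<Rightarrow> real ^ 'n) \<Rightarrow> ((real ^ 'n) \<times> (real \<Rightarrow> real ^ 'n)) set \<Rightarrow> ennreal" where
  "transition_prob P \<Phi> t = (\<lambda>(x, \<omega>m) \<Gamma>.
     \<integral>\<^sup>+ \<omega>p. indicator \<Gamma> (pullback \<Phi> t (glue t \<omega>m \<omega>p) x, glue t \<omega>m \<omega>p) \<partial>P)"

definition invariant_measure :: "(real \<Rightarrow> real ^ 'n) measure \<Rightarrow>
    (real \<Rightarrow> (real \<Rightarrow> real ^ 'n) \<times> (real \<Rightarrow> real ^ 'n) \<Rightarrow> real ^ 'n \<Rightarrow> real ^ 'n) \<Rightarrow>
    ((real ^ 'n) \<times> (real \<Rightarrow> real ^ 'n)) measure \<Rightarrow> bool" where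
  "invariant_measure P \<Phi> \<mu> \<longleftrightarrow> prob_space \<mu> \<and> sets \<mu> = sets (borel \<Otimes>\<^sub>M P) \<and>
     distr \<mu> P snd = P \<and>
     (\<forall>t\<ge>0. \<forall>\<Gamma>\<in>sets \<mu>. emeasure \<mu> \<Gamma> = (\<integral>\<^sup>+ z. transition_prob P \<Phi> t z \<Gamma> \<partial>\<mu>))"

text \<open>``The unique invariant measure with marginal \<open>P\<close>'', as a definite description: \<open>\<mu>\<close> has the
  property, and nothing else has it.\<close>

definition the_invariant_measure :: "(real \<Rightarrow> real ^ 'n) measure \<Rightarrow>
    (real \<Rightarrow> (real \<Rightarrow> real ^ 'n) \<times> (real \<Rightarrow> real ^ 'n) \<Rightarrow> real ^ 'n \<Rightarrow> real ^ 'n) \<Rightarrow>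
    ((real ^ 'n) \<times> (real \<Rightarrow> real ^ 'n)) measure \<Rightarrow> bool" where
  "the_invariant_measure P \<Phi> \<mu> \<longleftrightarrow>
     invariant_measure P \<Phi> \<mu> \<and> (\<forall>\<nu>. invariant_measure P \<Phi> \<nu> \<longrightarrow> \<nu> = \<mu>)"

definition disintegration :: "(real \<Rightarrow> real ^ 'n) measure \<Rightarrow>
    (real \<Rightarrow> (real \<Rightarrow> real ^ 'n) \<times> (real \<Rightarrow> real ^ 'n) \<Rightarrow> real ^ 'n \<Rightarrow> real ^ 'n) \<Rightarrow>
    ((real ^ 'n) \<times> (real \<Rightarrow> real ^ 'n)) measure \<Rightarrow> (real \<Rightarrow> real ^ 'n) set \<Rightarrow>
    ((real \<Rightarrow> real ^ 'n) \<Rightarrow> (real ^ 'n) measure) \<Rightarrow> bool" where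
  "disintegration P \<Phi> \<mu> B' \<kappa> \<longleftrightarrow>
     B' \<in> sets P \<and> emeasure P B' = 1 \<and>
     (\<forall>\<omega>\<in>space P. prob_space (\<kappa> \<omega>) \<and> sets (\<kappa> \<omega>) = sets borel) \<and>
     (\<forall>A\<in>sets borel. (\<lambda>\<omega>. emeasure (\<kappa> \<omega>) A) \<in> borel_measurable P) \<and>
     (\<forall>A\<in>sets borel. \<forall>E\<in>sets P.
        emeasure \<mu> (A \<times> E) = (\<integral>\<^sup>+ \<omega>\<in>E. emeasure (\<kappa> \<omega>) A \<partial>P)) \<and>
     (\<forall>\<omega>m\<in>B'. \<forall>\<omega>p\<in>space P. \<forall>t\<ge>0.
        glue t \<omega>m \<omega>p \<in> B' \<and> distr (\<kappa> \<omega>m) borel (\<Phi> t (\<omega>m, \<omega>p)) = \<kappa> (glue t \<omega>m \<omega>p))"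

definition random_compact_set :: "(real \<Rightarrow> real ^ 'n) measure \<Rightarrow>
    ((real \<Rightarrow> real ^ 'n) \<Rightarrow> (real ^ 'n) set) \<Rightarrow> bool" where
  "random_compact_set P A \<longleftrightarrow>
     (\<forall>\<omega>\<in>space P. A \<omega> \<noteq> {}) \<and>
     (AE \<omega> in P. compact (A \<omega>)) \<and>
     (\<forall>x. (\<lambda>\<omega>. infdist x (A \<omega>)) \<in> borel_measurable P)"

definition weak_point_attractor :: "(real \<Rightarrow> real ^ 'n) measure \<Rightarrow>
    (real \<Rightarrow> (real \<Rightarrow> real ^ 'n) \<times> (real \<Rightarrow> real ^ 'n) \<Rightarrow> real ^ 'n \<Rightarrow> real ^ 'n) \<Rightarrow>
    ((real \<Rightarrow> real ^ 'n) \<Rightarrow> (real ^ 'n) set) \<Rightarrow> bool" where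
  "weak_point_attractor P \<Phi> A \<longleftrightarrow> random_compact_set P A \<and>
     (\<forall>\<omega>m\<in>space P. \<forall>\<omega>p\<in>space P. \<forall>t\<ge>0. \<Phi> t (\<omega>m, \<omega>p) ` A \<omega>m = A (glue t \<omega>m \<omega>p)) \<and>
     (\<forall>x. \<forall>\<epsilon>>0. ((\<lambda>t. measure P {\<omega>\<in>space P. infdist (pullback \<Phi> t \<omega> x) (A \<omega>) > \<epsilon>})
        \<longlongrightarrow> 0) at_top)"

definition measure_support :: "'a::topological_space measure \<Rightarrow> 'a set" where
  "measure_support M = {x. \<forall>U. open U \<and> x \<in> U \<longrightarrow> emeasure M U > 0}"

end

theory Submission
  imports Defs
begin

text \<open>The law of \<open>(pullback \<Phi> t \<omega> 0, \<omega>)\<close> under \<open>P\<close> is that of the Markov process started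
  in the deterministic point 0, and by attraction the mean distance of its first component to
  \<open>A \<omega>\<close> tends to 0. A Krylov-Bogoliubov average of these laws therefore vanishes on the
  integrand \<open>min 1 (infdist x (A \<omega>))\<close>. By uniqueness the average represents \<open>\<mu>\<close>, so \<open>\<mu>\<close> is
  carried by the attractor and disintegration gives the claim.

  That integrand is only measurable in \<open>\<omega>\<close>. The average is therefore taken as a finitely
  additive mean which keeps \<open>P\<close> as its second marginal, and it is regularised in the first
  variable only; this preserves integrals of functions that are measurable in \<open>\<omega>\<close> and Lipschitz
  in \<open>x\<close>. Tightness comes from comparing the orbit of 0 with a stationary one: by dissipativity
  two solutions with the same noise stay at bounded distance.\<close>

section \<open>Invariant means on the half line\<close>

text \<open>The difficulty is how little is given about the objects. \<open>D\<close> is fixed by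
  continuity and a formula on test paths, \<Phi> path by path through the integral equation;
  measurability and a Markov property of the pullback have to be derived. Measurability comes from
  Euler approximation. The Markov property comes from three facts: the pullback is a cocycle,
  because \<open>D\<close> commutes with shifts; shifting a glued path returns its past; and gluing
  a \<open>P\<close>-distributed future to a \<open>P\<close>-distributed past gives law
  \<open>P\<close> again, which is read off from the invariance of \<mu> and its marginal
  \<open>P\<close>. Invariance of the averaged law can be tested only on functions on which mean and
  measure agree, so the transition operator must map this class into itself. Lipschitz dependence on
  the starting point, from the one-sided Lipschitz bound on \<open>F\<close>, achieves this. The two
  halves of the minimum in the dissipativity condition thus have separate tasks: one gives this
  stability, the other tightness.\<close>

fun iterated_average :: "nat \<Rightarrow> real list \<Rightarrow> (real \<Rightarrow> real) \<Rightarrow> real" where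
  "iterated_average n [] f = f 0"
| "iterated_average n (s # ss) f =
     (\<Sum>k<n. iterated_average n ss (\<lambda>t. f (t + real k * s))) / real n"

lemma iterated_average_add:
  "iterated_average n ss (\<lambda>t. f t + g t) = iterated_average n ss f + iterated_average n ss g"
  by (induction ss arbitrary: f g) (simp_all add: sum.distrib add_divide_distrib)

lemma iterated_average_mult:
  "iterated_average n ss (\<lambda>t. c * f t) = c * iterated_average n ss f"
  by (induction ss arbitrary: f) (simp_all add: sum_distrib_left)

lemma iterated_average_const: "n > 0 \<Longrightarrow> iterated_average n ss (\<lambda>_. c) = c"
  by (induction ss) simp_all

lemma abs_iterated_average_le:
  assumes "n > 0" "set ss \<subseteq> {0..}" "\<And>t. t \<ge> 0 \<Longrightarrow> \<bar>f t\<bar> \<le> B"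
  shows "\<bar>iterated_average n ss f\<bar> \<le> B"
  using assms(2,3)
proof (induction ss arbitrary: f)
  case (Cons s ss)
  have "\<bar>\<Sum>k<n. iterated_average n ss (\<lambda>t. f (t + real k * s))\<bar> \<le> (\<Sum>k<n. B)"
    by (intro order_trans[OF sum_abs] sum_mono Cons.IH) (use Cons.prems in auto)
  then show ?case
    using assms(1) by (simp add: field_simps)
qed simp

text \<open>At the level of \<open>s\<close> the sum telescopes to two boundary terms of size at
  most \<open>B\<close>, divided by \<open>n\<close>; every other level merely averages this bound.
  Since one list may hold many shifts, one average is almost invariant under finitely many shifts at
  once.\<close>

lemma iterated_average_shift:
  assumes "n > 0" "set ss \<subseteq> {0..}" "s \<in> set ss" "\<And>t. t \<ge> 0 \<Longrightarrow> \<bar>f t\<bar> \<le> B"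
  shows "\<bar>iterated_average n ss (\<lambda>t. f (t + s)) - iterated_average n ss f\<bar> \<le> 2 * B / real n"
  using assms(2-)
proof (induction ss arbitrary: f)
  case (Cons r ss)
  show ?case
  proof (cases "s = r")
    case True
    let ?a = "\<lambda>k. iterated_average n ss (\<lambda>t. f (t + real k * r))"
    have "iterated_average n (r # ss) (\<lambda>t. f (t + s)) - iterated_average n (r # ss) f
        = (\<Sum>k<n. ?a (Suc k) - ?a k) / real n"
      by (simp add: True sum_subtractf diff_divide_distrib algebra_simps)
    also have "(\<Sum>k<n. ?a (Suc k) - ?a k) = ?a n - ?a 0"
      by (rule sum_lessThan_telescope)
    finally have *: "iterated_average n (r # ss) (\<lambda>t. f (t + s)) - iterated_average n (r # ss) f
      = (?a n - ?a 0) / real n" .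
    have "\<bar>?a k\<bar> \<le> B" for k
      by (rule abs_iterated_average_le) (use assms(1) Cons.prems in auto)
    from this[of n] this[of 0] show ?thesis
      unfolding * using assms(1) by (auto simp: abs_divide intro!: divide_right_mono)
  next
    case False
    let ?b = "\<lambda>k. iterated_average n ss (\<lambda>t. f (t + s + real k * r))
      - iterated_average n ss (\<lambda>t. f (t + real k * r))"
    have "\<bar>?b k\<bar> \<le> 2 * B / real n" for k
      using Cons.IH[of "\<lambda>t. f (t + real k * r)"] Cons.prems False
      by (auto simp: algebra_simps)
    then have "\<bar>\<Sum>k<n. ?b k\<bar> \<le> (\<Sum>k<n. 2 * B / real n)"
      by (intro order_trans[OF sum_abs] sum_mono)
    moreover have "iterated_average n (r # ss) (\<lambda>t. f (t + s)) - iterated_average n (r # ss) f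
        = (\<Sum>k<n. ?b k) / real n"
      by (simp add: sum_subtractf diff_divide_distrib algebra_simps)
    ultimately show ?thesis
      using assms(1) by (simp add: abs_divide field_simps)
  qed
qed simp

text \<open>Arguments are total functions of which only the restriction to the half line counts. The
  bound on \<open>\<bar>m f\<bar>\<close> has two effects: applied to a function vanishing there it
  gives this locality, and together with \<open>m (\<lambda>_. 1) = 1\<close> it gives
  positivity.\<close>

definition invariant_mean :: "((real \<Rightarrow> real) \<Rightarrow> real) \<Rightarrow> bool" where
  "invariant_mean m \<longleftrightarrow>
     (\<forall>f g. bounded (f ` {0..}) \<longrightarrow> bounded (g ` {0..}) \<longrightarrow> m (\<lambda>t. f t + g t) = m f + m g) \<and>
     (\<forall>c f. bounded (f ` {0..}) \<longrightarrow> m (\<lambda>t. c * f t) = c * m f) \<and>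
     (\<forall>f B. (\<forall>t\<ge>0. \<bar>f t\<bar> \<le> B) \<longrightarrow> \<bar>m f\<bar> \<le> B) \<and>
     m (\<lambda>_. 1) = 1 \<and>
     (\<forall>f s. s \<ge> 0 \<longrightarrow> bounded (f ` {0..}) \<longrightarrow> m (\<lambda>t. f (t + s)) = m f)"

text \<open>The half line is amenable as a discrete semigroup, so no measurability in time is needed.\<close>

lemma invariant_mean_exists: "\<exists>m. invariant_mean m"
proof -
  let ?bd = "\<lambda>f :: real \<Rightarrow> real. bounded (f ` {0..})"
  \<comment> \<open>Exact invariance is weakened to an error \<open>2 * B / (n + 1)\<close>, which
    some iterated average meets; letting \<open>n\<close> vary recovers it. Each instance of a
    clause constrains finitely many coordinates of \<open>m\<close> and is closed in the product
    topology.\<close>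
  define C :: "real \<times> nat \<Rightarrow> ((real \<Rightarrow> real) \<Rightarrow> real) set" where "C = (\<lambda>(s, n). {m.
     (\<forall>f g. ?bd f \<longrightarrow> ?bd g \<longrightarrow> m (\<lambda>t. f t + g t) = m f + m g) \<and>
     (\<forall>c f. ?bd f \<longrightarrow> m (\<lambda>t. c * f t) = c * m f) \<and>
     (\<forall>f B. (\<forall>t\<ge>0. \<bar>f t\<bar> \<le> B) \<longrightarrow> \<bar>m f\<bar> \<le> B) \<and>
     m (\<lambda>_. 1) = 1 \<and>
     (\<forall>f B. (\<forall>t\<ge>0. \<bar>f t\<bar> \<le> B) \<longrightarrow> \<bar>m (\<lambda>t. f (t + s)) - m f\<bar> \<le> 2 * B / (real n + 1))})"
  define I where "I = {0::real..} \<times> (UNIV :: nat set)"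
  \<comment> \<open>A product of compact intervals, compact by Tychonoff. The clauses say nothing
    about unbounded functions, so their coordinates are confined by fixing the value 0.\<close>
  define K where "K = (PiE UNIV (\<lambda>f :: real \<Rightarrow> real.
      if ?bd f then cball 0 (SOME B. \<forall>t\<ge>0. \<bar>f t\<bar> \<le> B) else {0::real}))"
  have "compactin (product_topology (\<lambda>_. euclidean) UNIV) K"
    unfolding K_def compactin_PiE by auto
  then have "compact K"
    by (simp add: euclidean_product_topology)
  have coord: "continuous_on UNIV (\<lambda>m :: (real \<Rightarrow> real) \<Rightarrow> real. m f)" for f
    by (rule continuous_on_product_coordinates)
  have closed_if: "closed {m :: (real \<Rightarrow> real) \<Rightarrow> real. Q \<longrightarrow> R m}" if "closed {m. R m}" for Q R
    using that by (cases Q) simp_all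
  have closed: "closed (C i)" for i
    unfolding C_def split_beta
    by (intro closed_Collect_conj closed_Collect_all closed_if; intro closed_Collect_eq
        closed_Collect_le continuous_intros coord)
  have bdB: "\<exists>B. \<forall>t\<ge>0. \<bar>f t\<bar> \<le> B" if "?bd f" for f
    using that by (auto simp: bounded_iff)
  have "K \<inter> (\<Inter>i\<in>J. C i) \<noteq> {}" if J: "finite J" "J \<subseteq> I" for J :: "(real \<times> nat) set"
  proof -
    obtain ss where ss: "set ss = fst ` J"
      using finite_list[OF finite_imageI[OF J(1)]] by metis
    obtain N where N: "\<And>i. i \<in> J \<Longrightarrow> snd i \<le> N"
      using finite_imageI[OF J(1), of snd] by (auto simp: finite_nat_set_iff_bounded_le)
    have ss0: "set ss \<subseteq> {0..}"
      using J(2) by (auto simp: ss I_def)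
    \<comment> \<open>One list of all shifts in \<open>J\<close>, with \<open>Suc N\<close> terms
      per level, where \<open>N\<close> dominates every accuracy demanded in
      \<open>J\<close>.\<close>
    define m where "m = (\<lambda>f. if ?bd f then iterated_average (Suc N) ss f else 0)"
    have bd_of: "?bd f" if "\<forall>t\<ge>0. \<bar>f t\<bar> \<le> B" for f B
      using that by (auto simp: bounded_iff)
    have le: "\<bar>m f\<bar> \<le> B" if "\<forall>t\<ge>0. \<bar>f t\<bar> \<le> B" for f B
      using bd_of[OF that] that ss0 by (auto simp: m_def intro!: abs_iterated_average_le)
    have "m \<in> K"
      unfolding K_def
    proof (intro PiE_I)
      fix f :: "real \<Rightarrow> real"
      show "m f \<in> (if ?bd f then cball 0 (SOME B. \<forall>t\<ge>0. \<bar>f t\<bar> \<le> B) else {0})"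
        using le[OF someI_ex[OF bdB]] by (auto simp: m_def)
    qed simp
    moreover have "m \<in> C (s, n)" if i: "(s, n) \<in> J" for s n
    proof -
      have s: "s \<in> set ss" "s \<ge> 0" and n: "n \<le> N"
        using i J(2) N[OF i] by (force simp: ss I_def)+
      have add: "?bd (\<lambda>t. f t + g t)" if "?bd f" "?bd g" for f g
        using bounded_plus_comp[OF that] .
      have mult: "?bd (\<lambda>t. c * f t)" if "?bd f" for f c
        using bounded_scaleR_comp[OF that, of c] by simp
      have "\<bar>m (\<lambda>t. f (t + s)) - m f\<bar> \<le> 2 * B / (real n + 1)" if B: "\<forall>t\<ge>0. \<bar>f t\<bar> \<le> B" for f B
      proof -
        have "0 \<le> B" using B[rule_format, of 0] by simp
        have "?bd f" "?bd (\<lambda>t. f (t + s))"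
          using B s by (auto intro!: bd_of[of _ B])
        then have "\<bar>m (\<lambda>t. f (t + s)) - m f\<bar> \<le> 2 * B / real (Suc N)"
          using iterated_average_shift[OF _ ss0 s(1), of "Suc N" f B] B by (simp add: m_def)
        also have "\<dots> \<le> 2 * B / (real n + 1)"
          using n \<open>0 \<le> B\<close> by (intro divide_left_mono) auto
        finally show ?thesis .
      qed
      moreover have "m (\<lambda>_. 1) = 1"
        using iterated_average_const[of "Suc N" ss 1] bd_of[of "\<lambda>_. 1" 1] by (simp add: m_def)
      ultimately show ?thesis
        using le by (simp add: C_def m_def add mult iterated_average_add iterated_average_mult)
    qed
    ultimately show ?thesis by fast
  qed
  from compact_imp_fip_image[OF \<open>compact K\<close> closed this, where I = I]
  obtain m where m: "\<And>i. i \<in> I \<Longrightarrow> m \<in> C i" by blast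
  have m0: "m \<in> C (0, 0)" by (rule m) (simp add: I_def)
  have "m (\<lambda>t. f (t + s)) = m f" if s: "s \<ge> 0" and f: "?bd f" for f s
  proof -
    obtain B where B: "\<forall>t\<ge>0. \<bar>f t\<bar> \<le> B" using bdB[OF f] by blast
    have "\<bar>m (\<lambda>t. f (t + s)) - m f\<bar> \<le> 2 * B / (real n + 1)" for n
      using m[of "(s, n)"] s B by (auto simp: I_def C_def)
    moreover have "(\<lambda>n. 2 * B / (real n + 1)) \<longlonglongrightarrow> 0"
      using LIMSEQ_Suc[OF lim_const_over_n[of "2 * B"]] by (simp add: add.commute)
    ultimately have "\<bar>m (\<lambda>t. f (t + s)) - m f\<bar> \<le> 0"
      by (intro LIMSEQ_le_const) auto
    then show ?thesis by simp
  qed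
  with m0 show ?thesis
    unfolding invariant_mean_def C_def by blast
qed

context
  fixes m assumes m: "invariant_mean m"
begin

lemma mean_add: "bounded (f ` {0..}) \<Longrightarrow> bounded (g ` {0..}) \<Longrightarrow> m (\<lambda>t. f t + g t) = m f + m g"
  and mean_mult: "bounded (f ` {0..}) \<Longrightarrow> m (\<lambda>t. c * f t) = c * m f"
  and mean_abs_le: "(\<And>t. t \<ge> 0 \<Longrightarrow> \<bar>f t\<bar> \<le> B) \<Longrightarrow> \<bar>m f\<bar> \<le> B"
  and mean_one: "m (\<lambda>_. 1) = 1"
  and mean_shift: "s \<ge> 0 \<Longrightarrow> bounded (f ` {0..}) \<Longrightarrow> m (\<lambda>t. f (t + s)) = m f"
  using m by (simp_all add: invariant_mean_def)

lemma mean_const: "m (\<lambda>_. c) = c"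
  using mean_mult[of "\<lambda>_. 1" c] mean_one by (simp add: image_constant_conv)

lemma mean_cong:
  assumes "bounded (f ` {0..})" "\<And>t. t \<ge> 0 \<Longrightarrow> f t = g t"
  shows "m f = m g"
proof -
  have g: "bounded (g ` {0..})"
    using assms by (simp cong: image_cong_simp)
  have b: "bounded ((\<lambda>t. (-1) * g t) ` {0..})"
    using bounded_scaleR_comp[OF g, of "-1"] by simp
  have "\<bar>m (\<lambda>t. f t + (-1) * g t)\<bar> \<le> 0"
    by (rule mean_abs_le) (simp add: assms(2))
  moreover have "m (\<lambda>t. f t + (-1) * g t) = m f + (-1) * m g"
    by (simp only: mean_add[OF assms(1) b] mean_mult[OF g])
  ultimately show ?thesis by simp
qed

lemma mean_nonneg:
  assumes "bounded (f ` {0..})" "\<And>t. t \<ge> 0 \<Longrightarrow> 0 \<le> f t"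
  shows "0 \<le> m f"
proof -
  obtain B where B: "\<And>t. t \<ge> 0 \<Longrightarrow> \<bar>f t\<bar> \<le> B"
    using assms(1) by (auto simp: bounded_iff)
  \<comment> \<open>Values in \<open>{0..B}\<close> are recentred to
    \<open>{- B / 2..B / 2}\<close>, where the bound on absolute values is strong enough to give the
    sign.\<close>
  have "m (\<lambda>t. f t + (- B / 2)) = m f + (- B / 2)"
    by (subst mean_add) (auto simp: assms(1) mean_const image_constant_conv)
  moreover have "\<bar>m (\<lambda>t. f t + (- B / 2))\<bar> \<le> B / 2"
  proof (rule mean_abs_le)
    fix t :: real assume "t \<ge> 0"
    with B[of t] assms(2)[of t] show "\<bar>f t + (- B / 2)\<bar> \<le> B / 2" by arith
  qed
  ultimately show ?thesis by linarith
qed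

lemma mean_mono:
  assumes "bounded (f ` {0..})" "bounded (g ` {0..})" "\<And>t. t \<ge> 0 \<Longrightarrow> f t \<le> g t"
  shows "m f \<le> m g"
proof -
  have b: "bounded ((\<lambda>t. (-1) * f t) ` {0..})"
    using bounded_scaleR_comp[OF assms(1), of "-1"] by simp
  have "0 \<le> m (\<lambda>t. g t + (-1) * f t)"
    using bounded_plus_comp[OF assms(2) b] assms(3) by (intro mean_nonneg) auto
  also have "\<dots> = m g + (-1) * m f"
    by (simp only: mean_add[OF assms(2) b] mean_mult[OF assms(1)])
  finally show ?thesis by simp
qed

lemma mean_tendsto_0:
  assumes "bounded (f ` {0..})" "(f \<longlongrightarrow> 0) at_top"
  shows "m f = 0"
proof -
  have le: "\<bar>m f\<bar> \<le> 0 + e" if e: "e > 0" for e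
  proof -
    obtain T where T: "\<And>t. t \<ge> T \<Longrightarrow> \<bar>f t\<bar> < e"
      using tendstoD[OF assms(2) e] unfolding dist_real_def eventually_at_top_linorder by auto
    have "m f = m (\<lambda>t. f (t + max 0 T))"
      using assms(1) by (simp add: mean_shift)
    also have "\<bar>\<dots>\<bar> \<le> e"
      by (rule mean_abs_le) (auto intro!: less_imp_le[OF T])
    finally show ?thesis by simp
  qed
  have "\<bar>m f\<bar> \<le> 0"
    by (rule field_le_epsilon) (rule le)
  then show ?thesis by simp
qed

end

section \<open>From finitely additive means to measures\<close>

text \<open>A Koenig-type argument: each condition concerns one or two coordinates, hence is closed
  in the product of discrete spaces, and the levels \<open>F n\<close> are finite, so Tychonoff
  applies. It will select a single branch lying in all sections of a decreasing sequence of
  cylinders.\<close>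

lemma product_discrete_compactness:
  fixes F :: "nat \<Rightarrow> 'k set" and A :: "nat \<Rightarrow> (nat \<Rightarrow> 'k) set"
  assumes fin: "\<And>n. finite (F n)"
    and A: "\<And>j. A j = {c. \<forall>n. c n \<in> F n \<and> Q n (c n) (c (Suc n))} \<inter> {c. R j (c (N j))}"
    and ne: "\<And>J. finite J \<Longrightarrow> (\<Inter>j\<in>J. A j) \<noteq> {}"
  shows "(\<Inter>j. A j) \<noteq> {}"
proof -
  let ?X = "product_topology (\<lambda>_ :: nat. discrete_topology (UNIV :: 'k set)) UNIV"
  have cl2: "closedin ?X {c. Z (c n) (c m)}" for Z and n m :: nat
  proof -
    have op: "openin ?X {c. c n = a}" for n a
      using openin_continuous_map_preimage[OF continuous_map_product_projection, of n UNIV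
          "\<lambda>_. discrete_topology UNIV" "{a}"]
      by (simp add: PiE_UNIV_domain)
    have "openin ?X (\<Union>(a, b)\<in>{(a, b). \<not> Z a b}. {c. c n = a} \<inter> {c. c m = b})"
      by (intro openin_Union) (auto intro!: openin_Int op)
    moreover have "topspace ?X - {c. Z (c n) (c m)}
        = (\<Union>(a, b)\<in>{(a, b). \<not> Z a b}. {c. c n = a} \<inter> {c. c m = b})"
      by (auto simp: PiE_UNIV_domain)
    ultimately show ?thesis
      unfolding closedin_def by (simp add: PiE_UNIV_domain)
  qed
  have cp: "compactin ?X (PiE UNIV F)"
    by (simp add: compactin_PiE fin compactin_discrete_topology)
  moreover have closed: "closedin ?X (A j)" for j
  proof -
    have "A j = \<Inter> (range (\<lambda>n. {c. c n \<in> F n}) \<union> range (\<lambda>n. {c. Q n (c n) (c (Suc n))})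
        \<union> {{c. R j (c (N j))}})"
      unfolding A by auto
    moreover have "closedin ?X \<dots>"
      using cl2[of "\<lambda>a _. a \<in> F n" n n for n] cl2[of "\<lambda>a _. R j a" "N j" "N j"] cl2
      by (intro closedin_Inter) auto
    ultimately show ?thesis by simp
  qed
  moreover have fip: "PiE UNIV F \<inter> \<Inter> V \<noteq> {}" if V: "finite V" "V \<subseteq> range A" for V
  proof -
    obtain J where J: "finite J" "V = A ` J"
      using finite_subset_image[OF V] by blast
    \<comment> \<open>Adding index 0 keeps the intersection inside the box even when
      \<open>J\<close> is empty.\<close>
    have sub: "(\<Inter>j\<in>insert 0 J. A j) \<subseteq> PiE UNIV F \<inter> \<Inter> V"
      by (auto simp: J A)
    have "(\<Inter>j\<in>insert 0 J. A j) \<noteq> {}"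
      by (rule ne) (simp add: J(1))
    with sub show ?thesis by blast
  qed
  moreover have "(\<forall>C\<in>range A. closedin ?X C) \<and>
      (\<forall>V. finite V \<and> V \<subseteq> range A \<longrightarrow> PiE UNIV F \<inter> \<Inter> V \<noteq> {})"
    using closed fip by simp
  ultimately have "PiE UNIV F \<inter> \<Inter> (range A) \<noteq> {}"
    by (intro cp[unfolded compactin_fip, THEN conjunct2, THEN spec[of _ "range A"], THEN mp])
  then show ?thesis by blast
qed

lemma finite_vec_box: "finite T \<Longrightarrow> finite {v :: int ^ 'n. \<forall>i. v $ i \<in> T}"
proof -
  assume "finite T"
  have "{v :: int ^ 'n. \<forall>i. v $ i \<in> T} \<subseteq> vec_lambda ` (PiE UNIV (\<lambda>_. T))"
  proof
    fix v :: "int ^ 'n" assume "v \<in> {v. \<forall>i. v $ i \<in> T}"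
    then show "v \<in> vec_lambda ` (PiE UNIV (\<lambda>_. T))"
      by (intro image_eqI[of _ _ "vec_nth v"]) auto
  qed
  moreover have "finite (PiE (UNIV :: 'n set) (\<lambda>_. T))"
    by (rule finite_PiE) (use \<open>finite T\<close> in auto)
  ultimately show ?thesis
    using finite_surj by blast
qed

section \<open>Dyadic cubes and consistent sequences of them\<close>

definition dyadic :: "nat \<Rightarrow> real ^ 'n \<Rightarrow> int ^ 'n" where
  "dyadic n x = (\<chi> i. \<lfloor>2 ^ n * x $ i\<rfloor>)"

definition dyadic_point :: "nat \<Rightarrow> int ^ 'n \<Rightarrow> real ^ 'n" where
  "dyadic_point n v = (\<chi> i. real_of_int (v $ i) / 2 ^ n)"

text \<open>Integer division rounds down, also for negative coordinates, so the cube with corner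
  \<open>v\<close> at level \<open>n + k\<close> lies in the cube with corner
  \<open>parent k v\<close> at level \<open>n\<close>.\<close>

definition parent :: "nat \<Rightarrow> int ^ 'n \<Rightarrow> int ^ 'n" where
  "parent k v = (\<chi> i. v $ i div 2 ^ k)"

text \<open>A branch is a consistent sequence of dyadic cubes, coded by their corners. The sections of
  cylinder sets of branches are compact, which gives \<open>\<sigma>\<close>-additivity of a content for free; the
  same content on half-open cubes of the vector space could lose mass at their boundaries.\<close>

definition dyadic_branches :: "(nat \<Rightarrow> int ^ 'n) set" where
  "dyadic_branches = {c. \<forall>n. c n = parent 1 (c (Suc n))}"

lemma parent_parent: "parent k (parent l v) = parent (k + l) v"
  by (simp add: parent_def vec_eq_iff zdiv_zmult2_eq power_add add.commute[of k l])

lemma parent_0: "parent 0 v = v"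
  by (simp add: parent_def vec_eq_iff)

lemma dyadic_parent: "dyadic n x = parent k (dyadic (n + k) x)"
proof -
  have "\<lfloor>2 ^ n * x $ i\<rfloor> = \<lfloor>2 ^ (n + k) * x $ i\<rfloor> div 2 ^ k" for i
  proof -
    have "2 ^ n * x $ i = 2 ^ (n + k) * x $ i / real_of_int (2 ^ k)"
      by (simp add: power_add)
    then show ?thesis
      by (simp only: floor_divide_real_eq_div zero_le_power zero_le_numeral)
  qed
  then show ?thesis by (simp add: dyadic_def parent_def vec_eq_iff)
qed

lemma dyadic_branch: "(\<lambda>n. dyadic n x) \<in> dyadic_branches"
  unfolding dyadic_branches_def mem_Collect_eq Suc_eq_plus1 by (intro allI dyadic_parent)

lemma branch_parent:
  assumes "c \<in> dyadic_branches" shows "c n = parent k (c (n + k))"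
proof (induction k)
  case (Suc k)
  have *: "c (n + k) = parent 1 (c (Suc (n + k)))"
    using assms unfolding dyadic_branches_def by blast
  show ?case
    by (subst Suc, subst *) (simp add: parent_parent)
qed (simp add: parent_0)

lemma dyadic_of_point: "dyadic n (dyadic_point n v) = v"
  by (simp add: dyadic_def dyadic_point_def vec_eq_iff)

lemma branch_through: "\<exists>c \<in> dyadic_branches. c n = v"
  by (rule bexI[OF _ dyadic_branch[of "dyadic_point n v"]]) (rule dyadic_of_point)

text \<open>Distinct branches may share a limit: in dimension one the constant branch -1 and the
  constant branch 0 both tend to 0. The limit lies in the closure of every cube of the branch, but
  not always in the half-open cube itself.\<close>

definition branch_point :: "(nat \<Rightarrow> int ^ 'n) \<Rightarrow> real ^ 'n" where
  "branch_point c = lim (\<lambda>n. dyadic_point n (c n))"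

lemma norm_le_card:
  fixes x :: "real ^ 'n"
  assumes "\<And>i. \<bar>x $ i\<bar> \<le> e" shows "norm x \<le> real CARD('n) * e"
  using norm_le_l1_cart[of x] sum_bounded_above[of UNIV "\<lambda>i. \<bar>x $ i\<bar>" e] assms by simp

lemma dyadic_point_dyadic:
  fixes x :: "real ^ 'n"
  shows "norm (x - dyadic_point n (dyadic n x)) \<le> real CARD('n) * (1 / 2 ^ n)"
proof (rule norm_le_card)
  fix i
  have "\<bar>2 ^ n * x $ i - of_int \<lfloor>2 ^ n * x $ i\<rfloor>\<bar> \<le> 1" by linarith
  moreover have "x $ i - of_int \<lfloor>2 ^ n * x $ i\<rfloor> / 2 ^ n
      = (2 ^ n * x $ i - of_int \<lfloor>2 ^ n * x $ i\<rfloor>) / 2 ^ n"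
    by (simp add: field_simps)
  ultimately show "\<bar>(x - dyadic_point n (dyadic n x)) $ i\<bar> \<le> 1 / 2 ^ n"
    by (simp add: dyadic_point_def dyadic_def abs_divide divide_right_mono)
qed

text \<open>The corner at level \<open>n + k\<close> is itself a point whose cube at level
  \<open>n\<close> is \<open>c n\<close>, so this is the distance of a point from the corner of its
  own cube.\<close>

lemma dyadic_point_branch:
  fixes c :: "nat \<Rightarrow> int ^ 'n"
  assumes "c \<in> dyadic_branches"
  shows "norm (dyadic_point (n + k) (c (n + k)) - dyadic_point n (c n)) \<le> real CARD('n) * (1 / 2 ^ n)"
  using dyadic_point_dyadic[of "dyadic_point (n + k) (c (n + k))" n]
    dyadic_parent[of n "dyadic_point (n + k) (c (n + k))" k] branch_parent[OF assms, of n k]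
  by (simp add: dyadic_of_point)

lemma branch_point:
  fixes c :: "nat \<Rightarrow> int ^ 'n"
  assumes c: "c \<in> dyadic_branches"
  shows "(\<lambda>n. dyadic_point n (c n)) \<longlonglongrightarrow> branch_point c"
    and "norm (branch_point c - dyadic_point n (c n)) \<le> real CARD('n) * (1 / 2 ^ n)"
proof -
  have e0: "(\<lambda>n. real CARD('n) * (1 / 2 ^ n)) \<longlonglongrightarrow> 0"
    by (intro tendsto_mult_right_zero) (simp add: LIMSEQ_divide_realpow_zero)
  have "Cauchy (\<lambda>n. dyadic_point n (c n))"
  proof (rule metric_CauchyI)
    fix e :: real assume "e > 0"
    then obtain N where N: "real CARD('n) * (1 / 2 ^ N) < e / 2"
      using order_tendstoD(2)[OF e0, of "e / 2"] by (auto simp: eventually_sequentially)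
    have "dist (dyadic_point m (c m)) (dyadic_point N (c N)) < e / 2" if "m \<ge> N" for m
      using le_less_trans[OF dyadic_point_branch[OF c, of N "m - N"] N] that by (simp add: dist_norm)
    then show "\<exists>M. \<forall>m\<ge>M. \<forall>n\<ge>M. dist (dyadic_point m (c m)) (dyadic_point n (c n)) < e"
      using dist_triangle_half_l by blast
  qed
  then show lim: "(\<lambda>n. dyadic_point n (c n)) \<longlonglongrightarrow> branch_point c"
    unfolding branch_point_def using Cauchy_convergent convergent_LIMSEQ_iff by blast
  have "(\<lambda>k. norm (dyadic_point (n + k) (c (n + k)) - dyadic_point n (c n)))
      \<longlonglongrightarrow> norm (branch_point c - dyadic_point n (c n))"
    using LIMSEQ_ignore_initial_segment[OF lim, of n]
    by (intro tendsto_intros) (simp add: add.commute)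
  then show "norm (branch_point c - dyadic_point n (c n)) \<le> real CARD('n) * (1 / 2 ^ n)"
    by (rule LIMSEQ_le_const2) (use dyadic_point_branch[OF c] in auto)
qed

lemma dyadic_measurable: "{x. dyadic n x = v} \<in> sets borel"
proof -
  have "{x. dyadic n x = v} = (\<Inter>i. {x. \<lfloor>2 ^ n * x $ i\<rfloor> = v $ i})"
    by (auto simp: dyadic_def vec_eq_iff)
  also have "\<dots> \<in> sets borel"
    by (intro sets.countable_INT'') (auto intro!: measurable_sets_borel)
  finally show ?thesis .
qed

section \<open>Bounded measurable functions and additive means on them\<close>

definition bounded_measurable :: "'a measure \<Rightarrow> ('a \<Rightarrow> real) \<Rightarrow> bool" where
  "bounded_measurable M f \<longleftrightarrow> f \<in> borel_measurable M \<and> bounded (f ` space M)"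

lemma bounded_measurableI:
  "f \<in> borel_measurable M \<Longrightarrow> (\<And>x. x \<in> space M \<Longrightarrow> \<bar>f x\<bar> \<le> B) \<Longrightarrow> bounded_measurable M f"
  by (auto simp: bounded_measurable_def bounded_iff)

lemma bounded_measurableE:
  assumes "bounded_measurable M f"
  obtains B where "f \<in> borel_measurable M" "\<And>x. x \<in> space M \<Longrightarrow> \<bar>f x\<bar> \<le> B"
  using assms by (auto simp: bounded_measurable_def bounded_iff)

lemma bounded_measurable_add:
  "bounded_measurable M f \<Longrightarrow> bounded_measurable M g \<Longrightarrow> bounded_measurable M (\<lambda>x. f x + g x)"
  by (auto simp: bounded_measurable_def intro: bounded_plus_comp)

lemma bounded_measurable_mult:
  "bounded_measurable M f \<Longrightarrow> bounded_measurable M (\<lambda>x. c * f x)"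
  using bounded_scaleR_comp[of f "space M" c] by (auto simp: bounded_measurable_def)

lemma bounded_measurable_indicator:
  "A \<in> sets M \<Longrightarrow> bounded_measurable M (indicator A)"
  by (rule bounded_measurableI[where B = 1]) (auto simp: indicator_def)

lemma (in finite_measure) integrable_bounded_measurable:
  "bounded_measurable M f \<Longrightarrow> integrable M f"
  by (erule bounded_measurableE) (rule integrable_const_bound, auto)

lemma (in prob_space) abs_integral_diff_le:
  fixes f g :: "'a \<Rightarrow> real"
  assumes f: "integrable M f" and g: "integrable M g" and le: "\<And>x. x \<in> space M \<Longrightarrow> \<bar>f x - g x\<bar> \<le> e"
  shows "\<bar>integral\<^sup>L M f - integral\<^sup>L M g\<bar> \<le> e"
proof -
  have fe: "integrable M (\<lambda>x. f x + e)" and ge: "integrable M (\<lambda>x. g x + e)" using f g by auto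
  have "integral\<^sup>L M f \<le> (LINT x|M. g x + e)"
    by (rule integral_mono[OF f ge]) (use le in \<open>force simp: abs_le_iff\<close>)
  moreover have "integral\<^sup>L M g \<le> (LINT x|M. f x + e)"
    by (rule integral_mono[OF g fe]) (use le in \<open>force simp: abs_le_iff\<close>)
  ultimately show ?thesis using f g by (simp add: prob_space abs_le_iff)
qed

text \<open>What \<open>L\<close> lacks in comparison with an integral is countable additivity. Its
  second marginal is the measure \<open>P\<close>, so the failure is confined to the first variable,
  and there tightness excludes escape of mass to infinity. What remains is mass piling up at missing
  boundary points, which the passage to branches repairs.\<close>

locale finitely_additive_mean = prob_space P for P :: "'w measure" +
  fixes L :: "((real ^ 'n) \<times> 'w \<Rightarrow> real) \<Rightarrow> real"
  assumes L_add: "bounded_measurable (borel \<Otimes>\<^sub>M P) f \<Longrightarrow> bounded_measurable (borel \<Otimes>\<^sub>M P) g \<Longrightarrow>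
      L (\<lambda>z. f z + g z) = L f + L g"
    and L_mult: "bounded_measurable (borel \<Otimes>\<^sub>M P) f \<Longrightarrow> L (\<lambda>z. c * f z) = c * L f"
    and L_mono: "bounded_measurable (borel \<Otimes>\<^sub>M P) f \<Longrightarrow> bounded_measurable (borel \<Otimes>\<^sub>M P) g \<Longrightarrow>
      (\<And>z. z \<in> space (borel \<Otimes>\<^sub>M P) \<Longrightarrow> f z \<le> g z) \<Longrightarrow> L f \<le> L g"
    and L_marginal: "E \<in> sets P \<Longrightarrow> L (indicator (UNIV \<times> E)) = measure P E"
    and L_tight: "e > 0 \<Longrightarrow> \<exists>R. 1 - e \<le> L (indicator (cball 0 R \<times> space P))"
begin

abbreviation "bm \<equiv> bounded_measurable (borel \<Otimes>\<^sub>M P :: ((real ^ 'n) \<times> 'w) measure)"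

lemma space_M: "space (borel \<Otimes>\<^sub>M P) = UNIV \<times> space P"
  by (simp add: space_pair_measure)

lemma L_cong: "bm f \<Longrightarrow> bm g \<Longrightarrow> (\<And>x w. w \<in> space P \<Longrightarrow> f (x, w) = g (x, w)) \<Longrightarrow> L f = L g"
  by (intro antisym L_mono) (auto simp: space_M)

lemma bm_const: "bm (\<lambda>_. c)"
  by (rule bounded_measurableI[where B = "\<bar>c\<bar>"]) auto

lemma L_const: "L (\<lambda>_. c) = c"
proof -
  have "L (\<lambda>_. 1) = L (indicator (UNIV \<times> space P))"
    by (rule L_cong) (auto intro!: bm_const bounded_measurable_indicator)
  then have "L (\<lambda>_. 1) = 1"
    by (simp add: L_marginal prob_space)
  with L_mult[OF bm_const[of 1], of c] show ?thesis by simp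
qed

lemma L_abs_diff_le:
  assumes "bm f" "bm g" "\<And>x w. w \<in> space P \<Longrightarrow> \<bar>f (x, w) - g (x, w)\<bar> \<le> e"
  shows "\<bar>L f - L g\<bar> \<le> e"
proof -
  have "L f \<le> L g + e" if "bm f" "bm g" "\<And>x w. w \<in> space P \<Longrightarrow> \<bar>f (x, w) - g (x, w)\<bar> \<le> e" for f g
  proof -
    have "L f \<le> L (\<lambda>z. g z + e)"
      using that(3) by (intro L_mono bounded_measurable_add that bm_const)
        (auto simp: space_M abs_le_iff diff_le_eq add.commute)
    then show ?thesis by (simp add: L_add that bm_const L_const)
  qed
  from this[of f g] this[of g f] show ?thesis
    using assms by (auto simp: abs_minus_commute)
qed

lemma L_indicator_empty: "L (indicator {}) = 0"
proof -
  have "indicator {} = (\<lambda>_ :: (real ^ 'n) \<times> 'w. 0 :: real)" by (intro ext) simp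
  then show ?thesis by (simp add: L_const)
qed

section \<open>The content on cylinders of branches\<close>

definition branch_space :: "((nat \<Rightarrow> int ^ 'n) \<times> 'w) set" where
  "branch_space = dyadic_branches \<times> space P"

text \<open>Each of the infinitely many cubes of level \<open>n\<close> may carry its own set, so
  the level sets of a function of \<open>c n\<close> and \<open>w\<close> are cylinders as they
  stand.\<close>

definition cylinder :: "nat \<Rightarrow> (int ^ 'n \<Rightarrow> 'w set) \<Rightarrow> ((nat \<Rightarrow> int ^ 'n) \<times> 'w) set" where
  "cylinder n E = {(c, w). c \<in> dyadic_branches \<and> w \<in> E (c n)}"

definition cylinders :: "((nat \<Rightarrow> int ^ 'n) \<times> 'w) set set" where
  "cylinders = {cylinder n E | n E. range E \<subseteq> sets P}"

text \<open>The argument is pulled back along the map that sends a point to its branch. That map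
  misses some branches, yet every cube is met by points, so a nonempty cylinder never has an empty
  pullback.\<close>

definition branch_content :: "((nat \<Rightarrow> int ^ 'n) \<times> 'w) set \<Rightarrow> real" where
  "branch_content A = L (indicator {(x, w). ((\<lambda>n. dyadic n x), w) \<in> A})"

lemma cylinder_lift: "cylinder n E = cylinder (n + k) (\<lambda>v. E (parent k v))"
  unfolding cylinder_def by (auto simp: branch_parent[of _ n k, symmetric])

lemma cylindersE:
  assumes "A \<in> cylinders"
  obtains n E where "range E \<subseteq> sets P" "A = cylinder n E"
  using assms by (auto simp: cylinders_def)

lemma cylinders2E:
  assumes "A \<in> cylinders" "B \<in> cylinders"
  obtains n E F where "range E \<subseteq> sets P" "range F \<subseteq> sets P" "A = cylinder n E" "B = cylinder n F"
proof -
  obtain n E where A: "range E \<subseteq> sets P" "A = cylinder n E" using assms(1) by (rule cylindersE)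
  obtain m F where B: "range F \<subseteq> sets P" "B = cylinder m F" using assms(2) by (rule cylindersE)
  show ?thesis
  proof (rule that)
    show "A = cylinder (n + m) (\<lambda>v. E (parent m v))"
      unfolding A(2) by (rule cylinder_lift)
    show "B = cylinder (n + m) (\<lambda>v. F (parent n v))"
      unfolding B(2) add.commute[of n m] by (rule cylinder_lift)
  qed (use A(1) B(1) in auto)
qed

lemma ring_of_sets_cylinders: "ring_of_sets branch_space cylinders"
  unfolding ring_of_sets_iff
proof (intro conjI ballI)
  show "cylinders \<subseteq> Pow branch_space"
    using sets.sets_into_space by (auto simp: cylinders_def cylinder_def branch_space_def image_subset_iff)
  show "{} \<in> cylinders"
    unfolding cylinders_def by (intro CollectI exI[of _ 0] exI[of _ "\<lambda>_. {}"]) (auto simp: cylinder_def)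
  fix A B assume "A \<in> cylinders" "B \<in> cylinders"
  then obtain n E F where *: "range E \<subseteq> sets P" "range F \<subseteq> sets P" "A = cylinder n E" "B = cylinder n F"
    by (rule cylinders2E)
  have "A \<union> B = cylinder n (\<lambda>v. E v \<union> F v)" "A - B = cylinder n (\<lambda>v. E v - F v)"
    unfolding *(3,4) by (auto simp: cylinder_def)
  moreover have "range (\<lambda>v. E v \<union> F v) \<subseteq> sets P" "range (\<lambda>v. E v - F v) \<subseteq> sets P"
    using *(1,2) by auto
  ultimately show "A \<union> B \<in> cylinders" "A - B \<in> cylinders"
    unfolding cylinders_def by blast+
qed

lemma cylinder_preimage: "{(x, w). ((\<lambda>n. dyadic n x), w) \<in> cylinder n E} = {(x, w). w \<in> E (dyadic n x)}"
  using dyadic_branch by (auto simp: cylinder_def)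

lemma dyadic_family_measurable:
  assumes "range E \<subseteq> sets P"
  shows "{(x, w). w \<in> E (dyadic n x)} \<in> sets ((borel :: (real ^ 'n) measure) \<Otimes>\<^sub>M P)"
proof -
  have "{(x, w). w \<in> E (dyadic n x)} = (\<Union>v. {x. dyadic n x = v} \<times> E v)"
    by auto
  also have "\<dots> \<in> sets (borel \<Otimes>\<^sub>M P)"
    using assms by (intro sets.countable_UN'') (auto intro!: pair_measureI dyadic_measurable)
  finally show ?thesis .
qed

lemma cylinder_preimage_measurable:
  assumes "A \<in> cylinders"
  shows "{(x, w). ((\<lambda>n. dyadic n x), w) \<in> A} \<in> sets ((borel :: (real ^ 'n) measure) \<Otimes>\<^sub>M P)"
  using assms by (elim cylindersE) (simp add: cylinder_preimage dyadic_family_measurable)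

lemma branch_content_nonneg: "A \<in> cylinders \<Longrightarrow> 0 \<le> branch_content A"
  using L_mono[OF bm_const[of 0] bounded_measurable_indicator[OF cylinder_preimage_measurable[of A]]]
  by (simp add: branch_content_def L_const)

lemma branch_content_add:
  assumes "A \<in> cylinders" "B \<in> cylinders" "A \<inter> B = {}"
  shows "branch_content (A \<union> B) = branch_content A + branch_content B"
proof -
  let ?S = "\<lambda>A. {(x, w). ((\<lambda>n. dyadic n (x :: real ^ 'n)), w) \<in> A}"
  have "L (indicator (?S (A \<union> B))) = L (\<lambda>z. indicator (?S A) z + indicator (?S B) z)"
    using assms(3) by (intro arg_cong[of _ _ L] ext) (auto simp: indicator_def)
  then show ?thesis
    unfolding branch_content_def
    by (simp only: L_add bounded_measurable_indicator cylinder_preimage_measurable assms)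
qed


text \<open>Up to mass \<open>e / 2\<close> the first variable stays in a bounded box. Over the box
  the projections of the cylinders to the second variable decrease, and they shrink to the empty set
  because sections are compact; countable additivity of \<open>P\<close> then makes their measure
  tend to 0.\<close>

lemma branch_content_tendsto_0:
  assumes A: "range A \<subseteq> cylinders" "decseq A" "(\<Inter>j. A j) = {}"
  shows "(\<lambda>j. branch_content (A j)) \<longlonglongrightarrow> 0"
proof (rule metric_LIMSEQ_I)
  fix e :: real assume "e > 0"
  then obtain R where R: "1 - e / 2 \<le> L (indicator (cball 0 R \<times> space P))"
    using L_tight[of "e / 2"] by auto
  have "\<forall>j. \<exists>n E. range E \<subseteq> sets P \<and> A j = cylinder n E"
    using A(1) cylindersE by (metis range_subsetD)
  then obtain n E where E: "\<And>j. range (E j) \<subseteq> sets P" and AE: "\<And>j. A j = cylinder (n j) (E j)"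
    by metis
  define N where "N = \<lceil>R\<rceil> + 1"
  \<comment> \<open>The cubes of level \<open>n\<close> whose unit ancestor has coordinates in
    \<open>{- N..N}\<close>. Together they cover the ball of radius \<open>R\<close>, and whether a
    branch stays in them can be read off at level 0.\<close>
  define F :: "nat \<Rightarrow> (int ^ 'n) set" where "F n = {v. \<forall>i. v $ i div 2 ^ n \<in> {-N..N}}" for n
  have fin: "finite (F n)" for n
  proof -
    \<comment> \<open>The bound with \<open>N + 1\<close> accommodates the remainder of the division
      by \<open>2 ^ n\<close>.\<close>
    have "F n \<subseteq> {v. \<forall>i. v $ i \<in> {- N * 2 ^ n..(N + 1) * 2 ^ n}}"
    proof (clarsimp simp: F_def)
      fix v :: "int ^ 'n" and i assume "\<forall>i. - N \<le> v $ i div 2 ^ n \<and> v $ i div 2 ^ n \<le> N"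
      then have a: "- N \<le> v $ i div 2 ^ n" "v $ i div 2 ^ n \<le> N" by auto
      have d: "v $ i = v $ i div 2 ^ n * 2 ^ n + v $ i mod 2 ^ n"
        by (rule div_mult_mod_eq[symmetric])
      have m: "0 \<le> v $ i mod 2 ^ n" "v $ i mod 2 ^ n < 2 ^ n" by auto
      have s: "- N * 2 ^ n \<le> v $ i div 2 ^ n * 2 ^ n" "v $ i div 2 ^ n * 2 ^ n \<le> N * 2 ^ n"
        by (intro mult_right_mono a; simp)+
      with d m show "- (N * 2 ^ n) \<le> v $ i \<and> v $ i \<le> (N + 1) * 2 ^ n"
        unfolding distrib_right minus_mult_left mult_1 using s by linarith
    qed
    then show ?thesis
      by (rule finite_subset) (intro finite_vec_box finite_atLeastAtMost_int)
  qed
  have F0: "c m \<in> F m \<longleftrightarrow> c 0 \<in> F 0" if "c \<in> dyadic_branches" for c m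
    using branch_parent[OF that, of 0 m] by (simp add: F_def parent_def)
  \<comment> \<open>The projection of the part of \<open>A j\<close> over the box. As only finitely
    many cubes occur, it is measurable.\<close>
  define B where "B j = (\<Union>v\<in>F (n j). E j v)" for j
  have B[measurable]: "B j \<in> sets P" for j
    unfolding B_def using E fin by (intro sets.finite_UN) auto
  have inB: "w \<in> B j \<longleftrightarrow> (\<exists>c\<in>dyadic_branches. (c, w) \<in> A j \<and> c 0 \<in> F 0)" for w j
  proof
    assume "w \<in> B j"
    then obtain v where v: "v \<in> F (n j)" "w \<in> E j v" by (auto simp: B_def)
    obtain c where c: "c \<in> dyadic_branches" "c (n j) = v" using branch_through[of "n j" v] by blast
    with v F0[OF c(1), of "n j"] have "(c, w) \<in> A j \<and> c 0 \<in> F 0"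
      by (simp add: AE cylinder_def)
    with c(1) show "\<exists>c\<in>dyadic_branches. (c, w) \<in> A j \<and> c 0 \<in> F 0" by blast
  next
    assume "\<exists>c\<in>dyadic_branches. (c, w) \<in> A j \<and> c 0 \<in> F 0"
    then obtain c where c: "c \<in> dyadic_branches" "(c, w) \<in> A j" "c 0 \<in> F 0" by blast
    with F0[OF c(1), of "n j"] show "w \<in> B j"
      by (auto simp: AE cylinder_def B_def)
  qed
  have mono: "A j \<subseteq> A i" if "i \<le> j" for i j
    using A(2) that by (auto simp: decseq_def)
  have "(\<Inter>j. B j) = {}"
  proof (rule ccontr)
    assume "(\<Inter>j. B j) \<noteq> {}"
    then obtain w where w: "\<And>j. w \<in> B j" by blast
    \<comment> \<open>The section of \<open>A j\<close> at \<open>w\<close> within the box, in the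
      form that the compactness lemma expects.\<close>
    define C where "C j = {c. \<forall>m. c m \<in> F m \<and> c m = parent 1 (c (Suc m))} \<inter> {c. w \<in> E j (c (n j))}" for j
    have C: "c \<in> C j \<longleftrightarrow> c \<in> dyadic_branches \<and> (c, w) \<in> A j \<and> c 0 \<in> F 0" for c j
    proof -
      have "c \<in> C j \<longleftrightarrow> c \<in> dyadic_branches \<and> w \<in> E j (c (n j)) \<and> (\<forall>m. c m \<in> F m)"
        unfolding C_def dyadic_branches_def by blast
      also have "\<dots> \<longleftrightarrow> c \<in> dyadic_branches \<and> w \<in> E j (c (n j)) \<and> c 0 \<in> F 0"
        using F0[of c] by blast
      finally show ?thesis by (auto simp: AE cylinder_def)
    qed
    have "(\<Inter>j\<in>J. C j) \<noteq> {}" if J: "finite J" for J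
    proof -
      obtain m where m: "\<And>j. j \<in> J \<Longrightarrow> j \<le> m"
        using J finite_nat_set_iff_bounded_le by auto
      obtain c where "c \<in> C m"
        using w[of m] inB C by auto
      then have "c \<in> C j" if "j \<in> J" for j
        using mono[OF m[OF that]] C by auto
      then show ?thesis by blast
    qed
    then have "(\<Inter>j. C j) \<noteq> {}"
      by (rule product_discrete_compactness[OF fin C_def, rotated])
    then obtain c where "\<And>j. c \<in> C j" by blast
    then have "(c, w) \<in> (\<Inter>j. A j)" using C by blast
    with A(3) show False by simp
  qed
  moreover have "decseq B"
    unfolding decseq_def using mono inB by blast
  ultimately have "(\<lambda>j. measure P (B j)) \<longlonglongrightarrow> 0"
    using finite_Lim_measure_decseq[of B] B by (simp add: image_subset_iff)
  then have "\<forall>\<^sub>F j in sequentially. measure P (B j) < e / 2"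
    by (rule order_tendstoD(2)) (use \<open>e > 0\<close> in simp)
  then obtain j0 where j0: "\<And>j. j \<ge> j0 \<Longrightarrow> measure P (B j) < e / 2"
    unfolding eventually_sequentially by blast
  have "dist (branch_content (A j)) 0 < e" if j: "j \<ge> j0" for j
  proof -
    let ?S = "{(x, w). ((\<lambda>n. dyadic n (x :: real ^ 'n)), w) \<in> A j}"
    let ?K = "cball (0 :: real ^ 'n) R \<times> space P"
    have Aj: "A j \<in> cylinders" using A(1) by blast
    have bK: "bm (indicator ?K)"
      by (intro bounded_measurable_indicator pair_measureI) auto
    have bB: "bm (indicator (UNIV \<times> B j))"
      by (intro bounded_measurable_indicator pair_measureI) auto
    have b: "bm (\<lambda>z. indicator (UNIV \<times> B j) z + (1 + (-1) * indicator ?K z))"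
      by (intro bounded_measurable_add bm_const bounded_measurable_mult bK bB)
    \<comment> \<open>A point of the pullback of \<open>A j\<close> lies over \<open>B j\<close> or
      outside the ball, and the latter costs at most \<open>e / 2\<close> by tightness.\<close>
    have "branch_content (A j) \<le> L (\<lambda>z. indicator (UNIV \<times> B j) z + (1 + (-1) * indicator ?K z))"
      unfolding branch_content_def
    proof (rule L_mono[OF bounded_measurable_indicator[OF cylinder_preimage_measurable[OF Aj]] b])
      fix z assume "z \<in> space (borel \<Otimes>\<^sub>M P :: ((real ^ 'n) \<times> 'w) measure)"
      then obtain x w where z: "z = (x, w)" "w \<in> space P" by (auto simp: space_M)
      have "w \<in> B j" if "z \<in> ?S" "z \<in> ?K"
      proof -
        have "\<bar>x $ i\<bar> \<le> R" for i
          using that(2) component_le_norm_cart[of x i] by (auto simp: z)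
        then have "dyadic 0 x \<in> F 0"
          by (auto simp: F_def dyadic_def N_def abs_le_iff) (smt (verit) le_floor_iff ceiling_correct of_int_minus of_int_add of_int_1 floor_le_iff)+
        with that(1) show ?thesis
          using dyadic_branch by (auto simp: inB z)
      qed
      then show "indicator ?S z \<le> indicator (UNIV \<times> B j) z + (1 + (-1) * indicator ?K z :: real)"
        by (auto simp: indicator_def z)
    qed
    also have "\<dots> = measure P (B j) + (1 + (-1) * L (indicator ?K))"
      by (simp only: L_add L_mult L_const L_marginal[OF B] bK bB bounded_measurable_add
          bounded_measurable_mult bm_const)
    also have "\<dots> < e" using j0[OF j] R by simp
    finally show ?thesis using branch_content_nonneg[OF Aj] by simp
  qed
  then show "\<exists>j0. \<forall>j\<ge>j0. dist (branch_content (A j)) 0 < e" by blast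
qed

lemma cylinder_whole: "cylinder 0 (\<lambda>_. space P) = branch_space"
  by (auto simp: cylinder_def branch_space_def)

text \<open>Caratheodory extension: for a finite content on a ring, continuity at the empty set
  amounts to countable additivity.\<close>

lemma branch_measure_exists:
  "\<exists>N. prob_space N \<and> space N = branch_space \<and> sets N = sigma_sets branch_space cylinders \<and>
     (\<forall>A\<in>cylinders. measure N A = branch_content A)"
proof -
  interpret ring_of_sets branch_space cylinders by (rule ring_of_sets_cylinders)
  let ?f = "\<lambda>A. ennreal (branch_content A)"
  have "branch_content {} = 0"
    by (simp add: branch_content_def L_indicator_empty)
  have "\<exists>\<mu>. (\<forall>s\<in>cylinders. \<mu> s = ?f s) \<and> measure_space branch_space (sigma_sets branch_space cylinders) \<mu>"
  proof (rule caratheodory_empty_continuous)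
    show "positive cylinders ?f"
      using \<open>branch_content {} = 0\<close> by (simp add: positive_def)
    show "additive cylinders ?f"
      unfolding additive_def
      by (auto simp: branch_content_add branch_content_nonneg ennreal_plus simp del: ennreal_plus[symmetric])
    fix A assume "range A \<subseteq> cylinders" "decseq A" "(\<Inter>i. A i) = {}"
    from tendsto_ennrealI[OF branch_content_tendsto_0[OF this]]
    show "(\<lambda>i. ?f (A i)) \<longlonglongrightarrow> 0" by simp
  qed simp
  then obtain \<mu> where \<mu>: "\<And>s. s \<in> cylinders \<Longrightarrow> \<mu> s = ?f s"
    "measure_space branch_space (sigma_sets branch_space cylinders) \<mu>" by blast
  define N where "N = measure_of branch_space (sigma_sets branch_space cylinders) \<mu>"
  have sub: "cylinders \<subseteq> Pow branch_space" by (rule space_closed)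
  have sub2: "sigma_sets branch_space cylinders \<subseteq> Pow branch_space"
    using sigma_sets_into_sp[OF sub] by blast
  have sp: "space N = branch_space" and se: "sets N = sigma_sets branch_space cylinders"
    unfolding N_def using sets_measure_of[OF sub2] sigma_sets_sigma_sets_eq[OF sub]
    by (simp_all add: space_measure_of_conv)
  have em: "emeasure N A = ?f A" if "A \<in> cylinders" for A
    using \<mu>(1)[OF that] emeasure_measure_of_sigma[of branch_space "sigma_sets branch_space cylinders" \<mu> A]
      \<mu>(2) that by (simp add: N_def measure_space_def)
  have whole: "branch_space \<in> cylinders"
    unfolding cylinders_def using cylinder_whole by blast
  have "branch_content branch_space = 1"
  proof -
    have "{(x, w). ((\<lambda>n. dyadic n (x :: real ^ 'n)), w) \<in> branch_space} = UNIV \<times> space P"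
      using dyadic_branch by (auto simp: branch_space_def)
    then show ?thesis by (simp add: branch_content_def L_marginal prob_space)
  qed
  then have "prob_space N"
    by (intro prob_spaceI) (simp add: sp em whole)
  moreover have "measure N A = branch_content A" if "A \<in> cylinders" for A
    using em[OF that] branch_content_nonneg[OF that] by (simp add: measure_def)
  ultimately show ?thesis using sp se by blast
qed


lemma L_sum:
  assumes "finite J" "\<And>j. j \<in> J \<Longrightarrow> bm (f j)"
  shows "bm (\<lambda>z. \<Sum>j\<in>J. a j * f j z) \<and> L (\<lambda>z. \<Sum>j\<in>J. a j * f j z) = (\<Sum>j\<in>J. a j * L (f j))"
  using assms
proof (induction J)
  case empty
  then show ?case using bm_const[of 0] L_const[of 0] by simp
next
  case (insert j J)
  then have IH: "bm (\<lambda>z. \<Sum>j\<in>J. a j * f j z)"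
    "L (\<lambda>z. \<Sum>j\<in>J. a j * f j z) = (\<Sum>j\<in>J. a j * L (f j))" and j: "bm (f j)" by auto
  from bounded_measurable_add[OF bounded_measurable_mult[OF j] IH(1)]
    L_add[OF bounded_measurable_mult[OF j] IH(1)] show ?case
    using insert.hyps by (simp add: L_mult[OF j] IH(2))
qed

text \<open>Only finite sums can be exchanged with \<open>L\<close>, so \<open>g\<close> is rounded
  to a grid of mesh \<open>1 / Suc k\<close>. Being bounded, it takes finitely many values there,
  and its level sets are cylinders, on which the measure is the value of \<open>L\<close> by
  construction.\<close>

lemma branch_integral:
  assumes N: "prob_space N" "space N = branch_space" "sets N = sigma_sets branch_space cylinders"
    "\<forall>A\<in>cylinders. measure N A = branch_content A"
    and g: "\<And>v. g v \<in> borel_measurable P" "\<And>v. \<forall>w\<in>space P. \<bar>g v w\<bar> \<le> B"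
  shows "bounded_measurable N (\<lambda>(c, w). g (c n) w)"
    and "bm (\<lambda>(x, w). g (dyadic n x) w)"
    and "(LINT (c, w)|N. g (c n) w) = L (\<lambda>(x, w). g (dyadic n x) w)"
proof -
  interpret N: prob_space N by (rule N(1))
  note [measurable] = g(1)
  have cyl: "cylinder n E \<in> sets N" "cylinder n E \<in> cylinders" if "\<And>v. E v \<in> sets P" for E
    using that by (auto simp: N(3) cylinders_def)
  show bN: "bounded_measurable N (\<lambda>(c, w). g (c n) w)"
  proof (rule bounded_measurableI[where B = B])
    have "{z \<in> space N. (case z of (c, w) \<Rightarrow> g (c n) w) \<le> a}
        = cylinder n (\<lambda>v. {w \<in> space P. g v w \<le> a})" for a
      by (auto simp: N(2) cylinder_def branch_space_def)
    then show "(\<lambda>(c, w). g (c n) w) \<in> borel_measurable N"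
      unfolding borel_measurable_iff_le by (auto intro!: cyl)
  qed (use g(2) in \<open>auto simp: N(2) branch_space_def\<close>)
  show bL: "bm (\<lambda>(x, w). g (dyadic n x) w)"
  proof (rule bounded_measurableI[where B = B])
    have "{z \<in> space (borel \<Otimes>\<^sub>M P). (case z of (x :: real ^ 'n, w) \<Rightarrow> g (dyadic n x) w) \<le> a}
        \<in> sets (borel \<Otimes>\<^sub>M P)" for a
    proof -
      have "{z \<in> space (borel \<Otimes>\<^sub>M P). (case z of (x :: real ^ 'n, w) \<Rightarrow> g (dyadic n x) w) \<le> a}
          = {(x, w). w \<in> (\<lambda>v. {w \<in> space P. g v w \<le> a}) (dyadic n x)}"
        by (auto simp: space_M)
      also have "\<dots> \<in> sets (borel \<Otimes>\<^sub>M P)"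
        by (rule dyadic_family_measurable) auto
      finally show ?thesis .
    qed
    then show "(\<lambda>(x, w). g (dyadic n x) w) \<in> borel_measurable (borel \<Otimes>\<^sub>M P)"
      unfolding borel_measurable_iff_le by blast
  qed (use g(2) in \<open>auto simp: space_M\<close>)
  have "\<bar>(LINT (c, w)|N. g (c n) w) - L (\<lambda>(x, w). g (dyadic n x) w)\<bar> \<le> 2 / real (Suc k)" for k
  proof -
    \<comment> \<open>Bounds the absolute value of every floor that occurs, rounding down at
      negative values included.\<close>
    define m where "m = \<lceil>real (Suc k) * B\<rceil> + 1"
    define J where "J = {- m..m}"
    define E where "E j v = {w \<in> space P. \<lfloor>real (Suc k) * g v w\<rfloor> = j}" for j v
    have E[measurable]: "E j v \<in> sets P" for j v
      unfolding E_def by measurable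
    define h where "h v w = real_of_int \<lfloor>real (Suc k) * g v w\<rfloor> / real (Suc k)" for v w
    have close: "\<bar>g v w - h v w\<bar> \<le> 1 / real (Suc k)" for v w
    proof -
      have "\<bar>real (Suc k) * g v w - real_of_int \<lfloor>real (Suc k) * g v w\<rfloor>\<bar> \<le> 1" by linarith
      moreover have "g v w - h v w
          = (real (Suc k) * g v w - real_of_int \<lfloor>real (Suc k) * g v w\<rfloor>) / real (Suc k)"
        by (simp add: h_def field_simps)
      ultimately show ?thesis by (simp add: abs_divide divide_right_mono)
    qed
    let ?a = "\<lambda>j. real_of_int j / real (Suc k)"
    have hsum: "h v w = (\<Sum>j\<in>J. ?a j * indicator (E j v) w)" if w: "w \<in> space P" for v w
    proof -
      have "\<bar>real (Suc k) * g v w\<bar> \<le> real (Suc k) * B"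
        using g(2)[of v] w by (simp add: abs_mult)
      then have "\<lfloor>real (Suc k) * g v w\<rfloor> \<in> J"
        unfolding J_def m_def by (simp only: atLeastAtMost_iff) linarith
      then have "(\<Sum>j\<in>J. ?a j * indicator (E j v) w) =
          (\<Sum>j\<in>{\<lfloor>real (Suc k) * g v w\<rfloor>}. ?a j * indicator (E j v) w)"
        by (intro sum.mono_neutral_right) (auto simp: J_def E_def)
      then show ?thesis using w by (simp add: h_def E_def)
    qed
    let ?S = "\<lambda>j. {(x, w). w \<in> E j (dyadic n (x :: real ^ 'n))}"
    have S: "bm (indicator (?S j))" for j
      by (intro bounded_measurable_indicator dyadic_family_measurable) auto
    have fin: "finite J" by (simp add: J_def)
    have content: "measure N (cylinder n (E j)) = L (indicator (?S j))" for j
      using cyl(2)[of "E j"] N(4) by (simp add: branch_content_def cylinder_preimage)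
    have "(LINT z|N. (\<Sum>j\<in>J. ?a j * indicator (cylinder n (E j)) z))
        = (\<Sum>j\<in>J. ?a j * measure N (cylinder n (E j)))"
      using cyl(1)[of "E j" for j]
      by (subst Bochner_Integration.integral_sum) (auto simp: N.emeasure_eq_measure)
    also have "\<dots> = L (\<lambda>z. \<Sum>j\<in>J. ?a j * indicator (?S j) z)"
      by (simp only: L_sum[OF fin S, THEN conjunct2] content)
    finally have eq: "(LINT z|N. (\<Sum>j\<in>J. ?a j * indicator (cylinder n (E j)) z))
      = L (\<lambda>z. \<Sum>j\<in>J. ?a j * indicator (?S j) z)" .
    have "\<bar>(LINT (c, w)|N. g (c n) w) - (LINT z|N. (\<Sum>j\<in>J. ?a j * indicator (cylinder n (E j)) z))\<bar>
        \<le> 1 / real (Suc k)"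
    proof -
      have i1: "integrable N (\<lambda>(c, w). g (c n) w)"
        by (rule N.integrable_bounded_measurable[OF bN])
      have i2: "integrable N (\<lambda>z. \<Sum>j\<in>J. ?a j * indicator (cylinder n (E j)) z)"
        using cyl(1)[of "E j" for j] by (intro Bochner_Integration.integrable_sum) (auto simp: N.emeasure_eq_measure)
      have "\<bar>(case z of (c, w) \<Rightarrow> g (c n) w) - (\<Sum>j\<in>J. ?a j * indicator (cylinder n (E j)) z)\<bar>
          \<le> 1 / real (Suc k)" if "z \<in> space N" for z
      proof -
        obtain c w where z: "z = (c, w)" "c \<in> dyadic_branches" "w \<in> space P"
          using \<open>z \<in> space N\<close> by (auto simp: N(2) branch_space_def)
        have "(\<Sum>j\<in>J. ?a j * indicator (cylinder n (E j)) z) = h (c n) w"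
          unfolding hsum[OF z(3)] by (intro sum.cong) (auto simp: z cylinder_def indicator_def)
        then show ?thesis using close by (simp add: z)
      qed
      then show ?thesis by (rule N.abs_integral_diff_le[OF i1 i2])
    qed
    moreover have "\<bar>L (\<lambda>(x, w). g (dyadic n x) w) - L (\<lambda>z. \<Sum>j\<in>J. ?a j * indicator (?S j) z)\<bar>
        \<le> 1 / real (Suc k)"
    proof (rule L_abs_diff_le[OF bL])
      show "bm (\<lambda>z. \<Sum>j\<in>J. ?a j * indicator (?S j) z)"
        by (rule L_sum[OF fin S, THEN conjunct1])
      fix x :: "real ^ 'n" and w assume w: "w \<in> space P"
      have "(\<Sum>j\<in>J. ?a j * indicator (?S j) (x, w)) = h (dyadic n x) w"
        unfolding hsum[OF w] by (intro sum.cong) (auto simp: indicator_def)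
      then show "\<bar>(case (x, w) of (x, w) \<Rightarrow> g (dyadic n x) w)
          - (\<Sum>j\<in>J. ?a j * indicator (?S j) (x, w))\<bar> \<le> 1 / real (Suc k)"
        using close by simp
    qed
    moreover have "2 / real (Suc k) = 1 / real (Suc k) + 1 / real (Suc k)" by simp
    ultimately show ?thesis
      using eq by linarith
  qed
  moreover have "(\<lambda>k. 2 / real (Suc k)) \<longlonglongrightarrow> 0"
    using LIMSEQ_Suc[OF lim_const_over_n[of 2]] by simp
  ultimately have "\<bar>(LINT (c, w)|N. g (c n) w) - L (\<lambda>(x, w). g (dyadic n x) w)\<bar> \<le> 0"
    by (intro LIMSEQ_le_const) auto
  then show "(LINT (c, w)|N. g (c n) w) = L (\<lambda>(x, w). g (dyadic n x) w)" by simp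
qed

text \<open>Lipschitz functions are uniformly approximated by functions of the dyadic digits, and on
  those the mean agrees with the measure on branches.\<close>

lemma representing_measure_exists:
  obtains \<nu> where "prob_space \<nu>" "sets \<nu> = sets (borel \<Otimes>\<^sub>M P)"
    "\<And>h C. bm h \<Longrightarrow> (\<And>x y w. w \<in> space P \<Longrightarrow> \<bar>h (x, w) - h (y, w)\<bar> \<le> C * norm (x - y)) \<Longrightarrow>
       integral\<^sup>L \<nu> h = L h"
proof -
  obtain N where N: "prob_space N" "space N = branch_space" "sets N = sigma_sets branch_space cylinders"
    "\<forall>A\<in>cylinders. measure N A = branch_content A"
    using branch_measure_exists by blast
  interpret N: prob_space N by (rule N(1))
  have cyl: "cylinder n E \<in> sets N" if "\<And>v. E v \<in> sets P" for n E
    using that by (auto simp: N(3) cylinders_def)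
  have snd[measurable]: "snd \<in> N \<rightarrow>\<^sub>M P"
  proof (rule measurableI)
    fix E assume E: "E \<in> sets P"
    have "snd -` E \<inter> space N = cylinder 0 (\<lambda>_. E)"
      using sets.sets_into_space[OF E] by (auto simp: N(2) branch_space_def cylinder_def)
    then show "snd -` E \<inter> space N \<in> sets N" using cyl E by simp
  qed (auto simp: N(2) branch_space_def)
  have coord: "(\<lambda>z. dyadic_point n (fst z n)) \<in> borel_measurable N" for n
  proof (rule borel_measurableI)
    fix S :: "(real ^ 'n) set"
    have "(\<lambda>z. dyadic_point n (fst z n)) -` S \<inter> space N
        = cylinder n (\<lambda>v. if dyadic_point n v \<in> S then space P else {})"
      by (auto simp: N(2) branch_space_def cylinder_def split: if_splits)
    then show "(\<lambda>z. dyadic_point n (fst z n)) -` S \<inter> space N \<in> sets N" by (auto intro: cyl)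
  qed
  \<comment> \<open>A pointwise limit of functions each of which depends on a single digit.\<close>
  have bp[measurable]: "(\<lambda>z. branch_point (fst z)) \<in> borel_measurable N"
    by (rule borel_measurable_LIMSEQ_metric[OF coord])
      (auto simp: N(2) branch_space_def intro: branch_point(1))
  let ?M = "borel \<Otimes>\<^sub>M P :: ((real ^ 'n) \<times> 'w) measure"
  \<comment> \<open>The representing measure is the image under passage to limit points. Mass that
    approaches a face from outside a half-open cube is thereby placed on the face.\<close>
  define T where "T = (\<lambda>z :: (nat \<Rightarrow> int ^ 'n) \<times> 'w. (branch_point (fst z) :: real ^ 'n, snd z))"
  have T[measurable]: "T \<in> N \<rightarrow>\<^sub>M ?M" unfolding T_def by measurable
  have "integral\<^sup>L (distr N ?M T) h = L h"
    if h: "bm h" "\<And>x y w. w \<in> space P \<Longrightarrow> \<bar>h (x, w) - h (y, w)\<bar> \<le> C * norm (x - y)" for h C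
  proof -
    obtain B where hm[measurable]: "h \<in> borel_measurable ?M" and B: "\<And>z. z \<in> space ?M \<Longrightarrow> \<bar>h z\<bar> \<le> B"
      using bounded_measurableE[OF h(1)] by blast
    have C: "C \<ge> 0"
    proof -
      obtain w where "w \<in> space P" using not_empty by blast
      from order_trans[OF abs_ge_zero h(2)[OF this, of "axis undefined 1" 0]] show ?thesis
        by (simp add: norm_axis_1)
    qed
    let ?e = "\<lambda>n. C * (real CARD('n) * (1 / 2 ^ n))"
    define g where "g n = (\<lambda>v w. h (dyadic_point n v, w))" for n
    have g: "g n v \<in> borel_measurable P" "\<forall>w\<in>space P. \<bar>g n v w\<bar> \<le> B" for n v
      unfolding g_def using B by (measurable, auto simp: space_M)
    note bi = branch_integral[OF N, of "g n" B n for n, OF g]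
    have le1: "\<bar>L h - L (\<lambda>(x, w). g n (dyadic n x) w)\<bar> \<le> ?e n" for n
    proof (rule L_abs_diff_le[OF h(1) bi(2)])
      fix x :: "real ^ 'n" and w assume w: "w \<in> space P"
      have "\<bar>h (x, w) - h (dyadic_point n (dyadic n x), w)\<bar> \<le> C * norm (x - dyadic_point n (dyadic n x))"
        by (rule h(2)[OF w])
      also have "\<dots> \<le> ?e n" using C by (intro mult_left_mono dyadic_point_dyadic)
      finally show "\<bar>h (x, w) - (case (x, w) of (x, w) \<Rightarrow> g n (dyadic n x) w)\<bar> \<le> ?e n"
        by (simp add: g_def)
    qed
    have le2: "\<bar>(LINT z|N. h (T z)) - (LINT (c, w)|N. g n (c n) w)\<bar> \<le> ?e n" for n
    proof -
      have "bounded_measurable N (\<lambda>z. h (T z))"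
        using measurable_space[OF T] B by (intro bounded_measurableI[where B = B]) auto
      then have i1: "integrable N (\<lambda>z. h (T z))" by (rule N.integrable_bounded_measurable)
      have i2: "integrable N (\<lambda>(c, w). g n (c n) w)" by (rule N.integrable_bounded_measurable[OF bi(1)])
      have "\<bar>h (T z) - (case z of (c, w) \<Rightarrow> g n (c n) w)\<bar> \<le> ?e n" if z: "z \<in> space N" for z
      proof -
        obtain c w where cw: "z = (c, w)" "c \<in> dyadic_branches" "w \<in> space P"
          using z by (auto simp: N(2) branch_space_def)
        have "\<bar>h (branch_point c, w) - h (dyadic_point n (c n), w)\<bar>
            \<le> C * norm (branch_point c - dyadic_point n (c n))"
          by (rule h(2)[OF cw(3)])
        also have "\<dots> \<le> ?e n" using C by (intro mult_left_mono branch_point(2) cw)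
        finally show ?thesis by (simp add: g_def T_def cw)
      qed
      then show ?thesis by (rule N.abs_integral_diff_le[OF i1 i2])
    qed
    have "\<bar>(LINT z|N. h (T z)) - L h\<bar> \<le> 2 * ?e n" for n
      using le1[of n] le2[of n] bi(3)[of n] by linarith
    moreover have "(\<lambda>n. 2 * ?e n) \<longlonglongrightarrow> 0"
      by (intro tendsto_mult_right_zero) (simp add: LIMSEQ_divide_realpow_zero)
    ultimately have "\<bar>(LINT z|N. h (T z)) - L h\<bar> \<le> 0"
      by (intro LIMSEQ_le_const) auto
    then show ?thesis by (simp add: integral_distr)
  qed
  then show ?thesis
    using that[of "distr N ?M T"] N.prob_space_distr[OF T] by auto
qed

end

text \<open>Indicators of closed sets are decreasing limits of the cutoffs
  \<open>max 0 (1 - real n * infdist x A)\<close>. Their Lipschitz constants grow with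
  \<open>n\<close>, so \<open>C\<close> has to be free to depend on \<open>g\<close>. Rectangles
  over closed sets generate the product and are stable under intersection.\<close>

lemma lipschitz_test_functions_determine:
  fixes \<nu> \<nu>' :: "('a::euclidean_space \<times> 'w) measure"
  assumes "prob_space \<nu>" "prob_space \<nu>'" and sets: "sets \<nu> = sets (borel \<Otimes>\<^sub>M P)" "sets \<nu>' = sets (borel \<Otimes>\<^sub>M P)"
    and eq: "\<And>g E C. E \<in> sets P \<Longrightarrow> (\<And>x. 0 \<le> g x \<and> g x \<le> 1) \<Longrightarrow> (\<And>x y. \<bar>g x - g y\<bar> \<le> C * norm (x - y)) \<Longrightarrow>
      (LINT z|\<nu>. g (fst z) * indicator E (snd z)) = (LINT z|\<nu>'. g (fst z) * indicator E (snd z))"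
  shows "\<nu> = \<nu>'"
proof -
  interpret \<nu>: prob_space \<nu> by fact
  interpret \<nu>': prob_space \<nu>' by fact
  have sp: "space \<nu> = UNIV \<times> space P" "space \<nu>' = UNIV \<times> space P"
    using sets[THEN sets_eq_imp_space_eq] by (simp_all add: space_pair_measure)
  have rect: "measure \<nu> (A \<times> E) = measure \<nu>' (A \<times> E)" if A: "closed A" and E: "E \<in> sets P" for A E
  \<comment> \<open>By convention \<open>infdist\<close> from the empty set is 0, which would turn
    all cutoffs into the constant 1.\<close>
  proof (cases "A = {}")
    case False
    define g where "g n x = max 0 (1 - real n * infdist x A)" for n x
    have g: "0 \<le> g n x \<and> g n x \<le> 1" for n x
      by (auto simp: g_def infdist_nonneg)
    have lip: "\<bar>g n x - g n y\<bar> \<le> real n * norm (x - y)" for n x y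
    proof -
      have "\<bar>infdist x A - infdist y A\<bar> \<le> dist x y"
        using infdist_triangle_abs by blast
      then have "real n * \<bar>infdist x A - infdist y A\<bar> \<le> real n * norm (x - y)"
        by (intro mult_left_mono) (auto simp: dist_norm)
      then have "\<bar>real n * infdist x A - real n * infdist y A\<bar> \<le> real n * norm (x - y)"
        by (simp add: abs_mult right_diff_distrib[symmetric])
      then show ?thesis unfolding g_def by arith
    qed
    have lim: "(\<lambda>n. g n x) \<longlonglongrightarrow> indicator A x" for x
    proof (cases "x \<in> A")
      case True
      then show ?thesis by (simp add: g_def)
    next
      case False
      then have d: "infdist x A > 0"
        using A \<open>A \<noteq> {}\<close> by (simp add: infdist_pos_not_in_closed)
      obtain n0 where n0: "real n0 * infdist x A > 1" using ex_less_of_nat_mult[OF d] by blast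
      then have "g n x = 0" if "n \<ge> n0" for n
      proof -
        have "real n0 * infdist x A \<le> real n * infdist x A"
          using that d by (intro mult_right_mono) auto
        with n0 show ?thesis by (simp add: g_def)
      qed
      then have "\<forall>\<^sub>F n in sequentially. g n x = 0" by (auto simp: eventually_sequentially)
      then show ?thesis using False by (simp add: tendsto_eventually)
    qed
    have gm[measurable]: "g n \<in> borel_measurable borel" for n
      unfolding g_def by (intro borel_measurable_continuous_onI continuous_intros)
    have AE[measurable]: "A \<times> E \<in> sets (borel \<Otimes>\<^sub>M P)" using A E by auto
    have meas: "(\<lambda>n. LINT z|N. g n (fst z) * indicator E (snd z)) \<longlonglongrightarrow> measure N (A \<times> E)"
      if N: "prob_space N" "sets N = sets (borel \<Otimes>\<^sub>M P)" for N :: "('a \<times> 'w) measure"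
    proof -
      interpret N: prob_space N by (rule N(1))
      have "(\<lambda>n. LINT z|N. g n (fst z) * indicator E (snd z)) \<longlonglongrightarrow> (LINT z|N. indicator (A \<times> E) z)"
      proof (rule integral_dominated_convergence[where w = "\<lambda>_. 1"])
        show "indicator (A \<times> E) \<in> borel_measurable N"
          using AE N(2) by (intro borel_measurable_indicator) simp
        show "(\<lambda>z. g n (fst z) * indicator E (snd z)) \<in> borel_measurable N" for n
          unfolding measurable_cong_sets[OF N(2) refl] using E by measurable
        have "(\<lambda>n. g n (fst z) * indicator E (snd z)) \<longlonglongrightarrow> indicator A (fst z) * indicator E (snd z)" for z
          by (intro tendsto_mult lim tendsto_const)
        then show "AE z in N. (\<lambda>n. g n (fst z) * indicator E (snd z)) \<longlonglongrightarrow> indicator (A \<times> E) z"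
          by (auto simp: indicator_times)
        show "AE z in N. norm (g n (fst z) * indicator E (snd z)) \<le> 1" for n
          using g by (auto simp: indicator_def)
      qed simp
      then show ?thesis using AE N(2) sets.sets_into_space[of "A \<times> E" N] by (simp add: Int_absorb1)
    qed
    show ?thesis
      using LIMSEQ_unique[OF meas[OF assms(1) sets(1)]] meas[OF assms(2) sets(2)] eq[OF E g lip] by simp
  qed simp
  let ?G = "{A \<times> E | (A :: 'a set) E. A \<in> Collect closed \<and> E \<in> sets P}"
  have "sets ((borel :: 'a measure) \<Otimes>\<^sub>M P) = sets (sigma UNIV (Collect closed :: 'a set set) \<Otimes>\<^sub>M sigma (space P) (sets P))"
    by (intro sets_pair_measure_cong) (simp_all add: borel_eq_closed[symmetric] sets.sigma_sets_eq)
  also have "sigma UNIV (Collect closed :: 'a set set) \<Otimes>\<^sub>M sigma (space P) (sets P)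
      = sigma (UNIV \<times> space P) ?G"
    by (rule sigma_prod)
      (auto dest: sets.sets_into_space intro: exI[of _ "{UNIV}"] exI[of _ "{space P}"])
  finally have gen: "sets ((borel :: 'a measure) \<Otimes>\<^sub>M P) = sets (sigma (UNIV \<times> space P) ?G)" .
  have GP: "?G \<subseteq> Pow (UNIV \<times> space P)"
    using sets.sets_into_space by fast
  have gen': "sets ((borel :: 'a measure) \<Otimes>\<^sub>M P) = sigma_sets (UNIV \<times> space P) ?G"
    using gen GP by simp
  show ?thesis
  proof (rule measure_eqI_generator_eq[where \<Omega> = "UNIV \<times> space P" and E = ?G and A = "\<lambda>_. UNIV \<times> space P"])
    show "Int_stable ?G"
      unfolding Int_stable_def
    proof (intro ballI)
      fix a b assume "a \<in> ?G" "b \<in> ?G"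
      then obtain A E A' E' where "a = A \<times> E" "b = A' \<times> E'" "closed A" "E \<in> sets P" "closed A'" "E' \<in> sets P"
        by auto
      then have "a \<inter> b = (A \<inter> A') \<times> (E \<inter> E')" "closed (A \<inter> A')" "E \<inter> E' \<in> sets P" by auto
      then show "a \<inter> b \<in> ?G" by blast
    qed
    show "?G \<subseteq> Pow (UNIV \<times> space P)" by (rule GP)
    show "sets \<nu> = sigma_sets (UNIV \<times> space P) ?G" "sets \<nu>' = sigma_sets (UNIV \<times> space P) ?G"
      using gen' sets by auto
    show "emeasure \<nu> X = emeasure \<nu>' X" if "X \<in> ?G" for X
      using that rect by (auto simp: \<nu>.emeasure_eq_measure \<nu>'.emeasure_eq_measure)
    show "range (\<lambda>_. UNIV \<times> space P) \<subseteq> ?G" by auto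
  qed auto
qed

section \<open>Dissipative differential equations driven by a path\<close>

definition ode_solution ::
    "('a::euclidean_space \<Rightarrow> 'a) \<Rightarrow> (real \<Rightarrow> 'a) \<Rightarrow> 'a \<Rightarrow> real \<Rightarrow> (real \<Rightarrow> 'a) \<Rightarrow> bool" where
  "ode_solution F b x T Y \<longleftrightarrow> continuous_on {0..T} Y \<and>
     (\<forall>t\<in>{0..T}. Y t = x + integral {0..t} (\<lambda>s. F (Y s)) + b t)"

lemma ode_solution_cong:
  assumes "ode_solution F b x T Y" "\<And>t. t \<in> {0..T} \<Longrightarrow> b t = b' t"
  shows "ode_solution F b' x T Y"
  using assms by (simp add: ode_solution_def)

text \<open>The driver cancels in the difference of two solutions, which is therefore differentiable
  however rough \<open>b\<close> is. The form with \<open>k\<close> covers both bounds on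
  \<open>F\<close>: \<open>k = 0\<close> with \<open>l > 0\<close> gives exponential separation,
  \<open>k = C1 / C2\<close> with \<open>l = - C2\<close> gives a bound uniform in time.\<close>

lemma ode_solution_contraction:
  fixes F :: "'a::euclidean_space \<Rightarrow> 'a"
  assumes F: "continuous_on UNIV F"
    and dis: "\<And>\<xi> \<eta>. (F \<xi> - F \<eta>) \<bullet> (\<xi> - \<eta>) \<le> l * ((norm (\<xi> - \<eta>))\<^sup>2 - k)"
    and Y: "ode_solution F b x T Y" and Z: "ode_solution F b y T Z" and t: "t \<in> {0..T}"
  shows "(norm (Y t - Z t))\<^sup>2 - k \<le> exp (2 * l * t) * ((norm (x - y))\<^sup>2 - k)"
proof -
  define u where "u s = x - y + (integral {0..s} (\<lambda>r. F (Y r)) - integral {0..s} (\<lambda>r. F (Z r)))" for s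
  have u: "u s = Y s - Z s" if "s \<in> {0..T}" for s
    using Y Z that by (simp add: ode_solution_def u_def)
  have cY: "continuous_on {0..T} (\<lambda>r. F (Y r))" and cZ: "continuous_on {0..T} (\<lambda>r. F (Z r))"
    using Y Z by (auto simp: ode_solution_def intro!: continuous_on_compose2[OF F])
  have du: "(u has_vector_derivative (F (Y s) - F (Z s))) (at s within {0..T})" if "s \<in> {0..T}" for s
    unfolding u_def using that
    by (auto intro!: derivative_eq_intros integral_has_vector_derivative cY cZ)
  \<comment> \<open>Integrating factor: the differential inequality for the squared norm says that
    \<open>p\<close> does not increase.\<close>
  define p where "p s = (u s \<bullet> u s - k) * exp (- (2 * l * s))" for s
  have "p t \<le> p 0"
  proof (rule DERIV_nonpos_imp_decreasing_open[where f = p])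
    show "0 \<le> t" using t by simp
    have "continuous_on {0..T} u"
      unfolding continuous_on_eq_continuous_within
      using has_vector_derivative_continuous[OF du] by blast
    then show "continuous_on {0..t} p"
      unfolding p_def using t by (intro continuous_intros) (auto intro: continuous_on_subset)
    fix s assume s: "0 < s" "s < t"
    have "at s within {0..T} = at s"
      using s t by (intro at_within_interior) auto
    with du[of s] s t have d: "(u has_vector_derivative (F (Y s) - F (Z s))) (at s)" by simp
    have "((\<lambda>s. u s \<bullet> u s) has_real_derivative 2 * ((F (Y s) - F (Z s)) \<bullet> u s)) (at s)"
      using has_derivative_inner[OF d[unfolded has_vector_derivative_def] d[unfolded has_vector_derivative_def]]
      unfolding has_field_derivative_def
      by (rule has_derivative_eq_rhs) (auto simp: inner_commute algebra_simps)
    then have "(p has_real_derivative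
        (2 * ((F (Y s) - F (Z s)) \<bullet> u s) - 2 * l * (u s \<bullet> u s - k)) * exp (- (2 * l * s))) (at s)"
      unfolding p_def by (auto intro!: derivative_eq_intros simp: algebra_simps)
    moreover have "2 * ((F (Y s) - F (Z s)) \<bullet> u s) - 2 * l * (u s \<bullet> u s - k) \<le> 0"
      using dis[of "Y s" "Z s"] u[of s] s t by (simp add: power2_norm_eq_inner)
    ultimately show "\<exists>y. DERIV p s :> y \<and> y \<le> 0"
      by (auto simp: mult_le_0_iff)
  qed
  moreover have "p 0 = (norm (x - y))\<^sup>2 - k"
    by (simp add: p_def u_def power2_norm_eq_inner)
  moreover have "p t = ((norm (Y t - Z t))\<^sup>2 - k) * exp (- (2 * l * t))"
    using u[OF t] by (simp add: p_def power2_norm_eq_inner)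
  ultimately have "exp (2 * l * t) * (((norm (Y t - Z t))\<^sup>2 - k) * exp (- (2 * l * t)))
      \<le> exp (2 * l * t) * ((norm (x - y))\<^sup>2 - k)"
    by (intro mult_left_mono) auto
  moreover have "exp (2 * l * t) * (((norm (Y t - Z t))\<^sup>2 - k) * exp (- (2 * l * t)))
      = (norm (Y t - Z t))\<^sup>2 - k"
    by (simp add: exp_minus)
  ultimately show ?thesis by simp
qed

text \<open>The restarted driver is reduced by \<open>b s\<close>, because the new initial value
  \<open>V s\<close> already contains it.\<close>

lemma ode_solution_shift:
  fixes F :: "'a::euclidean_space \<Rightarrow> 'a"
  assumes F: "continuous_on UNIV F" and V: "ode_solution F b x (s + t) V" and st: "0 \<le> s" "0 \<le> t"
  shows "ode_solution F (\<lambda>u. b (s + u) - b s) (V s) t (\<lambda>u. V (s + u))"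
  unfolding ode_solution_def
proof (intro conjI ballI)
  have cV: "continuous_on {0..s + t} V" using V by (simp add: ode_solution_def)
  then show "continuous_on {0..t} (\<lambda>u. V (s + u))"
    using st by (auto intro!: continuous_intros intro: continuous_on_compose2)
  fix u assume u: "u \<in> {0..t}"
  have "continuous_on {0..s + u} (\<lambda>r. F (V r))"
    using u by (intro continuous_on_compose2[OF F] continuous_on_subset[OF cV]) auto
  then have "integral {0..s} (\<lambda>r. F (V r)) + integral {s..s + u} (\<lambda>r. F (V r))
      = integral {0..s + u} (\<lambda>r. F (V r))"
    using u st by (intro Henstock_Kurzweil_Integration.integral_combine integrable_continuous_real) auto
  moreover have "integral {s..s + u} (\<lambda>r. F (V r)) = integral {0..u} (\<lambda>r. F (V (s + r)))"
    using integral_shift_cbox_plus[of 0 u "\<lambda>r. F (V r)" s] by (simp add: o_def add.commute)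
  moreover have "V (s + u) = x + integral {0..s + u} (\<lambda>r. F (V r)) + b (s + u)"
    "V s = x + integral {0..s} (\<lambda>r. F (V r)) + b s"
    using V u st by (auto simp: ode_solution_def)
  ultimately show "V (s + u) = V s + integral {0..u} (\<lambda>r. F (V (s + r))) + (b (s + u) - b s)"
    by (simp add: algebra_simps)
qed

section \<open>Measurability of solutions by Euler approximation\<close>

primrec euler :: "('a::euclidean_space \<Rightarrow> 'a) \<Rightarrow> (real \<Rightarrow> 'a) \<Rightarrow> 'a \<Rightarrow> real \<Rightarrow> nat \<Rightarrow> 'a" where
  "euler F b x d 0 = x + b 0"
| "euler F b x d (Suc k) =
     euler F b x d k + d *\<^sub>R F (euler F b x d k) + (b (real (Suc k) * d) - b (real k * d))"

text \<open>The scheme uses the exact increments of \<open>b\<close>, so these cancel in the error,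
  and only the modulus of continuity of the drift along the solution enters.\<close>

lemma euler_tendsto:
  fixes F :: "'a::euclidean_space \<Rightarrow> 'a"
  assumes lip: "\<And>\<xi> \<eta>. norm (F \<xi> - F \<eta>) \<le> C * norm (\<xi> - \<eta>)" and C: "C \<ge> 0"
    and Y: "ode_solution F b x T Y" and T: "T \<ge> 0"
  shows "(\<lambda>n. euler F b x (T / real (Suc n)) (Suc n)) \<longlonglongrightarrow> Y T"
proof (rule metric_LIMSEQ_I)
  fix e :: real assume e: "e > 0"
  \<comment> \<open>Chosen so that the accumulated error \<open>T * \<eta> * exp (C * T)\<close> is
    at most \<open>e / 2\<close>; the divisor \<open>T + 1\<close> in place of \<open>T\<close>
    admits \<open>T = 0\<close>.\<close>
  define \<eta> where "\<eta> = e / (2 * (T + 1) * exp (C * T))"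
  have \<eta>: "\<eta> > 0" using e T by (simp add: \<eta>_def)
  have F: "continuous_on UNIV F"
    by (intro lipschitz_on_continuous_on[of C]) (use lip C in \<open>auto simp: lipschitz_on_def dist_norm\<close>)
  have cY: "continuous_on {0..T} (\<lambda>r. F (Y r))"
    using Y by (auto simp: ode_solution_def intro!: continuous_on_compose2[OF F])
  then have "uniformly_continuous_on {0..T} (\<lambda>r. F (Y r))"
    by (intro compact_uniformly_continuous) auto
  then obtain d0 where d0: "d0 > 0"
    "\<And>r s. r \<in> {0..T} \<Longrightarrow> s \<in> {0..T} \<Longrightarrow> dist s r < d0 \<Longrightarrow> dist (F (Y s)) (F (Y r)) < \<eta>"
    using \<eta> unfolding uniformly_continuous_on_def by metis
  obtain n0 where n0: "T / real (Suc n0) < d0"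
  proof -
    have "(\<lambda>n. T / real (Suc n)) \<longlonglongrightarrow> 0"
      using LIMSEQ_Suc[OF lim_const_over_n[of T]] by simp
    then have "\<forall>\<^sub>F n in sequentially. T / real (Suc n) < d0"
      by (rule order_tendstoD(2)) (rule d0(1))
    then show ?thesis using that by (auto simp: eventually_sequentially)
  qed
  have "dist (euler F b x (T / real (Suc n)) (Suc n)) (Y T) < e" if n: "n \<ge> n0" for n
  proof -
    define d where "d = T / real (Suc n)"
    have d: "d \<ge> 0" "real (Suc n) * d = T" using T by (simp_all add: d_def)
    have "d \<le> T / real (Suc n0)"
      unfolding d_def using n T by (intro divide_left_mono) auto
    then have dd: "d < d0" using n0 by simp
    have kd: "real k * d \<in> {0..T}" if "k \<le> Suc n" for k
      using mult_right_mono[of "real k" "real (Suc n)" d] d that by simp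
    define E where "E k = norm (Y (real k * d) - euler F b x d k)" for k
    \<comment> \<open>Discrete Gronwall inequality: the Lipschitz bound propagates the old error,
      and the oscillation of the drift over one step adds \<open>d * \<eta>\<close>.\<close>
    have step: "E (Suc k) \<le> (1 + C * d) * E k + d * \<eta>" if k: "k \<le> n" for k
    proof -
      let ?s = "real k * d" and ?t = "real (Suc k) * d"
      have st: "?s \<in> {0..T}" "?t \<in> {0..T}" using kd[of k] kd[of "Suc k"] k by auto
      have ts: "?t = ?s + d" by (simp add: algebra_simps)
      have i1: "(\<lambda>r. F (Y r)) integrable_on {0..?t}"
        using st by (intro integrable_continuous_real continuous_on_subset[OF cY]) auto
      have i2: "(\<lambda>r. F (Y r)) integrable_on {?s..?t}"
        using st by (intro integrable_continuous_real continuous_on_subset[OF cY]) auto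
      have c: "integral {0..?s} (\<lambda>r. F (Y r)) + integral {?s..?t} (\<lambda>r. F (Y r))
          = integral {0..?t} (\<lambda>r. F (Y r))"
        using st ts d(1) by (intro Henstock_Kurzweil_Integration.integral_combine i1) auto
      have Yt: "Y ?t = x + integral {0..?t} (\<lambda>r. F (Y r)) + b ?t"
        "Y ?s = x + integral {0..?s} (\<lambda>r. F (Y r)) + b ?s"
        using Y st unfolding ode_solution_def by blast+
      have dif: "integral {?s..?t} (\<lambda>r. F (Y r) - F (Y ?s))
          = integral {?s..?t} (\<lambda>r. F (Y r)) - d *\<^sub>R F (Y ?s)"
        using i2 ts d(1) by (subst Henstock_Kurzweil_Integration.integral_diff) auto
      have "norm (integral {?s..?t} (\<lambda>r. F (Y r) - F (Y ?s))) \<le> \<eta> * (?t - ?s)"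
      proof (rule integral_bound)
        show "continuous_on {?s..?t} (\<lambda>r. F (Y r) - F (Y ?s))"
          using st by (intro continuous_intros continuous_on_subset[OF cY]) auto
        fix r assume r: "r \<in> {?s..?t}"
        then show "norm (F (Y r) - F (Y ?s)) \<le> \<eta>"
          using d0(2)[of ?s r] st dd ts by (auto simp: dist_norm)
      qed (use ts d in simp)
      then have ib: "norm (integral {?s..?t} (\<lambda>r. F (Y r)) - d *\<^sub>R F (Y ?s)) \<le> d * \<eta>"
        unfolding dif unfolding ts by (simp add: mult.commute)
      have "Y ?t - euler F b x d (Suc k) = (Y ?s - euler F b x d k)
          + d *\<^sub>R (F (Y ?s) - F (euler F b x d k))
          + (integral {?s..?t} (\<lambda>r. F (Y r)) - d *\<^sub>R F (Y ?s))"
        unfolding Yt c[symmetric] euler.simps by (simp add: algebra_simps)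
      also have "norm \<dots> \<le> E k + d * (C * E k) + d * \<eta>"
        unfolding E_def
        by (intro norm_triangle_le add_mono ib order_refl) (use lip d in \<open>auto intro!: mult_left_mono\<close>)
      finally show ?thesis unfolding E_def by (simp add: algebra_simps)
    qed
    have E: "E k \<le> real k * (d * \<eta>) * (1 + C * d) ^ k" if "k \<le> Suc n" for k
      using that
    proof (induction k)
      case 0
      have "Y 0 = x + b 0" using Y T by (auto simp: ode_solution_def)
      then show ?case by (simp add: E_def)
    next
      case (Suc k)
      have q: "1 + C * d \<ge> 1" using C d by simp
      have "E (Suc k) \<le> (1 + C * d) * (real k * (d * \<eta>) * (1 + C * d) ^ k) + d * \<eta> * 1"
      proof -
        have "(1 + C * d) * E k \<le> (1 + C * d) * (real k * (d * \<eta>) * (1 + C * d) ^ k)"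
          using Suc q by (intro mult_left_mono Suc.IH) auto
        with step[of k] Suc.prems show ?thesis by simp
      qed
      also have "\<dots> \<le> (1 + C * d) * (real k * (d * \<eta>) * (1 + C * d) ^ k) + d * \<eta> * (1 + C * d) ^ Suc k"
        using q d \<eta> by (intro add_left_mono mult_left_mono one_le_power) auto
      finally show ?case by (simp add: algebra_simps)
    qed
    have "(1 + C * d) ^ Suc n \<le> exp (C * d) ^ Suc n"
      using C d by (intro power_mono) auto
    also have "\<dots> = exp (C * (real (Suc n) * d))"
      by (simp only: exp_of_nat_mult[symmetric] mult.left_commute)
    also have "\<dots> = exp (C * T)" by (simp only: d(2))
    finally have "E (Suc n) \<le> T * \<eta> * exp (C * T)"
      using E[of "Suc n"] d T \<eta> mult_left_mono[of "(1 + C * d) ^ Suc n" "exp (C * T)" "T * \<eta>"]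
      by (simp add: mult.assoc[symmetric] del: power_Suc)
    also have "\<dots> = T / (T + 1) * (e / 2)"
    proof -
      have "T * (e / (2 * q * r)) * r = T / q * (e / 2)" if "q \<noteq> 0" "r \<noteq> 0" for q r :: real
        using that by (simp add: field_simps)
      from this[of "T + 1" "exp (C * T)"] show ?thesis using T by (simp add: \<eta>_def)
    qed
    also have "\<dots> \<le> 1 * (e / 2)"
      using T e by (intro mult_right_mono) auto
    also have "\<dots> < e" using e by simp
    finally show ?thesis
      unfolding E_def d(2) d_def[symmetric] by (simp add: dist_norm norm_minus_commute)
  qed
  then show "\<exists>n0. \<forall>n\<ge>n0. dist (euler F b x (T / real (Suc n)) (Suc n)) (Y T) < e" by blast
qed

text \<open>The scheme reads \<open>b\<close> at finitely many times only; this is what makes it a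
  route to measurability of the solution.\<close>

lemma euler_measurable:
  assumes F[measurable]: "F \<in> borel_measurable borel" and X[measurable]: "X \<in> borel_measurable N"
    and b: "\<And>j. j \<le> k \<Longrightarrow> b (real j * d) \<in> borel_measurable N"
  shows "(\<lambda>\<omega>. euler F (\<lambda>s. b s \<omega>) (X \<omega>) d k) \<in> borel_measurable N"
  using b
proof (induction k)
  case 0
  then show ?case using 0[of 0] by simp
next
  case (Suc k)
  have [measurable]: "(\<lambda>\<omega>. euler F (\<lambda>s. b s \<omega>) (X \<omega>) d k) \<in> borel_measurable N"
    using Suc by auto
  have [measurable]: "b (real (Suc k) * d) \<in> borel_measurable N" "b (real k * d) \<in> borel_measurable N"
    using Suc.prems[of "Suc k"] Suc.prems[of k] by auto
  show ?case unfolding euler.simps by measurable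
qed

text \<open>The nearest-point map onto a ball is 1-Lipschitz and has values in a convex set, on
  which the derivative bound controls increments.\<close>

lemma differentiable_truncation_lipschitz:
  fixes F :: "'a::euclidean_space \<Rightarrow> 'a"
  assumes diff: "\<And>\<xi>. F differentiable (at \<xi>)"
    and bd: "\<And>\<xi>. norm \<xi> \<le> R \<Longrightarrow> onorm (frechet_derivative F (at \<xi>)) \<le> C" and R: "R \<ge> 0"
  shows "norm (F (closest_point (cball 0 R) \<xi>) - F (closest_point (cball 0 R) \<eta>)) \<le> C * norm (\<xi> - \<eta>)"
proof -
  let ?c = "closest_point (cball (0 :: 'a) R)"
  have ne: "cball (0 :: 'a) R \<noteq> {}" using R by simp
  have in_ball: "?c z \<in> cball 0 R" for z
    by (rule closest_point_in_set[OF closed_cball ne])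
  have dF: "(F has_derivative frechet_derivative F (at z)) (at z)" for z
    using diff frechet_derivative_works by blast
  have "0 \<le> C" using bd[of 0] R onorm_pos_le[OF has_derivative_bounded_linear[OF dF[of 0]]] by simp
  have "norm (F (?c \<xi>) - F (?c \<eta>)) \<le> C * norm (?c \<xi> - ?c \<eta>)"
  proof (rule differentiable_bound[OF convex_cball _ _ in_ball in_ball])
    show "(F has_derivative frechet_derivative F (at z)) (at z within cball 0 R)" for z
      using dF by (rule has_derivative_at_withinI)
  qed (use bd in auto)
  also have "\<dots> \<le> C * norm (\<xi> - \<eta>)"
    using closest_point_lipschitz[OF convex_cball closed_cball ne, of \<xi> \<eta>] \<open>0 \<le> C\<close>
    by (intro mult_left_mono) (auto simp: dist_norm)
  finally show ?thesis .
qed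

text \<open>\<open>F\<close> is only locally Lipschitz, so it is cut off at radius \<open>m\<close>.
  For each \<omega> the given solution is bounded on \<open>{0..T}\<close> and thus solves the
  cut-off equation once \<open>m\<close> is large; from then on the Euler values converge to it. For
  smaller \<open>m\<close> the function \<open>U m\<close> is still measurable, being defined by
  \<open>lim\<close> everywhere.\<close>

lemma ode_solution_measurable:
  fixes F :: "'a::euclidean_space \<Rightarrow> 'a"
  assumes diff: "\<And>\<xi>. F differentiable (at \<xi>)"
    and bd: "\<And>R. \<exists>C. \<forall>\<xi>. norm \<xi> \<le> R \<longrightarrow> onorm (frechet_derivative F (at \<xi>)) \<le> C"
    and T: "T \<ge> 0"
    and X: "X \<in> borel_measurable N" and b: "\<And>s. s \<in> {0..T} \<Longrightarrow> b s \<in> borel_measurable N"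
    and Y: "\<And>\<omega>. \<omega> \<in> space N \<Longrightarrow> ode_solution F (\<lambda>s. b s \<omega>) (X \<omega>) T (Y \<omega>)"
  shows "(\<lambda>\<omega>. Y \<omega> T) \<in> borel_measurable N"
proof -
  let ?F = "\<lambda>m :: nat. \<lambda>\<xi>. F (closest_point (cball 0 (real m)) \<xi>)"
  define U where "U m \<omega> = lim (\<lambda>n. euler (?F m) (\<lambda>s. b s \<omega>) (X \<omega>) (T / real (Suc n)) (Suc n))" for m \<omega>
  have cF: "continuous_on UNIV F"
    using diff by (simp add: continuous_at_imp_continuous_on differentiable_imp_continuous_within)
  have cp: "continuous_on UNIV (closest_point (cball (0 :: 'a) (real m)))" for m
    by (rule continuous_on_closest_point) auto
  have [measurable]: "?F m \<in> borel_measurable borel" for m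
    by (intro borel_measurable_continuous_onI continuous_on_compose2[OF cF cp]) auto
  have "U m \<in> borel_measurable N" for m
    unfolding U_def
  proof (rule borel_measurable_lim_metric, rule euler_measurable)
    fix n j assume j: "j \<le> Suc n"
    have "real j * (T / real (Suc n)) \<le> real (Suc n) * (T / real (Suc n))"
      using j T by (intro mult_right_mono) auto
    then show "b (real j * (T / real (Suc n))) \<in> borel_measurable N"
      using T by (intro b) simp
  qed (use X in measurable)
  then show ?thesis
  proof (rule borel_measurable_LIMSEQ_metric)
    fix \<omega> assume \<omega>: "\<omega> \<in> space N"
    have "continuous_on {0..T} (Y \<omega>)" using Y[OF \<omega>] by (simp add: ode_solution_def)
    then have "bounded (Y \<omega> ` {0..T})"
      by (intro compact_imp_bounded compact_continuous_image) auto
    then obtain B where "\<forall>y\<in>Y \<omega> ` {0..T}. norm y \<le> B"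
      unfolding bounded_iff by blast
    then have B: "norm (Y \<omega> s) \<le> B" if "s \<in> {0..T}" for s
      using that by blast
    obtain m0 :: nat where m0: "B \<le> real m0" using real_arch_simple by blast
    have "U m \<omega> = Y \<omega> T" if m: "m \<ge> m0" for m
    proof -
      have "?F m (Y \<omega> s) = F (Y \<omega> s)" if "s \<in> {0..T}" for s
        using B[OF that] m m0 by (subst closest_point_self) auto
      then have "integral {0..t} (\<lambda>s. ?F m (Y \<omega> s)) = integral {0..t} (\<lambda>s. F (Y \<omega> s))"
        if "t \<in> {0..T}" for t
        using that by (intro Henstock_Kurzweil_Integration.integral_cong) auto
      with Y[OF \<omega>] have sol: "ode_solution (?F m) (\<lambda>s. b s \<omega>) (X \<omega>) T (Y \<omega>)"
        by (simp add: ode_solution_def)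
      obtain C where C: "\<And>\<xi>. norm \<xi> \<le> real m \<Longrightarrow> onorm (frechet_derivative F (at \<xi>)) \<le> C"
        using bd by blast
      have lip: "norm (?F m \<xi> - ?F m \<eta>) \<le> \<bar>C\<bar> * norm (\<xi> - \<eta>)" for \<xi> \<eta>
        using C by (intro differentiable_truncation_lipschitz diff order_trans[OF _ abs_ge_self]) auto
      show ?thesis
        unfolding U_def by (rule limI, rule euler_tendsto[OF lip _ sol T]) simp
    qed
    then show "(\<lambda>m. U m \<omega>) \<longlonglongrightarrow> Y \<omega> T"
      by (intro tendsto_eventually) (auto simp: eventually_sequentially)
  qed
qed

section \<open>Path spaces\<close>

definition holder_weight :: "real \<Rightarrow> real \<Rightarrow> real \<Rightarrow> real" where
  "holder_weight h s t = sqrt (1 + \<bar>t\<bar> + \<bar>s\<bar>) * \<bar>t - s\<bar> powr ((1 - h) / 2)"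

text \<open>The quotient of the norm is multiplied out, which makes the diagonal harmless, where it
  reads \<open>0 / 0\<close>.\<close>

definition holder_bound :: "real \<Rightarrow> real \<Rightarrow> (real \<Rightarrow> real ^ 'n) \<Rightarrow> bool" where
  "holder_bound h C \<omega> \<longleftrightarrow> (\<forall>s\<le>0. \<forall>t\<le>0. norm (\<omega> t - \<omega> s) \<le> C * holder_weight h s t)"

lemma holder_weight_nonneg: "0 \<le> holder_weight h s t"
  by (simp add: holder_weight_def)

lemma holder_weight_pos: "s \<noteq> t \<Longrightarrow> 0 < holder_weight h s t"
  unfolding holder_weight_def by (intro mult_pos_pos) auto

lemma holder_norm_le:
  assumes "holder_bound h C \<omega>" "0 \<le> C"
  shows "holder_norm h \<omega> \<le> ennreal C"
  unfolding holder_norm_def holder_weight_def[symmetric]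
proof (intro SUP_least ennreal_leI)
  fix s t :: real assume "s \<in> {..0}" "t \<in> {..0}"
  then have "norm (\<omega> t - \<omega> s) \<le> C * holder_weight h s t"
    using assms by (simp add: holder_bound_def)
  then show "norm (\<omega> t - \<omega> s) / holder_weight h s t \<le> C"
    using holder_weight_pos[of s t h] assms(2) by (cases "s = t") (auto simp: divide_le_eq)
qed

lemma holder_bound_norm:
  assumes "holder_norm h \<omega> < \<infinity>"
  shows "holder_bound h (enn2real (holder_norm h \<omega>)) \<omega>"
  unfolding holder_bound_def
proof (intro allI impI)
  fix s t :: real assume st: "s \<le> 0" "t \<le> 0"
  show "norm (\<omega> t - \<omega> s) \<le> enn2real (holder_norm h \<omega>) * holder_weight h s t"
  proof (cases "s = t")
    case False
    have "ennreal (norm (\<omega> t - \<omega> s) / holder_weight h s t) \<le> holder_norm h \<omega>"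
      unfolding holder_norm_def holder_weight_def
      using st by (intro SUP_upper2[of s] SUP_upper2[of t]) auto
    then have "norm (\<omega> t - \<omega> s) / holder_weight h s t \<le> enn2real (holder_norm h \<omega>)"
      using enn2real_mono[of "ennreal (norm (\<omega> t - \<omega> s) / holder_weight h s t)" "holder_norm h \<omega>"]
        assms holder_weight_nonneg[of h s t] by simp
    then show ?thesis
      using holder_weight_pos[OF False, of h] by (simp add: divide_le_eq)
  qed (simp add: holder_weight_def)
qed

lemma holder_space_iff:
  "\<omega> \<in> holder_space h \<longleftrightarrow> (\<forall>t\<ge>0. \<omega> t = 0) \<and> (\<exists>C\<ge>0. holder_bound h C \<omega>)"
proof -
  have "holder_norm h \<omega> < \<infinity> \<longleftrightarrow> (\<exists>C\<ge>0. holder_bound h C \<omega>)"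
    using holder_norm_le[of h _ \<omega>] holder_bound_norm[of h \<omega>] enn2real_nonneg
      le_less_trans[OF _ ennreal_less_top] by (metis infinity_ennreal_def)
  then show ?thesis by (simp add: holder_space_def)
qed

lemma holder_bound_lincomb:
  assumes "holder_bound h C \<omega>" "holder_bound h K \<eta>"
  shows "holder_bound h (\<bar>a\<bar> * C + \<bar>b\<bar> * K) (\<lambda>t. a *\<^sub>R \<omega> t + b *\<^sub>R \<eta> t)"
  unfolding holder_bound_def
proof (intro allI impI)
  fix s t :: real assume st: "s \<le> 0" "t \<le> 0"
  have "norm (a *\<^sub>R \<omega> t + b *\<^sub>R \<eta> t - (a *\<^sub>R \<omega> s + b *\<^sub>R \<eta> s))
      = norm (a *\<^sub>R (\<omega> t - \<omega> s) + b *\<^sub>R (\<eta> t - \<eta> s))"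
    by (simp add: algebra_simps)
  also have "\<dots> \<le> \<bar>a\<bar> * norm (\<omega> t - \<omega> s) + \<bar>b\<bar> * norm (\<eta> t - \<eta> s)"
    by (rule order_trans[OF norm_triangle_ineq]) simp
  also have "\<dots> \<le> \<bar>a\<bar> * (C * holder_weight h s t) + \<bar>b\<bar> * (K * holder_weight h s t)"
    using assms st unfolding holder_bound_def by (intro add_mono mult_left_mono) auto
  finally show "norm (a *\<^sub>R \<omega> t + b *\<^sub>R \<eta> t - (a *\<^sub>R \<omega> s + b *\<^sub>R \<eta> s))
      \<le> (\<bar>a\<bar> * C + \<bar>b\<bar> * K) * holder_weight h s t"
    by (simp add: algebra_simps)
qed

lemma holder_space_lincomb:
  assumes "\<omega> \<in> holder_space h" "\<eta> \<in> holder_space h"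
  shows "(\<lambda>t. a *\<^sub>R \<omega> t + b *\<^sub>R \<eta> t) \<in> holder_space h"
proof -
  obtain C K where "0 \<le> C" "holder_bound h C \<omega>" "0 \<le> K" "holder_bound h K \<eta>"
    using assms by (auto simp: holder_space_iff)
  then have "holder_bound h (\<bar>a\<bar> * C + \<bar>b\<bar> * K) (\<lambda>t. a *\<^sub>R \<omega> t + b *\<^sub>R \<eta> t)"
    "0 \<le> \<bar>a\<bar> * C + \<bar>b\<bar> * K"
    using holder_bound_lincomb by auto
  then show ?thesis
    using assms unfolding holder_space_iff by auto
qed

lemma holder_space_diff:
  "\<omega> \<in> holder_space h \<Longrightarrow> \<eta> \<in> holder_space h \<Longrightarrow> (\<lambda>t. \<omega> t - \<eta> t) \<in> holder_space h"
  using holder_space_lincomb[of \<omega> h \<eta> 1 "-1"] by simp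

lemma holder_dist_nonneg: "0 \<le> holder_dist h \<omega> \<eta>"
  by (simp add: holder_dist_def)

lemma holder_dist_commute: "holder_dist h \<omega> \<eta> = holder_dist h \<eta> \<omega>"
  by (rule Metric_space.commute[OF Metric_space_holder_space])

lemma holder_dist_le:
  assumes "holder_bound h C (\<lambda>t. \<omega> t - \<eta> t)" "0 \<le> C"
  shows "holder_dist h \<omega> \<eta> \<le> C"
  using holder_norm_le[OF assms] assms(2) unfolding holder_dist_def
  by (metis enn2real_leI)

lemma holder_bound_dist:
  assumes "\<omega> \<in> holder_space h" "\<eta> \<in> holder_space h"
  shows "holder_bound h (holder_dist h \<omega> \<eta>) (\<lambda>t. \<omega> t - \<eta> t)"
  using holder_space_diff[OF assms] unfolding holder_dist_def
  by (intro holder_bound_norm) (simp add: holder_space_def)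

lemma norm_diff_le_dist:
  assumes "\<omega> \<in> holder_space h" "\<eta> \<in> holder_space h" "t \<le> 0"
  shows "norm (\<omega> t - \<eta> t) \<le> holder_dist h \<omega> \<eta> * holder_weight h 0 t"
proof -
  have "norm ((\<omega> t - \<eta> t) - (\<omega> 0 - \<eta> 0)) \<le> holder_dist h \<omega> \<eta> * holder_weight h 0 t"
    using holder_bound_dist[OF assms(1,2)] assms(3) by (simp add: holder_bound_def)
  then show ?thesis using assms(1,2) by (simp add: holder_space_def)
qed

text \<open>\<open>closure_of\<close> sees only the test paths inside the metric space, hence the
  intersection. Membership of a test path in \<open>holder_space\<close> is accordingly carried
  along as a separate condition.\<close>

lemma path_space_iff:
  "\<omega> \<in> path_space h \<longleftrightarrow> \<omega> \<in> holder_space h \<and>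
     (\<forall>e>0. \<exists>\<eta>\<in>test_paths \<inter> holder_space h. holder_dist h \<omega> \<eta> < e)"
proof -
  interpret Metric_space "holder_space h :: (real \<Rightarrow> real ^ 'n) set" "holder_dist h"
    by (rule Metric_space_holder_space)
  show ?thesis
    unfolding path_space_def metric_closure_of by (fastforce simp: in_mball)
qed

lemma path_space_holder: "\<omega> \<in> path_space h \<Longrightarrow> \<omega> \<in> holder_space h"
  by (simp add: path_space_iff)

lemma path_space_nonneg: "\<omega> \<in> path_space h \<Longrightarrow> t \<ge> 0 \<Longrightarrow> \<omega> t = 0"
  by (auto simp: path_space_iff holder_space_def)

lemma test_path_in_path_space: "\<eta> \<in> test_paths \<Longrightarrow> \<eta> \<in> holder_space h \<Longrightarrow> \<eta> \<in> path_space h"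
  by (auto simp: path_space_iff holder_dist_def holder_norm_def SUP_constant bot_ennreal intro!: bexI[of _ \<eta>])

lemma path_space_closed:
  assumes "\<omega> \<in> holder_space h" "\<And>e. e > 0 \<Longrightarrow> \<exists>\<eta>\<in>path_space h. holder_dist h \<omega> \<eta> < e"
  shows "\<omega> \<in> path_space h"
  unfolding path_space_iff
proof (intro conjI allI impI assms(1))
  interpret Metric_space "holder_space h :: (real \<Rightarrow> real ^ 'n) set" "holder_dist h"
    by (rule Metric_space_holder_space)
  fix e :: real assume "e > 0"
  then obtain \<eta> where \<eta>: "\<eta> \<in> path_space h" "holder_dist h \<omega> \<eta> < e / 2"
    using assms(2)[of "e / 2"] by auto
  then obtain \<zeta> where \<zeta>: "\<zeta> \<in> test_paths \<inter> holder_space h" "holder_dist h \<eta> \<zeta> < e / 2"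
    using \<open>e > 0\<close> half_gt_zero unfolding path_space_iff by blast
  have "holder_dist h \<omega> \<zeta> \<le> holder_dist h \<omega> \<eta> + holder_dist h \<eta> \<zeta>"
    using assms(1) \<eta> \<zeta> by (intro triangle) (auto simp: path_space_holder)
  with \<eta> \<zeta> show "\<exists>\<eta>\<in>test_paths \<inter> holder_space h. holder_dist h \<omega> \<eta> < e"
    by (intro bexI[of _ \<zeta>]) auto
qed

text \<open>A bounded operator in the form that is used: compatibility with differences and a norm
  bound \<open>K\<close>, stated through \<open>holder_bound\<close> to avoid arithmetic with
  extended reals.\<close>

definition path_operator :: "real \<Rightarrow> real \<Rightarrow> ((real \<Rightarrow> real ^ 'n) \<Rightarrow> (real \<Rightarrow> real ^ 'n)) \<Rightarrow> bool" where
  "path_operator h K T \<longleftrightarrow> 0 \<le> K \<and>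
     (\<forall>\<omega> \<eta>. T (\<lambda>t. \<omega> t - \<eta> t) = (\<lambda>t. T \<omega> t - T \<eta> t)) \<and>
     (\<forall>\<omega>. (\<forall>t\<ge>0. \<omega> t = 0) \<longrightarrow> (\<forall>t\<ge>0. T \<omega> t = 0)) \<and>
     (\<forall>\<omega> C. 0 \<le> C \<longrightarrow> (\<forall>t\<ge>0. \<omega> t = 0) \<longrightarrow> holder_bound h C \<omega> \<longrightarrow> holder_bound h (K * C) (T \<omega>))"

context
  fixes h K :: real and T :: "(real \<Rightarrow> real ^ 'n) \<Rightarrow> (real \<Rightarrow> real ^ 'n)"
  assumes T: "path_operator h K T"
begin

lemma path_operator_holder_space: "\<omega> \<in> holder_space h \<Longrightarrow> T \<omega> \<in> holder_space h"
  using T unfolding holder_space_iff path_operator_def by (metis mult_nonneg_nonneg)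

lemma path_operator_dist:
  assumes "\<omega> \<in> holder_space h" "\<eta> \<in> holder_space h"
  shows "holder_dist h (T \<omega>) (T \<eta>) \<le> K * holder_dist h \<omega> \<eta>"
proof (rule holder_dist_le)
  have "holder_bound h (K * holder_dist h \<omega> \<eta>) (T (\<lambda>t. \<omega> t - \<eta> t))"
  proof -
    have "\<forall>t\<ge>0. \<omega> t - \<eta> t = 0" using assms by (simp add: holder_space_def)
    with holder_bound_dist[OF assms] holder_dist_nonneg[of h \<omega> \<eta>] show ?thesis
      using T[unfolded path_operator_def, THEN conjunct2, THEN conjunct2, THEN conjunct2, rule_format,
          of "holder_dist h \<omega> \<eta>" "\<lambda>t. \<omega> t - \<eta> t"] by blast
  qed
  then show "holder_bound h (K * holder_dist h \<omega> \<eta>) (\<lambda>t. T \<omega> t - T \<eta> t)"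
    using T by (simp add: path_operator_def)
  show "0 \<le> K * holder_dist h \<omega> \<eta>"
    using T holder_dist_nonneg[of h \<omega> \<eta>] by (simp add: path_operator_def)
qed

text \<open>Test paths are dense, the operator is Lipschitz and the path space is closed, so
  invariance has to be checked on test paths only.\<close>

lemma path_operator_path_space:
  assumes test: "\<And>\<eta>. \<eta> \<in> test_paths \<Longrightarrow> \<eta> \<in> holder_space h \<Longrightarrow> T \<eta> \<in> path_space h"
    and \<omega>: "\<omega> \<in> path_space h"
  shows "T \<omega> \<in> path_space h"
proof (rule path_space_closed)
  show "T \<omega> \<in> holder_space h" using \<omega> by (simp add: path_operator_holder_space path_space_holder)
  fix e :: real assume e: "e > 0"
  have K: "K \<ge> 0" using T by (simp add: path_operator_def)
  obtain \<eta> where \<eta>: "\<eta> \<in> test_paths" "\<eta> \<in> holder_space h" "holder_dist h \<omega> \<eta> < e / (K + 1)"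
    using \<omega> e K unfolding path_space_iff by (metis IntE add_nonneg_pos divide_pos_pos zero_less_one)
  have "holder_dist h (T \<omega>) (T \<eta>) \<le> K * holder_dist h \<omega> \<eta>"
    by (intro path_operator_dist \<eta> path_space_holder[OF \<omega>])
  also have "\<dots> \<le> (K + 1) * holder_dist h \<omega> \<eta>"
    using holder_dist_nonneg by (intro mult_right_mono) auto
  also have "\<dots> < e" using \<eta>(3) K by (simp add: field_simps)
  finally show "\<exists>\<eta>\<in>path_space h. holder_dist h (T \<omega>) \<eta> < e"
    using test \<eta> by blast
qed

end

lemma Metric_space_path_space: "Metric_space (path_space h) (holder_dist h)"
  by (rule Metric_space.subspace[OF Metric_space_holder_space]) (auto simp: path_space_holder)

lemma path_lipschitz_continuous:
  fixes T :: "(real \<Rightarrow> real ^ 'n) \<Rightarrow> (real \<Rightarrow> real ^ 'n)"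
  assumes T: "\<And>\<omega>. \<omega> \<in> path_space h \<Longrightarrow> T \<omega> \<in> path_space h"
    and lip: "\<And>\<omega> \<eta>. \<omega> \<in> path_space h \<Longrightarrow> \<eta> \<in> path_space h \<Longrightarrow>
      holder_dist h (T \<omega>) (T \<eta>) \<le> K * holder_dist h \<omega> \<eta>"
    and K: "K \<ge> 0"
  shows "continuous_map (path_topology h) (path_topology h) T"
proof -
  interpret Metric_space "path_space h :: (real \<Rightarrow> real ^ 'n) set" "holder_dist h"
    by (rule Metric_space_path_space)
  show ?thesis
    unfolding path_topology_def metric_continuous_map[OF Metric_space_path_space]
  proof (intro conjI ballI allI impI)
    show "T ` path_space h \<subseteq> path_space h" using T by blast
    fix a :: "real \<Rightarrow> real ^ 'n" and e :: real assume a: "a \<in> path_space h" and e: "e > 0"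
    have "holder_dist h (T a) (T x) < e" if x: "x \<in> path_space h" "holder_dist h a x < e / (K + 1)" for x
    proof -
      have "holder_dist h (T a) (T x) \<le> K * holder_dist h a x"
        by (rule lip[OF a x(1)])
      also have "\<dots> \<le> (K + 1) * holder_dist h a x"
        using holder_dist_nonneg by (intro mult_right_mono) auto
      also have "\<dots> < e" using x(2) K by (simp add: field_simps)
      finally show ?thesis .
    qed
    moreover have "e / (K + 1) > 0" using e K by simp
    ultimately show "\<exists>\<delta>>0. \<forall>x. x \<in> path_space h \<and> holder_dist h a x < \<delta> \<longrightarrow> holder_dist h (T a) (T x) < e"
      by blast
  qed
qed

lemma path_operator_continuous:
  fixes T :: "(real \<Rightarrow> real ^ 'n) \<Rightarrow> (real \<Rightarrow> real ^ 'n)"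
  assumes T: "path_operator h K T" "\<And>\<omega>. \<omega> \<in> path_space h \<Longrightarrow> T \<omega> \<in> path_space h"
  shows "continuous_map (path_topology h) (path_topology h) T"
  by (rule path_lipschitz_continuous[OF T(2) path_operator_dist[OF T(1)]])
    (use T in \<open>auto simp: path_operator_def path_space_holder\<close>)

lemma evaluation_continuous:
  "continuous_map (path_topology h) euclidean (\<lambda>\<omega> :: real \<Rightarrow> real ^ 'n. \<omega> t)"
proof -
  interpret Metric_space "path_space h :: (real \<Rightarrow> real ^ 'n) set" "holder_dist h"
    by (rule Metric_space_path_space)
  show ?thesis
  proof (cases "t \<le> 0")
    case False
    then have z: "0 = \<omega> t" if "\<omega> \<in> topspace (path_topology h)" for \<omega> :: "real \<Rightarrow> real ^ 'n"
      using that path_space_nonneg[of \<omega> h t] by (simp add: path_topology_def)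
    show ?thesis
      by (rule continuous_map_eq[of "path_topology h" euclidean "\<lambda>_. 0"]) (simp, rule z)
  next
    case True
    let ?c = "holder_weight h 0 t + 1"
    have c: "?c > 0" using holder_weight_nonneg[of h 0 t] by linarith
    show ?thesis
      unfolding path_topology_def mtopology_is_euclidean[symmetric] metric_continuous_map[OF Met_TC.Metric_space_axioms]
    proof (intro conjI ballI allI impI)
      fix a :: "real \<Rightarrow> real ^ 'n" and e :: real assume a: "a \<in> path_space h" and e: "e > 0"
      have "dist (a t) (x t) < e" if x: "x \<in> path_space h" "holder_dist h a x < e / ?c" for x
      proof -
        have "norm (a t - x t) \<le> holder_dist h a x * holder_weight h 0 t"
          by (intro norm_diff_le_dist path_space_holder a x True)
        also have "\<dots> \<le> holder_dist h a x * ?c"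
          using holder_dist_nonneg by (intro mult_left_mono) auto
        also have "\<dots> < e" using x(2) c by (simp add: field_simps)
        finally show ?thesis by (simp add: dist_norm)
      qed
      moreover have "e / ?c > 0" using e c by simp
      ultimately show "\<exists>\<delta>>0. \<forall>x. x \<in> path_space h \<and> holder_dist h a x < \<delta> \<longrightarrow> dist (a t) (x t) < e"
        by blast
    qed simp
  qed
qed

lemma test_paths_lincomb:
  assumes "\<omega> \<in> test_paths" "\<eta> \<in> test_paths"
  shows "(\<lambda>t. a *\<^sub>R \<omega> t + b *\<^sub>R \<eta> t) \<in> test_paths"
proof -
  obtain D E where D: "D 0 = \<omega>" "\<And>k t. t \<le> 0 \<Longrightarrow> (D k has_vector_derivative D (Suc k) t) (at t within {..0})"
    and E: "E 0 = \<eta>" "\<And>k t. t \<le> 0 \<Longrightarrow> (E k has_vector_derivative E (Suc k) t) (at t within {..0})"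
    using assms unfolding test_paths_def by blast
  let ?F = "\<lambda>k t. a *\<^sub>R D k t + b *\<^sub>R E k t"
  have "(?F k has_vector_derivative ?F (Suc k) t) (at t within {..0})" if "t \<le> 0" for k t
    by (intro has_vector_derivative_add D E that
        bounded_linear.has_vector_derivative[OF bounded_linear_scaleR_right])
  moreover have "?F 0 = (\<lambda>t. a *\<^sub>R \<omega> t + b *\<^sub>R \<eta> t)" by (simp add: D E)
  moreover have "bounded ({t. \<omega> t \<noteq> 0} \<union> {t. \<eta> t \<noteq> 0})"
    using assms by (simp add: test_paths_def)
  then have "bounded {t. a *\<^sub>R \<omega> t + b *\<^sub>R \<eta> t \<noteq> 0}"
    by (rule bounded_subset) auto
  ultimately show ?thesis
    using assms unfolding test_paths_def by (auto intro!: exI[of _ ?F])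
qed

lemma path_space_lincomb:
  assumes "\<omega> \<in> path_space h" "\<eta> \<in> path_space h"
  shows "(\<lambda>t. a *\<^sub>R \<omega> t + b *\<^sub>R \<eta> t) \<in> path_space h"
proof (rule path_space_closed)
  show "(\<lambda>t. a *\<^sub>R \<omega> t + b *\<^sub>R \<eta> t) \<in> holder_space h"
    by (intro holder_space_lincomb path_space_holder assms)
  fix e :: real assume e: "e > 0"
  let ?k = "\<bar>a\<bar> + \<bar>b\<bar> + 1"
  have k: "e / ?k > 0" using e by (intro divide_pos_pos) auto
  obtain \<omega>' \<eta>' where *: "\<omega>' \<in> test_paths" "\<omega>' \<in> holder_space h" "holder_dist h \<omega> \<omega>' < e / ?k"
    "\<eta>' \<in> test_paths" "\<eta>' \<in> holder_space h" "holder_dist h \<eta> \<eta>' < e / ?k"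
    using assms k unfolding path_space_iff by (metis IntE)
  have "holder_dist h (\<lambda>t. a *\<^sub>R \<omega> t + b *\<^sub>R \<eta> t) (\<lambda>t. a *\<^sub>R \<omega>' t + b *\<^sub>R \<eta>' t)
      \<le> \<bar>a\<bar> * holder_dist h \<omega> \<omega>' + \<bar>b\<bar> * holder_dist h \<eta> \<eta>'"
  proof (rule holder_dist_le)
    show "holder_bound h (\<bar>a\<bar> * holder_dist h \<omega> \<omega>' + \<bar>b\<bar> * holder_dist h \<eta> \<eta>')
       (\<lambda>t. a *\<^sub>R \<omega> t + b *\<^sub>R \<eta> t - (a *\<^sub>R \<omega>' t + b *\<^sub>R \<eta>' t))"
      using holder_bound_lincomb[OF holder_bound_dist[of \<omega> h \<omega>'] holder_bound_dist[of \<eta> h \<eta>'], of a b]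
        assms * by (simp add: path_space_holder algebra_simps)
  qed (simp add: holder_dist_nonneg)
  also have "\<dots> \<le> \<bar>a\<bar> * (e / ?k) + \<bar>b\<bar> * (e / ?k)"
    using * by (intro add_mono mult_left_mono) auto
  also have "\<dots> = (\<bar>a\<bar> + \<bar>b\<bar>) / ?k * e"
    by (simp only: distrib_right[symmetric]) simp
  also have "\<dots> < 1 * e"
    using e by (intro mult_strict_right_mono) (auto simp: divide_less_eq)
  also have "\<dots> = e" by simp
  finally have "holder_dist h (\<lambda>t. a *\<^sub>R \<omega> t + b *\<^sub>R \<eta> t) (\<lambda>t. a *\<^sub>R \<omega>' t + b *\<^sub>R \<eta>' t) < e" .
  moreover have "(\<lambda>t. a *\<^sub>R \<omega>' t + b *\<^sub>R \<eta>' t) \<in> path_space h"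
    using * by (intro test_path_in_path_space test_paths_lincomb holder_space_lincomb) auto
  ultimately show "\<exists>\<zeta>\<in>path_space h. holder_dist h (\<lambda>t. a *\<^sub>R \<omega> t + b *\<^sub>R \<eta> t) \<zeta> < e"
    by (rule bexI)
qed

lemma path_space_zero: "(\<lambda>_. 0) \<in> path_space h"
proof (rule test_path_in_path_space)
  show "(\<lambda>_. 0) \<in> test_paths"
    unfolding test_paths_def by (auto intro!: exI[of _ "\<lambda>_ _. 0"])
  show "(\<lambda>_. 0) \<in> holder_space h"
    by (auto simp: holder_space_iff holder_bound_def holder_weight_nonneg intro!: exI[of _ 0])
qed

section \<open>Shifts and gluing as reparametrisations\<close>

definition reparam :: "(real \<Rightarrow> real) \<Rightarrow> (real \<Rightarrow> real ^ 'n) \<Rightarrow> real \<Rightarrow> real ^ 'n" where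
  "reparam \<rho> \<omega> s = (if s \<le> 0 then \<omega> (\<rho> s) - \<omega> (\<rho> 0) else 0)"

text \<open>A 1-Lipschitz \<rho> does not increase the factor
  \<open>\<bar>t - s\<bar> powr ((1 - h) / 2)\<close>, whose exponent is positive. It adds at most
  \<open>2 * u\<close> under the root, and \<open>1 + 2 * u + a \<le> (1 + 2 * u) * (1 + a)\<close>
  for \<open>a \<ge> 0\<close> yields the constant.\<close>

lemma path_operator_reparam:
  assumes \<rho>: "\<And>s. s \<le> 0 \<Longrightarrow> \<rho> s \<le> 0" "\<And>s. s \<le> 0 \<Longrightarrow> \<bar>\<rho> s\<bar> \<le> \<bar>s\<bar> + u"
    "\<And>s t. s \<le> 0 \<Longrightarrow> t \<le> 0 \<Longrightarrow> \<bar>\<rho> t - \<rho> s\<bar> \<le> \<bar>t - s\<bar>"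
    and u: "u \<ge> 0" and h: "h < 1"
  shows "path_operator h (sqrt (1 + 2 * u)) (reparam \<rho>)"
  unfolding path_operator_def
proof (intro conjI allI impI)
  have w: "holder_weight h (\<rho> s) (\<rho> t) \<le> sqrt (1 + 2 * u) * holder_weight h s t"
    if st: "s \<le> 0" "t \<le> 0" for s t
  proof -
    have "1 + \<bar>\<rho> t\<bar> + \<bar>\<rho> s\<bar> \<le> (1 + 2 * u) + (\<bar>t\<bar> + \<bar>s\<bar>)"
      using \<rho>(2)[OF st(1)] \<rho>(2)[OF st(2)] by linarith
    also have "\<dots> \<le> (1 + 2 * u) + (1 + 2 * u) * (\<bar>t\<bar> + \<bar>s\<bar>)"
      using u mult_right_mono[of 1 "1 + 2 * u" "\<bar>t\<bar> + \<bar>s\<bar>"] by simp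
    finally have "sqrt (1 + \<bar>\<rho> t\<bar> + \<bar>\<rho> s\<bar>) \<le> sqrt ((1 + 2 * u) * (1 + \<bar>t\<bar> + \<bar>s\<bar>))"
      by (intro real_sqrt_le_mono) (simp add: algebra_simps)
    moreover have "\<bar>\<rho> t - \<rho> s\<bar> powr ((1 - h) / 2) \<le> \<bar>t - s\<bar> powr ((1 - h) / 2)"
      using \<rho>(3)[OF st] h by (intro powr_mono2) auto
    ultimately have "holder_weight h (\<rho> s) (\<rho> t)
        \<le> sqrt ((1 + 2 * u) * (1 + \<bar>t\<bar> + \<bar>s\<bar>)) * \<bar>t - s\<bar> powr ((1 - h) / 2)"
      unfolding holder_weight_def using u by (intro mult_mono) auto
    then show ?thesis by (simp add: holder_weight_def real_sqrt_mult mult.assoc)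
  qed
  fix \<omega> :: "real \<Rightarrow> real ^ 'n" and C :: real
  assume C: "0 \<le> C" "holder_bound h C \<omega>"
  show "holder_bound h (sqrt (1 + 2 * u) * C) (reparam \<rho> \<omega>)"
    unfolding holder_bound_def
  proof (intro allI impI)
    fix s t :: real assume st: "s \<le> 0" "t \<le> 0"
    have "norm (reparam \<rho> \<omega> t - reparam \<rho> \<omega> s) = norm (\<omega> (\<rho> t) - \<omega> (\<rho> s))"
      using st by (simp add: reparam_def)
    also have "\<dots> \<le> C * holder_weight h (\<rho> s) (\<rho> t)"
      using C(2) \<rho>(1) st by (simp add: holder_bound_def)
    also have "\<dots> \<le> C * (sqrt (1 + 2 * u) * holder_weight h s t)"
      using C(1) w[OF st] by (rule mult_left_mono[rotated])
    finally show "norm (reparam \<rho> \<omega> t - reparam \<rho> \<omega> s) \<le> sqrt (1 + 2 * u) * C * holder_weight h s t"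
      by (simp add: mult_ac)
  qed
qed (use u in \<open>auto simp: reparam_def fun_eq_iff\<close>)

lemma past_shift_eq_reparam: "past_shift u = reparam (\<lambda>s. s - u)"
  by (simp add: past_shift_def reparam_def fun_eq_iff)

lemma path_operator_past_shift:
  assumes "u \<ge> 0" "h < 1" shows "path_operator h (sqrt (1 + 2 * u)) (past_shift u)"
  unfolding past_shift_eq_reparam by (rule path_operator_reparam) (use assms in auto)

text \<open>Each half of a glued path is continued as a constant through the stretch of the other.
  In this form a half depends linearly on one path and is an instance of
  \<open>reparam\<close>.\<close>

definition glue_past :: "real \<Rightarrow> (real \<Rightarrow> real ^ 'n) \<Rightarrow> real \<Rightarrow> real ^ 'n" where
  "glue_past t \<omega> = reparam (\<lambda>s. min 0 (s + t)) \<omega>"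

definition glue_future :: "real \<Rightarrow> (real \<Rightarrow> real ^ 'n) \<Rightarrow> real \<Rightarrow> real ^ 'n" where
  "glue_future t \<omega> = reparam (\<lambda>s. min 0 (- s - t)) \<omega>"

lemma path_operator_glue_past:
  assumes "u \<ge> 0" "h < 1" shows "path_operator h (sqrt (1 + 2 * u)) (glue_past u)"
  unfolding glue_past_def[abs_def] by (rule path_operator_reparam) (use assms in \<open>auto simp: min_def\<close>)

lemma path_operator_glue_future:
  assumes "u \<ge> 0" "h < 1" shows "path_operator h (sqrt (1 + 2 * u)) (glue_future u)"
  unfolding glue_future_def[abs_def] by (rule path_operator_reparam) (use assms in \<open>auto simp: min_def\<close>)

lemma glue_eq:
  assumes "\<omega> 0 = 0" "\<eta> 0 = 0" "t \<ge> 0"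
  shows "glue t \<omega> \<eta> = (\<lambda>s. glue_past t \<omega> s + glue_future t \<eta> s)"
proof
  fix s show "glue t \<omega> \<eta> s = glue_past t \<omega> s + glue_future t \<eta> s"
  \<comment> \<open>At the seam the two pieces match because both paths vanish at 0.\<close>
  proof (cases "s = - t")
    case True
    then show ?thesis using assms by (simp add: glue_def glue_past_def glue_future_def reparam_def)
  next
    case False
    then show ?thesis
      using assms by (auto simp: glue_def glue_past_def glue_future_def reparam_def min_def)
  qed
qed

text \<open>Serves to turn one test path with a nonzero component at a given time into test paths
  with any prescribed value there.\<close>

lemma path_operator_component:
  fixes v :: "real ^ 'n"
  shows "path_operator h (norm v) (\<lambda>\<omega> s. (\<omega> s $ i) *\<^sub>R v)"
  unfolding path_operator_def
proof (intro conjI allI impI)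
  fix \<omega> :: "real \<Rightarrow> real ^ 'n" and C :: real assume C: "0 \<le> C" "holder_bound h C \<omega>"
  show "holder_bound h (norm v * C) (\<lambda>s. (\<omega> s $ i) *\<^sub>R v)"
    unfolding holder_bound_def
  proof (intro allI impI)
    fix s t :: real assume st: "s \<le> 0" "t \<le> 0"
    have "norm ((\<omega> t $ i) *\<^sub>R v - (\<omega> s $ i) *\<^sub>R v) = norm (((\<omega> t - \<omega> s) $ i) *\<^sub>R v)"
      by (simp add: algebra_simps)
    also have "\<dots> = norm v * \<bar>(\<omega> t - \<omega> s) $ i\<bar>" by simp
    also have "\<dots> \<le> norm v * (C * holder_weight h s t)"
      using C(2) st component_le_norm_cart[of "\<omega> t - \<omega> s" i]
      by (intro mult_left_mono) (auto simp: holder_bound_def intro: order_trans)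
    finally show "norm ((\<omega> t $ i) *\<^sub>R v - (\<omega> s $ i) *\<^sub>R v) \<le> norm v * C * holder_weight h s t"
      by (simp add: mult.assoc)
  qed
qed (auto simp: algebra_simps)

lemma component_test_paths:
  fixes v :: "real ^ 'n" and \<eta> :: "real \<Rightarrow> real ^ 'n"
  assumes "\<eta> \<in> test_paths" shows "(\<lambda>s. (\<eta> s $ i) *\<^sub>R v) \<in> test_paths"
proof -
  obtain D where D: "D 0 = \<eta>" "\<And>k t. t \<le> 0 \<Longrightarrow> (D k has_vector_derivative D (Suc k) t) (at t within {..0})"
    using assms unfolding test_paths_def by blast
  have bl: "bounded_linear (\<lambda>x :: real ^ 'n. (x $ i) *\<^sub>R v)"
    by (rule bounded_linear_scaleR_const[OF bounded_linear_vec_nth])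
  have "((\<lambda>s. (D k s $ i) *\<^sub>R v) has_vector_derivative (D (Suc k) t $ i) *\<^sub>R v) (at t within {..0})"
    if "t \<le> 0" for k t
    by (rule bounded_linear.has_vector_derivative[OF bl D(2)[OF that]])
  moreover have "bounded {t. \<eta> t \<noteq> 0}" using assms by (simp add: test_paths_def)
  then have "bounded {t. (\<eta> t $ i) *\<^sub>R v \<noteq> 0}"
    by (rule bounded_subset) auto
  ultimately show ?thesis
    using assms unfolding test_paths_def by (auto simp: D intro!: exI[of _ "\<lambda>k s. (D k s $ i) *\<^sub>R v"])
qed

text \<open>Far in the past \<eta> is 0 and the shifted path equals \<open>- \<eta> (- u)\<close>,
  so its support is compact only if this value is 0. This is why the integral formula cannot be
  applied directly to shifts of all test paths.\<close>

lemma shift_test_path: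
  assumes "\<eta> \<in> test_paths" "\<eta> (- u) = 0" "u \<ge> 0"
  shows "past_shift u \<eta> \<in> test_paths"
proof -
  obtain D where D: "D 0 = \<eta>" "\<And>k t. t \<le> 0 \<Longrightarrow> (D k has_vector_derivative D (Suc k) t) (at t within {..0})"
    using assms unfolding test_paths_def by blast
  let ?E = "\<lambda>k s. if s \<le> 0 then D k (s - u) else 0"
  have E: "(?E k has_vector_derivative ?E (Suc k) t) (at t within {..0})" if t: "t \<le> 0" for k t
  proof -
    have "(D k has_vector_derivative D (Suc k) (t - u)) (at (t - u) within (\<lambda>s. s - u) ` {..0})"
      by (rule has_vector_derivative_within_subset[OF D(2)]) (use t assms in auto)
    moreover have "((\<lambda>s. s - u) has_vector_derivative 1) (at t within {..0})"
      by (auto intro!: derivative_eq_intros)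
    ultimately have "(D k \<circ> (\<lambda>s. s - u) has_vector_derivative 1 *\<^sub>R D (Suc k) (t - u)) (at t within {..0})"
      by (rule vector_diff_chain_within[rotated])
    then have "((\<lambda>s. D k (s - u)) has_vector_derivative D (Suc k) (t - u)) (at t within {..0})"
      by (simp add: o_def)
    then have "(?E k has_vector_derivative D (Suc k) (t - u)) (at t within {..0})"
      by (rule has_vector_derivative_transform[rotated 2]) (use t in auto)
    then show ?thesis using t by simp
  qed
  have sh: "past_shift u \<eta> = ?E 0"
    using assms D by (auto simp: past_shift_def fun_eq_iff)
  have "bounded ((\<lambda>t. u + t) ` {t. \<eta> t \<noteq> 0})"
    using assms by (intro bounded_translation) (simp add: test_paths_def)
  then have "bounded {t. past_shift u \<eta> t \<noteq> 0}"
    by (rule bounded_subset) (auto simp: past_shift_def assms image_iff intro!: exI[of _ "_ - u"])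
  moreover have "past_shift u \<eta> t = 0" if "t \<ge> 0" for t
    using that by (auto simp: past_shift_def)
  ultimately show ?thesis
    using E sh unfolding test_paths_def by (auto intro!: exI[of _ ?E])
qed

lemma test_path_support:
  assumes "\<eta> \<in> test_paths" obtains r where "r > 0" "\<And>t. t \<le> - r \<Longrightarrow> \<eta> t = 0"
proof -
  have "bounded {t. \<eta> t \<noteq> 0}" using assms by (simp add: test_paths_def)
  then obtain r where r: "\<And>t. \<eta> t \<noteq> 0 \<Longrightarrow> \<bar>t\<bar> \<le> r"
    unfolding bounded_iff by auto
  have "\<eta> t = 0" if "t \<le> - (\<bar>r\<bar> + 1)" for t
    using r[of t] that by fastforce
  then show ?thesis by (intro that[of "\<bar>r\<bar> + 1"]) auto
qed

text \<open>Closure of the path space under \<open>glue_future\<close> is inherited from the disintegration. Since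
  reflecting a compactly supported path twice translates it, closure under the other operators
  follows without any smooth cutoff.\<close>

lemma past_shift_double_reflection:
  assumes "\<eta> \<in> test_paths" "\<And>s. s \<le> - r \<Longrightarrow> \<eta> s = 0" "0 \<le> t" "t \<le> r"
  shows "past_shift t \<eta> = glue_future (r - t) (glue_future r \<eta>)"
  using assms by (auto simp: past_shift_def glue_future_def reparam_def fun_eq_iff min_def test_paths_def)

lemma glue_past_double_reflection:
  assumes "\<eta> \<in> test_paths" "\<And>s. s \<le> - r \<Longrightarrow> \<eta> s = 0" "0 \<le> t" "0 < r"
  shows "glue_past t \<eta> = glue_future (r + t) (glue_future r \<eta>)"
  using assms by (auto simp: glue_past_def glue_future_def reparam_def fun_eq_iff min_def test_paths_def add.commute)

section \<open>The fractional operator commutes with shifts\<close>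

text \<open>Gives uniqueness of derivatives within the half line, the endpoint 0 included, so that
  \<open>vector_derivative\<close> is the derivative at hand.\<close>

lemma at_within_atMost_ne_bot: "r \<le> 0 \<Longrightarrow> at (r :: real) within {..0} \<noteq> bot"
  unfolding at_within_eq_bot_iff not_not closure_approachable
proof (intro allI impI)
  fix e :: real assume "r \<le> 0" "e > 0"
  then show "\<exists>y\<in>{..0} - {r}. dist y r < e"
    by (intro bexI[of _ "r - e / 2"]) (auto simp: dist_real_def)
qed

definition path_derivative :: "(real \<Rightarrow> real ^ 'n) \<Rightarrow> (real \<Rightarrow> real ^ 'n) \<Rightarrow> bool" where
  "path_derivative \<eta> d \<longleftrightarrow> (\<forall>r\<le>0. (\<eta> has_vector_derivative d r) (at r within {..0}))"

lemma test_path_derivative: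
  fixes \<eta> :: "real \<Rightarrow> real ^ 'n"
  assumes "\<eta> \<in> test_paths"
  obtains d B R where "continuous_on {..0} d" "R > 0"
    "path_derivative \<eta> d" "\<forall>r\<le>0. norm (d r) \<le> B" "\<forall>r\<le>- R. d r = 0"
proof -
  obtain D where D: "D 0 = \<eta>" "\<And>k t. t \<le> 0 \<Longrightarrow> (D k has_vector_derivative D (Suc k) t) (at t within {..0})"
    using assms unfolding test_paths_def by blast
  obtain R where R: "R > 0" "\<And>t. t \<le> - R \<Longrightarrow> \<eta> t = 0"
    using test_path_support[OF assms] by metis
  define d where "d = D 1"
  have dd: "(\<eta> has_vector_derivative d r) (at r within {..0})" if "r \<le> 0" for r
    using D(2)[OF that, of 0] by (simp add: d_def D(1))
  have cont: "continuous_on {..0} d"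
    unfolding continuous_on_eq_continuous_within d_def
    using has_vector_derivative_continuous[OF D(2)] by auto
  \<comment> \<open>One unit beyond \<open>- R\<close> the path vanishes in a whole neighbourhood,
    and this forces the derivative to vanish.\<close>
  have z: "d r = 0" if r: "r \<le> - (R + 1)" for r
  proof (rule vector_derivative_unique_within[OF at_within_atMost_ne_bot])
    show "r \<le> 0" using r R by simp
    show "((\<lambda>_. 0) has_vector_derivative d r) (at r within {..0})"
      by (rule has_vector_derivative_transform_within[OF dd, of r 1])
        (use r R in \<open>auto simp: dist_real_def\<close>)
  qed simp
  have "compact (d ` {- (R + 1)..0})"
    by (intro compact_continuous_image continuous_on_subset[OF cont]) auto
  then have "bounded (d ` {- (R + 1)..0})" by (rule compact_imp_bounded)
  then obtain B where B: "\<forall>y\<in>d ` {- (R + 1)..0}. norm y \<le> B" unfolding bounded_iff by blast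
  have "norm (d r) \<le> \<bar>B\<bar>" if "r \<le> 0" for r
    using B z[of r] that by (cases "r \<le> - (R + 1)") (auto intro: order_trans[OF _ abs_ge_self])
  then show ?thesis
    using that[OF cont, of "R + 1" "\<bar>B\<bar>"] dd z R by (simp add: path_derivative_def)
qed

definition fractional_integrand :: "real \<Rightarrow> (real \<Rightarrow> real ^ 'n) \<Rightarrow> real \<Rightarrow> real \<Rightarrow> real ^ 'n" where
  "fractional_integrand H \<omega> t r = ((- r) powr (H - 1/2)) *\<^sub>R
     (vector_derivative \<omega> (at (t + r) within {..0}) - vector_derivative \<omega> (at r within {..0}))"

lemma powr_set_integrable:
  fixes a R :: real assumes "a > -1" "R \<ge> 0"
  shows "set_integrable lborel {- R..0} (\<lambda>r. (- r) powr a)"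
proof -
  have "(\<lambda>t. t powr a) integrable_on {0..R}"
    by (rule integrable_on_powr_from_0) (use assms in auto)
  then have "(\<lambda>t. t powr a) absolutely_integrable_on {0..R}"
    by (intro nonnegative_absolutely_integrable_1) auto
  then have "integrable lborel (\<lambda>t. indicator {0..R} t *\<^sub>R t powr a)"
    unfolding set_integrable_def by (subst (asm) integrable_completion) auto
  then have "integrable lborel (\<lambda>t. indicator {0..R} (0 + (-1) * t) *\<^sub>R (0 + (-1) * t) powr a)"
    by (intro lborel_integrable_real_affine) auto
  moreover have "indicator {0..R} (0 + (-1) * t) = (indicator {- R..0} t :: real)" for t
    by (auto simp: indicator_def)
  ultimately show ?thesis unfolding set_integrable_def by simp
qed

lemma fractional_integrand_eq:
  assumes "path_derivative \<eta> d" "t \<le> 0" "r \<le> 0"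
  shows "fractional_integrand H \<eta> t r = ((- r) powr (H - 1/2)) *\<^sub>R (d (t + r) - d r)"
proof -
  have "vector_derivative \<eta> (at x within {..0}) = d x" if "x \<le> 0" for x
    using assms(1) that unfolding path_derivative_def
    by (intro vector_derivative_within at_within_atMost_ne_bot) auto
  then show ?thesis using assms(2,3) by (simp add: fractional_integrand_def)
qed

text \<open>Below \<open>- R\<close> both derivatives vanish, as \<open>t \<le> 0\<close>. On
  \<open>{- R..0}\<close> their difference is bounded, and \<open>H > 0\<close> keeps the exponent
  \<open>H - 1/2\<close> above -1, so the singularity at 0 is integrable.\<close>

lemma fractional_integrand_integrable:
  fixes \<eta> :: "real \<Rightarrow> real ^ 'n"
  assumes "\<eta> \<in> test_paths" "t \<le> 0" "0 < H"
  shows "set_integrable lborel {..0} (fractional_integrand H \<eta> t)"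
proof -
  obtain d B R where cont: "continuous_on {..0} d" and R: "R > 0"
    and d: "path_derivative \<eta> d"
    and B: "\<forall>r\<le>0. norm (d r) \<le> B" and z: "\<forall>r\<le>- R. d r = 0"
    using assms(1) by (rule test_path_derivative)
  let ?a = "H - 1/2"
  have "continuous_on {..0} (\<lambda>r. d (t + r) - d r)"
    using assms(2) by (intro continuous_intros cont continuous_on_compose2[OF cont]) auto
  then have m: "(\<lambda>r. indicator {..0} r *\<^sub>R (d (t + r) - d r)) \<in> borel_measurable borel"
    by (intro borel_measurable_continuous_on_indicator) auto
  have "integrable lborel (\<lambda>r. indicator {- R..0} r *\<^sub>R (- r) powr ?a)"
    using powr_set_integrable[of ?a R] assms R by (simp add: set_integrable_def)
  then have g: "integrable lborel (\<lambda>r. 2 * B * (indicator {- R..0} r *\<^sub>R (- r) powr ?a))"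
    by (rule integrable_mult_right)
  have "integrable lborel (\<lambda>r. ((- r) powr ?a) *\<^sub>R (indicator {..0} r *\<^sub>R (d (t + r) - d r)))"
  proof (rule Bochner_Integration.integrable_bound[OF g])
    show "(\<lambda>r. ((- r) powr ?a) *\<^sub>R (indicator {..0} r *\<^sub>R (d (t + r) - d r))) \<in> borel_measurable lborel"
      using m by measurable
    have "norm (((- r) powr ?a) *\<^sub>R (indicator {..0} r *\<^sub>R (d (t + r) - d r)))
        \<le> norm (2 * B * (indicator {- R..0} r *\<^sub>R (- r) powr ?a))" for r
    proof (cases "r \<in> {- R..0}")
      case True
      have "norm (d (t + r) - d r) \<le> B + B"
        using B True assms(2) by (intro norm_triangle_le_diff add_mono) auto
      then have "norm (d (t + r) - d r) * (- r) powr ?a \<le> \<bar>B\<bar> * 2 * (- r) powr ?a"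
        by (intro mult_right_mono) auto
      then show ?thesis using True by (simp add: abs_mult mult_ac)
    next
      case False
      then show ?thesis using z assms(2) by (auto simp: indicator_def)
    qed
    then show "AE r in lborel. norm (((- r) powr ?a) *\<^sub>R (indicator {..0} r *\<^sub>R (d (t + r) - d r)))
        \<le> norm (2 * B * (indicator {- R..0} r *\<^sub>R (- r) powr ?a))" by simp
  qed
  moreover have "((- r) powr ?a) *\<^sub>R (indicator {..0} r *\<^sub>R (d (t + r) - d r))
      = indicator {..0} r *\<^sub>R fractional_integrand H \<eta> t r" for r
    using fractional_integrand_eq[OF d assms(2), of r H] by (simp add: indicator_def)
  ultimately show ?thesis by (simp add: set_integrable_def)
qed

lemma fractional_integrand_lincomb:
  assumes "\<eta> \<in> test_paths" "\<zeta> \<in> test_paths" "t \<le> 0" "r \<le> 0"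
  shows "fractional_integrand H (\<lambda>s. a *\<^sub>R \<eta> s + b *\<^sub>R \<zeta> s) t r
    = a *\<^sub>R fractional_integrand H \<eta> t r + b *\<^sub>R fractional_integrand H \<zeta> t r"
proof -
  obtain d where d: "path_derivative \<eta> d"
    using assms(1) by (rule test_path_derivative)
  obtain e where e: "path_derivative \<zeta> e"
    using assms(2) by (rule test_path_derivative)
  have de: "path_derivative (\<lambda>s. a *\<^sub>R \<eta> s + b *\<^sub>R \<zeta> s) (\<lambda>r. a *\<^sub>R d r + b *\<^sub>R e r)"
    using d e unfolding path_derivative_def
    by (auto intro!: has_vector_derivative_add bounded_linear.has_vector_derivative[OF bounded_linear_scaleR_right])
  show ?thesis
    unfolding fractional_integrand_eq[OF d assms(3,4)] fractional_integrand_eq[OF e assms(3,4)]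
      fractional_integrand_eq[OF de assms(3,4)]
    by (simp add: algebra_simps)
qed

text \<open>The additive constant in \<open>past_shift\<close> is lost in the derivative, and
  \<open>d r\<close> is added and subtracted to split the difference of derivatives.\<close>

lemma fractional_integrand_shift:
  assumes "\<eta> \<in> test_paths" "u \<ge> 0" "t \<le> 0" "r \<le> 0"
  shows "fractional_integrand H (past_shift u \<eta>) t r
    = fractional_integrand H \<eta> (t - u) r - fractional_integrand H \<eta> (- u) r"
proof -
  obtain d where d: "path_derivative \<eta> d"
    using assms(1) by (rule test_path_derivative)
  have de: "path_derivative (past_shift u \<eta>) (\<lambda>r. d (r - u))"
    unfolding path_derivative_def
  proof (intro allI impI)
    fix r :: real assume r: "r \<le> 0"
    have "(\<eta> has_vector_derivative d (r - u)) (at (r - u) within (\<lambda>s. s - u) ` {..0})"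
    proof (rule has_vector_derivative_within_subset)
      show "(\<eta> has_vector_derivative d (r - u)) (at (r - u) within {..0})"
        using d r assms(2) unfolding path_derivative_def by simp
    qed (use assms(2) in auto)
    moreover have "((\<lambda>s. s - u) has_vector_derivative 1) (at r within {..0})"
      by (auto intro!: derivative_eq_intros simp del: has_vector_derivative_within_open)
    ultimately have "(\<eta> \<circ> (\<lambda>s. s - u) has_vector_derivative 1 *\<^sub>R d (r - u)) (at r within {..0})"
      by (rule vector_diff_chain_within[rotated])
    then have "((\<lambda>s. \<eta> (s - u) - \<eta> (- u)) has_vector_derivative d (r - u)) (at r within {..0})"
      using has_vector_derivative_diff[OF _ has_vector_derivative_const, of "\<eta> \<circ> (\<lambda>s. s - u)" "1 *\<^sub>R d (r - u)"
          "at r within {..0}" "\<eta> (- u)"] by (simp add: o_def)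
    then show "(past_shift u \<eta> has_vector_derivative d (r - u)) (at r within {..0})"
      by (rule has_vector_derivative_transform[rotated 2]) (simp_all add: past_shift_def r)
  qed
  have tu: "t - u \<le> 0" "- u \<le> 0" using assms by auto
  have arg: "t - u + r = t + r - u" "- u + r = r - u" by simp_all
  show ?thesis
    unfolding fractional_integrand_eq[OF d tu(1) assms(4)] fractional_integrand_eq[OF d tu(2) assms(4)]
      fractional_integrand_eq[OF de assms(3,4)]
    by (simp only: arg scaleR_diff_right) simp
qed

text \<open>Of the noise, the commutation argument uses only that reflections stay in the path space
  and that at every negative time some test path has a nonzero value. The constant \<alpha> stays
  unspecified, since commutation is unaffected by scaling.\<close>

locale fractional_paths =
  fixes H :: real and D :: "(real \<Rightarrow> real ^ 'n) \<Rightarrow> (real \<Rightarrow> real ^ 'n)"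
  assumes H: "0 < H" "H < 1"
    and glue_future_path: "\<And>t \<omega> :: real \<Rightarrow> real ^ 'n. t \<ge> 0 \<Longrightarrow> \<omega> \<in> path_space H \<Longrightarrow> glue_future t \<omega> \<in> path_space H"
    and D_continuous: "continuous_map (path_topology H) (path_topology (1 - H)) D"
    and D_formula: "\<exists>\<alpha>>0. \<forall>\<omega>\<in>test_paths. \<forall>t\<le>0.
        D \<omega> t = (1 / \<alpha>) *\<^sub>R (LINT r:{..0}|lborel. fractional_integrand H \<omega> t r)"
    and nondegenerate: "\<And>u. u > 0 \<Longrightarrow> \<exists>\<eta> :: real \<Rightarrow> real ^ 'n. \<eta> \<in> test_paths \<and> \<eta> \<in> holder_space H \<and> (\<exists>i. \<eta> (- u) $ i \<noteq> 0)"
begin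

abbreviation paths :: "(real \<Rightarrow> real ^ 'n) set" where "paths \<equiv> path_space H"

lemma topspace_path[simp]: "topspace (path_topology h) = path_space h"
  unfolding path_topology_def
  by (rule Metric_space.topspace_mtopology[OF Metric_space_path_space])

lemma past_shift_path:
  assumes "\<omega> \<in> paths" "t \<ge> 0" shows "past_shift t \<omega> \<in> paths"
proof (rule path_operator_path_space[OF path_operator_past_shift[OF assms(2) H(2)] _ assms(1)])
  fix \<eta> :: "real \<Rightarrow> real ^ 'n" assume \<eta>: "\<eta> \<in> test_paths" "\<eta> \<in> holder_space H"
  obtain r where r: "r > 0" "\<And>s. s \<le> - r \<Longrightarrow> \<eta> s = 0"
    using test_path_support[OF \<eta>(1)] by metis
  \<comment> \<open>\<open>r + t\<close> bounds the support as well and is at least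
    \<open>t\<close>, as the double reflection demands.\<close>
  have "past_shift t \<eta> = glue_future (r + t - t) (glue_future (r + t) \<eta>)"
    by (rule past_shift_double_reflection) (use \<eta> r assms in auto)
  then show "past_shift t \<eta> \<in> paths"
    using r \<eta> assms by (simp add: glue_future_path test_path_in_path_space)
qed

lemma glue_past_path:
  assumes "\<omega> \<in> paths" "t \<ge> 0" shows "glue_past t \<omega> \<in> paths"
proof (rule path_operator_path_space[OF path_operator_glue_past[OF assms(2) H(2)] _ assms(1)])
  fix \<eta> :: "real \<Rightarrow> real ^ 'n" assume \<eta>: "\<eta> \<in> test_paths" "\<eta> \<in> holder_space H"
  obtain r where r: "r > 0" "\<And>s. s \<le> - r \<Longrightarrow> \<eta> s = 0"
    using test_path_support[OF \<eta>(1)] by metis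
  have "glue_past t \<eta> = glue_future (r + t) (glue_future r \<eta>)"
    by (rule glue_past_double_reflection) (use \<eta> r assms in auto)
  then show "glue_past t \<eta> \<in> paths"
    using r \<eta> assms by (simp add: glue_future_path test_path_in_path_space)
qed

lemma glue_path:
  assumes "\<omega> \<in> paths" "\<eta> \<in> paths" "t \<ge> 0" shows "glue t \<omega> \<eta> \<in> paths"
  using path_space_lincomb[OF glue_past_path[OF assms(1,3)] glue_future_path[OF assms(3,2)], of 1 1]
    glue_eq[of \<omega> \<eta> t] assms by (simp add: path_space_nonneg)

lemma past_shift_continuous: "t \<ge> 0 \<Longrightarrow> continuous_map (path_topology H) (path_topology H) (past_shift t :: (real \<Rightarrow> real ^ 'n) \<Rightarrow> _)"
  by (rule path_operator_continuous[OF path_operator_past_shift]) (use H past_shift_path in auto)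

lemma D_path: "\<omega> \<in> paths \<Longrightarrow> D \<omega> \<in> path_space (1 - H)"
  using continuous_map_image_subset_topspace[OF D_continuous] by auto

lemma test_approximation:
  assumes "\<omega> \<in> paths"
  obtains \<eta> where "\<forall>n. \<eta> n \<in> test_paths \<and> \<eta> n \<in> holder_space H" "(\<lambda>n. holder_dist H (\<eta> n) \<omega>) \<longlonglongrightarrow> 0"
proof -
  have "\<exists>\<eta>. \<eta> \<in> test_paths \<and> \<eta> \<in> holder_space H \<and> holder_dist H \<omega> \<eta> < 1 / real (Suc n)" for n
    using assms unfolding path_space_iff by (meson IntE of_nat_0_less_iff zero_less_Suc zero_less_divide_1_iff)
  then obtain \<eta> where \<eta>: "\<And>n. \<eta> n \<in> test_paths \<and> \<eta> n \<in> holder_space H \<and> holder_dist H \<omega> (\<eta> n) < 1 / real (Suc n)"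
    by metis
  have "(\<lambda>n. holder_dist H (\<eta> n) \<omega>) \<longlonglongrightarrow> 0"
  proof (rule tendsto_sandwich[OF _ _ tendsto_const LIMSEQ_Suc[OF lim_const_over_n[of 1]]])
    show "\<forall>\<^sub>F n in sequentially. holder_dist H (\<eta> n) \<omega> \<le> 1 / real (Suc n)"
      using \<eta> by (subst holder_dist_commute) (auto intro!: always_eventually less_imp_le)
  qed (auto intro: always_eventually holder_dist_nonneg)
  then show ?thesis using that \<eta> by blast
qed

lemma path_limit_map:
  assumes "continuous_map (path_topology H) (path_topology k) G"
    and "\<forall>n. \<eta> n \<in> paths" "\<omega> \<in> paths" "(\<lambda>n. holder_dist H (\<eta> n) \<omega>) \<longlonglongrightarrow> 0"
  shows "(\<lambda>n. G (\<eta> n) t) \<longlonglongrightarrow> G \<omega> t"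
proof -
  interpret Metric_space paths "holder_dist H" by (rule Metric_space_path_space)
  have "limitin (path_topology H) \<eta> \<omega> sequentially"
    unfolding path_topology_def limitin_metric_dist_null using assms by auto
  then have "limitin euclidean ((\<lambda>\<omega>. G \<omega> t) \<circ> \<eta>) (G \<omega> t) sequentially"
    using continuous_map_compose[OF assms(1) evaluation_continuous[of k t]]
    by (intro continuous_map_limit[of "path_topology H"]) (auto simp: o_def)
  then show ?thesis by (simp add: limitin_canonical_iff o_def)
qed

lemma path_limit_eval:
  assumes "\<forall>n. \<eta> n \<in> paths" "\<omega> \<in> paths" "(\<lambda>n. holder_dist H (\<eta> n) \<omega>) \<longlonglongrightarrow> 0"
  shows "(\<lambda>n. \<eta> n t) \<longlonglongrightarrow> \<omega> t"
  using path_limit_map[OF continuous_map_id[unfolded id_def] assms] by simp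

lemma D_lincomb_test:
  assumes \<eta>: "\<eta> \<in> test_paths" and \<zeta>: "\<zeta> \<in> test_paths" and t: "t \<le> 0"
  shows "D (\<lambda>s. a *\<^sub>R \<eta> s + b *\<^sub>R \<zeta> s) t = a *\<^sub>R D \<eta> t + b *\<^sub>R D \<zeta> t"
proof -
  obtain \<alpha> where \<alpha>: "\<alpha> > 0" "\<And>\<omega> t. \<omega> \<in> test_paths \<Longrightarrow> t \<le> 0 \<Longrightarrow>
      D \<omega> t = (1 / \<alpha>) *\<^sub>R (LINT r:{..0}|lborel. fractional_integrand H \<omega> t r)"
    using D_formula by blast
  note i = fractional_integrand_integrable[OF \<eta> t H(1)] fractional_integrand_integrable[OF \<zeta> t H(1)]
  have "(LINT r:{..0}|lborel. fractional_integrand H (\<lambda>s. a *\<^sub>R \<eta> s + b *\<^sub>R \<zeta> s) t r)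
      = (LINT r:{..0}|lborel. a *\<^sub>R fractional_integrand H \<eta> t r + b *\<^sub>R fractional_integrand H \<zeta> t r)"
    by (intro set_lebesgue_integral_cong) (auto simp: fractional_integrand_lincomb[OF \<eta> \<zeta> t])
  also have "\<dots> = a *\<^sub>R (LINT r:{..0}|lborel. fractional_integrand H \<eta> t r)
      + b *\<^sub>R (LINT r:{..0}|lborel. fractional_integrand H \<zeta> t r)"
    using i by (subst set_integral_add) (auto simp: set_integral_scaleR_right intro!: set_integrable_scaleR_right)
  finally show ?thesis
    by (simp add: \<alpha> \<eta> \<zeta> t test_paths_lincomb scaleR_add_right)
qed

text \<open>Linearity of the integral on test paths, carried over by density and by continuity of
  \<open>D\<close>.\<close>

lemma D_lincomb:
  assumes \<omega>: "\<omega> \<in> paths" and \<upsilon>: "\<upsilon> \<in> paths"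
  shows "D (\<lambda>s. a *\<^sub>R \<omega> s + b *\<^sub>R \<upsilon> s) t = a *\<^sub>R D \<omega> t + b *\<^sub>R D \<upsilon> t"
proof (cases "t \<le> 0")
  case False
  then show ?thesis
    using D_path[OF \<omega>] D_path[OF \<upsilon>] D_path[OF path_space_lincomb[OF \<omega> \<upsilon>, of a b]]
    by (simp add: path_space_nonneg)
next
  case True
  obtain \<eta> where \<eta>: "\<forall>n. \<eta> n \<in> test_paths \<and> \<eta> n \<in> holder_space H" "(\<lambda>n. holder_dist H (\<eta> n) \<omega>) \<longlonglongrightarrow> 0"
    using \<omega> by (rule test_approximation)
  obtain \<zeta> where \<zeta>: "\<forall>n. \<zeta> n \<in> test_paths \<and> \<zeta> n \<in> holder_space H" "(\<lambda>n. holder_dist H (\<zeta> n) \<upsilon>) \<longlonglongrightarrow> 0"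
    using \<upsilon> by (rule test_approximation)
  have p: "\<forall>n. \<eta> n \<in> paths" "\<forall>n. \<zeta> n \<in> paths"
    using \<eta> \<zeta> by (auto intro: test_path_in_path_space)
  have "(\<lambda>n. holder_dist H (\<lambda>s. a *\<^sub>R \<eta> n s + b *\<^sub>R \<zeta> n s) (\<lambda>s. a *\<^sub>R \<omega> s + b *\<^sub>R \<upsilon> s)) \<longlonglongrightarrow> 0"
  proof (rule tendsto_sandwich[OF _ _ tendsto_const])
    show "(\<lambda>n. \<bar>a\<bar> * holder_dist H (\<eta> n) \<omega> + \<bar>b\<bar> * holder_dist H (\<zeta> n) \<upsilon>) \<longlonglongrightarrow> 0"
      by (intro tendsto_add_zero tendsto_mult_right_zero \<eta> \<zeta>)
    have "holder_dist H (\<lambda>s. a *\<^sub>R \<eta> n s + b *\<^sub>R \<zeta> n s) (\<lambda>s. a *\<^sub>R \<omega> s + b *\<^sub>R \<upsilon> s)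
       \<le> \<bar>a\<bar> * holder_dist H (\<eta> n) \<omega> + \<bar>b\<bar> * holder_dist H (\<zeta> n) \<upsilon>" for n
    proof (rule holder_dist_le)
      show "holder_bound H (\<bar>a\<bar> * holder_dist H (\<eta> n) \<omega> + \<bar>b\<bar> * holder_dist H (\<zeta> n) \<upsilon>)
        (\<lambda>s. a *\<^sub>R \<eta> n s + b *\<^sub>R \<zeta> n s - (a *\<^sub>R \<omega> s + b *\<^sub>R \<upsilon> s))"
        using holder_bound_lincomb[OF holder_bound_dist[of "\<eta> n" H \<omega>] holder_bound_dist[of "\<zeta> n" H \<upsilon>], of a b]
          p \<omega> \<upsilon> by (simp add: path_space_holder algebra_simps)
    qed (simp add: holder_dist_nonneg)
    then show "\<forall>\<^sub>F n in sequentially. holder_dist H (\<lambda>s. a *\<^sub>R \<eta> n s + b *\<^sub>R \<zeta> n s) (\<lambda>s. a *\<^sub>R \<omega> s + b *\<^sub>R \<upsilon> s)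
       \<le> \<bar>a\<bar> * holder_dist H (\<eta> n) \<omega> + \<bar>b\<bar> * holder_dist H (\<zeta> n) \<upsilon>"
      by (intro always_eventually allI)
  qed (simp add: holder_dist_nonneg)
  then have "(\<lambda>n. D (\<lambda>s. a *\<^sub>R \<eta> n s + b *\<^sub>R \<zeta> n s) t) \<longlonglongrightarrow> D (\<lambda>s. a *\<^sub>R \<omega> s + b *\<^sub>R \<upsilon> s) t"
    using p \<omega> \<upsilon> by (intro path_limit_map[OF D_continuous] path_space_lincomb allI) auto
  moreover have "D (\<lambda>s. a *\<^sub>R \<eta> n s + b *\<^sub>R \<zeta> n s) t = a *\<^sub>R D (\<eta> n) t + b *\<^sub>R D (\<zeta> n) t" for n
    by (rule D_lincomb_test) (use \<eta> \<zeta> True in auto)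
  moreover have "(\<lambda>n. a *\<^sub>R D (\<eta> n) t + b *\<^sub>R D (\<zeta> n) t) \<longlonglongrightarrow> a *\<^sub>R D \<omega> t + b *\<^sub>R D \<upsilon> t"
    by (intro tendsto_add tendsto_scaleR tendsto_const path_limit_map[OF D_continuous] p \<omega> \<upsilon> \<eta> \<zeta>)
  ultimately show ?thesis using LIMSEQ_unique by simp
qed


section \<open>The commutator of the fractional operator with shifts\<close>

definition defect :: "real \<Rightarrow> (real \<Rightarrow> real ^ 'n) \<Rightarrow> real \<Rightarrow> real ^ 'n" where
  "defect u \<omega> t = D (past_shift u \<omega>) t - past_shift u (D \<omega>) t"

lemma defect_lincomb:
  assumes "\<omega> \<in> paths" "\<eta> \<in> paths" "u \<ge> 0"
  shows "defect u (\<lambda>s. a *\<^sub>R \<omega> s + b *\<^sub>R \<eta> s) t = a *\<^sub>R defect u \<omega> t + b *\<^sub>R defect u \<eta> t"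
proof -
  have "past_shift u (\<lambda>s. a *\<^sub>R \<omega> s + b *\<^sub>R \<eta> s)
      = (\<lambda>s. a *\<^sub>R past_shift u \<omega> s + b *\<^sub>R past_shift u \<eta> s)"
    by (auto simp: past_shift_def fun_eq_iff algebra_simps)
  then have "D (past_shift u (\<lambda>s. a *\<^sub>R \<omega> s + b *\<^sub>R \<eta> s)) t
      = a *\<^sub>R D (past_shift u \<omega>) t + b *\<^sub>R D (past_shift u \<eta>) t"
    by (simp add: D_lincomb past_shift_path assms)
  moreover have "past_shift u (D (\<lambda>s. a *\<^sub>R \<omega> s + b *\<^sub>R \<eta> s)) t
      = a *\<^sub>R past_shift u (D \<omega>) t + b *\<^sub>R past_shift u (D \<eta>) t"
    by (simp add: past_shift_def D_lincomb assms algebra_simps)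
  ultimately show ?thesis by (simp add: defect_def algebra_simps)
qed

lemma defect_diff:
  assumes "\<omega> \<in> paths" "\<eta> \<in> paths" "u \<ge> 0"
  shows "defect u (\<lambda>s. \<omega> s - \<eta> s) t = defect u \<omega> t - defect u \<eta> t"
  using defect_lincomb[OF assms, of 1 "-1" t] by simp

lemma path_diff: "\<omega> \<in> paths \<Longrightarrow> \<eta> \<in> paths \<Longrightarrow> (\<lambda>s. \<omega> s - \<eta> s) \<in> paths"
  using path_space_lincomb[of \<omega> H \<eta> 1 "-1"] by simp

lemma defect_test_eq_0:
  assumes \<eta>: "\<eta> \<in> test_paths" "\<eta> (- u) = 0" "\<eta> \<in> holder_space H" and u: "u \<ge> 0"
  shows "defect u \<eta> t = 0"
proof (cases "t \<le> 0")
  case True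
  obtain \<alpha> where \<alpha>: "\<alpha> > 0" "\<And>\<omega> t. \<omega> \<in> test_paths \<Longrightarrow> t \<le> 0 \<Longrightarrow>
      D \<omega> t = (1 / \<alpha>) *\<^sub>R (LINT r:{..0}|lborel. fractional_integrand H \<omega> t r)"
    using D_formula by blast
  have tu: "t - u \<le> 0" "- u \<le> 0" using True u by auto
  have "(LINT r:{..0}|lborel. fractional_integrand H (past_shift u \<eta>) t r)
      = (LINT r:{..0}|lborel. fractional_integrand H \<eta> (t - u) r - fractional_integrand H \<eta> (- u) r)"
    by (intro set_lebesgue_integral_cong) (auto simp: fractional_integrand_shift[OF \<eta>(1) u True])
  also have "\<dots> = (LINT r:{..0}|lborel. fractional_integrand H \<eta> (t - u) r)
      - (LINT r:{..0}|lborel. fractional_integrand H \<eta> (- u) r)"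
    by (rule set_integral_diff) (intro fractional_integrand_integrable \<eta> tu H)+
  finally have *: "(LINT r:{..0}|lborel. fractional_integrand H (past_shift u \<eta>) t r)
    = (LINT r:{..0}|lborel. fractional_integrand H \<eta> (t - u) r)
      - (LINT r:{..0}|lborel. fractional_integrand H \<eta> (- u) r)" .
  have "past_shift u (D \<eta>) t = D \<eta> (t - u) - D \<eta> (- u)"
    using True by (simp add: past_shift_def)
  then show ?thesis
    unfolding defect_def \<alpha>(2)[OF shift_test_path[OF \<eta>(1,2) u] True] \<alpha>(2)[OF \<eta>(1) tu(1)]
      \<alpha>(2)[OF \<eta>(1) tu(2)] * by (simp add: scaleR_diff_right)
next
  case False
  have "past_shift u \<eta> \<in> paths" using \<eta> u by (intro past_shift_path test_path_in_path_space)
  then show ?thesis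
    using False path_space_nonneg[OF D_path, of _ t] by (simp add: defect_def past_shift_def)
qed

text \<open>A lift of values to test paths with norm controlled linearly. It permits correcting the
  value of an approximating test path at \<open>- u\<close> at a cost that tends to 0 with this
  value.\<close>

lemma path_value:
  assumes "u > 0"
  obtains \<zeta> :: "real ^ 'n \<Rightarrow> real \<Rightarrow> real ^ 'n" where "\<forall>v. \<zeta> v \<in> test_paths \<and> \<zeta> v \<in> holder_space H \<and> \<zeta> v (- u) = v"
    "\<exists>K\<ge>0. \<forall>v. holder_bound H (K * norm v) (\<zeta> v)"
proof -
  obtain \<eta> :: "real \<Rightarrow> real ^ 'n" and i where \<eta>: "\<eta> \<in> test_paths" "\<eta> \<in> holder_space H" "\<eta> (- u) $ i \<noteq> 0"
    using nondegenerate[OF assms] by blast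
  obtain C where C: "C \<ge> 0" "holder_bound H C \<eta>"
    using \<eta>(2) by (auto simp: holder_space_iff)
  define \<zeta> where "\<zeta> v = (\<lambda>s. (\<eta> s $ i) *\<^sub>R ((1 / \<eta> (- u) $ i) *\<^sub>R v))" for v :: "real ^ 'n"
  have "\<zeta> v \<in> test_paths \<and> \<zeta> v \<in> holder_space H \<and> \<zeta> v (- u) = v" for v
  proof (intro conjI)
    show "\<zeta> v \<in> test_paths"
      unfolding \<zeta>_def by (rule component_test_paths[OF \<eta>(1)])
    show "\<zeta> v \<in> holder_space H"
      unfolding \<zeta>_def by (rule path_operator_holder_space[OF path_operator_component \<eta>(2)])
  qed (simp add: \<zeta>_def \<eta>)
  moreover have "holder_bound H (C / \<bar>\<eta> (- u) $ i\<bar> * norm v) (\<zeta> v)" for v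
  proof -
    have "holder_bound H (norm ((1 / \<eta> (- u) $ i) *\<^sub>R v) * C) (\<zeta> v)"
      unfolding \<zeta>_def
      using path_operator_component[of H "(1 / \<eta> (- u) $ i) *\<^sub>R v" i] C \<eta>(2)
      unfolding path_operator_def holder_space_def by blast
    then show ?thesis by (simp add: mult.commute)
  qed
  moreover have "C / \<bar>\<eta> (- u) $ i\<bar> \<ge> 0" using C by simp
  ultimately show ?thesis using that by blast
qed

lemma defect_eq_0:
  assumes \<omega>: "\<omega> \<in> paths" "\<omega> (- u) = 0" and u: "u > 0"
  shows "defect u \<omega> t = 0"
proof -
  obtain \<zeta> :: "real ^ 'n \<Rightarrow> real \<Rightarrow> real ^ 'n" where \<zeta>: "\<forall>v. \<zeta> v \<in> test_paths \<and> \<zeta> v \<in> holder_space H \<and> \<zeta> v (- u) = v"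
    and K: "\<exists>K\<ge>0. \<forall>v. holder_bound H (K * norm v) (\<zeta> v)"
    using u by (rule path_value)
  obtain K where K: "K \<ge> 0" "\<forall>v. holder_bound H (K * norm v) (\<zeta> v)" using K by blast
  obtain \<eta> where \<eta>: "\<forall>n. \<eta> n \<in> test_paths \<and> \<eta> n \<in> holder_space H" "(\<lambda>n. holder_dist H (\<eta> n) \<omega>) \<longlonglongrightarrow> 0"
    using \<omega>(1) by (rule test_approximation)
  have \<eta>p: "\<forall>n. \<eta> n \<in> paths" using \<eta> by (auto intro: test_path_in_path_space)
  have lim0: "(\<lambda>n. \<eta> n (- u)) \<longlonglongrightarrow> 0"
    using path_limit_eval[OF \<eta>p \<omega>(1) \<eta>(2), of "- u"] \<omega>(2) by simp
  \<comment> \<open>The approximants are corrected to vanish at \<open>- u\<close>, so that their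
    shifts are again test paths; the correction tends to 0 because
    \<open>\<omega> (- u) = 0\<close>.\<close>
  define \<xi> where "\<xi> n = (\<lambda>s. 1 *\<^sub>R \<eta> n s + (-1) *\<^sub>R \<zeta> (\<eta> n (- u)) s)" for n
  have \<xi>1: "\<xi> n \<in> test_paths" for n
    unfolding \<xi>_def using \<eta> \<zeta> by (intro test_paths_lincomb) auto
  have \<xi>2: "\<xi> n \<in> holder_space H" for n
    unfolding \<xi>_def using \<eta> \<zeta> by (intro holder_space_lincomb) auto
  have \<xi>3: "\<xi> n (- u) = 0" for n
    using \<zeta> by (simp add: \<xi>_def)
  note \<xi> = \<xi>1 \<xi>2 \<xi>3
  have \<xi>p: "\<forall>n. \<xi> n \<in> paths" using \<xi> by (auto intro: test_path_in_path_space)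
  have lim: "(\<lambda>n. holder_dist H (\<xi> n) \<omega>) \<longlonglongrightarrow> 0"
  proof (rule tendsto_sandwich[OF _ _ tendsto_const])
    show "(\<lambda>n. K * norm (\<eta> n (- u)) + holder_dist H (\<eta> n) \<omega>) \<longlonglongrightarrow> 0"
      by (intro tendsto_add_zero tendsto_mult_right_zero tendsto_norm_zero lim0 \<eta>)
    have "holder_dist H (\<xi> n) \<omega> \<le> K * norm (\<eta> n (- u)) + holder_dist H (\<eta> n) \<omega>" for n
    proof -
      have "holder_bound H (\<bar>-1\<bar> * (K * norm (\<eta> n (- u))) + \<bar>0\<bar> * 0)
          (\<lambda>s. (-1) *\<^sub>R \<zeta> (\<eta> n (- u)) s + 0 *\<^sub>R 0)"
        using K by (intro holder_bound_lincomb) (auto simp: holder_bound_def)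
      then have "holder_dist H (\<xi> n) (\<eta> n) \<le> K * norm (\<eta> n (- u))"
        using K by (intro holder_dist_le) (auto simp: \<xi>_def)
      moreover have "holder_dist H (\<xi> n) \<omega> \<le> holder_dist H (\<xi> n) (\<eta> n) + holder_dist H (\<eta> n) \<omega>"
        using \<xi> \<eta> path_space_holder[OF \<omega>(1)]
        by (intro Metric_space.triangle[OF Metric_space_holder_space]) auto
      ultimately show ?thesis by simp
    qed
    then show "\<forall>\<^sub>F n in sequentially. holder_dist H (\<xi> n) \<omega> \<le> K * norm (\<eta> n (- u)) + holder_dist H (\<eta> n) \<omega>"
      by (intro always_eventually allI)
  qed (simp add: holder_dist_nonneg)
  have u0: "u \<ge> 0" using u by simp
  note conv = path_limit_map[OF _ \<xi>p \<omega>(1) lim]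
  have "(\<lambda>n. D (past_shift u (\<xi> n)) t) \<longlonglongrightarrow> D (past_shift u \<omega>) t"
    using conv[OF continuous_map_compose[OF past_shift_continuous[OF u0] D_continuous]] by (simp add: o_def)
  moreover have "(\<lambda>n. past_shift u (D (\<xi> n)) t) \<longlonglongrightarrow> past_shift u (D \<omega>) t"
    unfolding past_shift_def by (cases "t \<le> 0") (auto intro!: tendsto_diff conv[OF D_continuous])
  ultimately have "(\<lambda>n. defect u (\<xi> n) t) \<longlonglongrightarrow> defect u \<omega> t"
    unfolding defect_def by (rule tendsto_diff)
  then show ?thesis
    using defect_test_eq_0[OF \<xi>(1,3,2) u0] LIMSEQ_unique[OF _ tendsto_const] by fastforce
qed

lemma defect_cong:
  assumes "\<omega> \<in> paths" "\<eta> \<in> paths" "u > 0" "\<omega> (- u) = \<eta> (- u)"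
  shows "defect u \<omega> t = defect u \<eta> t"
  using defect_eq_0[OF path_diff[OF assms(1,2)], of u t] assms defect_diff[OF assms(1,2), of u t] by simp

text \<open>The product rule for the commutator with a composition of two shifts.\<close>

lemma defect_add:
  assumes "\<omega> \<in> paths" "u > 0" "w > 0"
  shows "defect (u + w) \<omega> t = defect u (past_shift w \<omega>) t + past_shift u (defect w \<omega>) t"
proof -
  have "past_shift u (past_shift w \<omega>) = past_shift (u + w) \<omega>"
    using assms by (auto simp: past_shift_def fun_eq_iff algebra_simps)
  moreover have "past_shift u (past_shift w (D \<omega>)) = past_shift (u + w) (D \<omega>)"
    using assms by (auto simp: past_shift_def fun_eq_iff algebra_simps)
  moreover have "past_shift u (defect w \<omega>) t
      = past_shift u (D (past_shift w \<omega>)) t - past_shift u (past_shift w (D \<omega>)) t"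
    by (simp add: past_shift_def defect_def)
  ultimately show ?thesis by (simp add: defect_def)
qed

text \<open>The defect sees neither more of \<omega> than one value nor the time at which it is
  taken. The path \<open>e\<close> inserts a flat stretch of length \<open>w\<close> between time 0
  and \<eta>; the shift over this stretch has no defect, so \<open>defect_add\<close> trades
  \<open>u\<close> for \<open>u + w\<close>.\<close>

lemma defect_past_shift_cong:
  assumes \<omega>: "\<omega> \<in> paths" and \<eta>: "\<eta> \<in> paths" and uw: "u > 0" "w > 0" and eq: "\<omega> (- u - w) = \<eta> (- u)"
  shows "defect (u + w) \<omega> t = defect u \<eta> t"
proof -
  define e where "e = glue_past w \<eta>"
  have e: "e \<in> paths" using \<eta> uw by (simp add: e_def glue_past_path)
  have ew: "e (- w) = 0" "e (- u - w) = \<eta> (- u)"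
    using uw path_space_nonneg[OF \<eta>, of 0] by (simp_all add: e_def glue_past_def reparam_def min_def)
  have "defect (u + w) \<omega> t = defect (u + w) e t"
    using \<omega> e uw eq ew by (intro defect_cong) auto
  also have "\<dots> = defect u (past_shift w e) t + past_shift u (defect w e) t"
    by (rule defect_add[OF e uw])
  also have "past_shift u (defect w e) t = 0"
    by (simp add: past_shift_def defect_eq_0[OF e ew(1) uw(2)])
  also have "defect u (past_shift w e) t = defect u \<eta> t"
    using e \<eta> uw ew by (intro defect_cong past_shift_path) (auto simp: past_shift_def)
  finally show ?thesis by simp
qed

lemma defect_cong':
  assumes \<omega>: "\<omega> \<in> paths" and \<eta>: "\<eta> \<in> paths" and uw: "u > 0" "w > 0" and eq: "\<omega> (- u) = \<eta> (- w)"
  shows "defect u \<omega> t = defect w \<eta> t"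
proof (cases u w rule: linorder_cases)
  case less
  then show ?thesis
    using defect_past_shift_cong[OF \<eta> \<omega> uw(1), of "w - u" t] eq by simp
next
  case equal
  then show ?thesis using assms by (auto intro: defect_cong)
next
  case greater
  then show ?thesis
    using defect_past_shift_cong[OF \<omega> \<eta> uw(2), of "u - w" t] eq by simp
qed

text \<open>Write \<open>g v\<close> for the defect of any path with value \<open>v\<close> at the
  time of the shift; by \<open>defect_cong'\<close> this is well defined, and \<open>g\<close> is
  additive. Then \<open>defect_add\<close> reduces the claim to \<open>g (\<omega> (- u - w)) - g
  (\<omega> (- u - w) - \<omega> (- w)) = g (\<omega> (- w))\<close>. The paths \<open>?e\<close>
  and \<open>?f\<close> realise the two values on the left at the common time
  \<open>- w\<close>.\<close>

lemma past_shift_defect: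
  assumes \<omega>: "\<omega> \<in> paths" and uw: "u > 0" "w > 0"
  shows "past_shift u (defect w \<omega>) t = defect w \<omega> t"
proof -
  obtain \<zeta> :: "real ^ 'n \<Rightarrow> real \<Rightarrow> real ^ 'n" where \<zeta>: "\<forall>v. \<zeta> v \<in> test_paths \<and> \<zeta> v \<in> holder_space H \<and> \<zeta> v (- w) = v"
    and K: "\<exists>K\<ge>0. \<forall>v. holder_bound H (K * norm v) (\<zeta> v)"
    using uw(2) by (rule path_value)
  have \<zeta>p: "\<zeta> v \<in> paths" "\<zeta> v (- w) = v" for v using \<zeta> by (auto intro: test_path_in_path_space)
  let ?e = "\<zeta> (\<omega> (- u - w))" and ?f = "\<zeta> (\<omega> (- u - w) - \<omega> (- w))"
  have "past_shift u (defect w \<omega>) t = defect (u + w) \<omega> t - defect u (past_shift w \<omega>) t"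
    by (simp add: defect_add[OF \<omega> uw])
  also have "defect (u + w) \<omega> t = defect w ?e t"
    using uw \<omega> \<zeta>p by (intro defect_cong') auto
  also have "defect u (past_shift w \<omega>) t = defect w ?f t"
    using uw \<omega> \<zeta>p by (intro defect_cong' past_shift_path) (auto simp: past_shift_def)
  also have "defect w ?e t - defect w ?f t = defect w (\<lambda>s. ?e s - ?f s) t"
    using uw \<zeta>p by (simp add: defect_diff)
  also have "\<dots> = defect w \<omega> t"
    using uw \<omega> \<zeta>p by (intro defect_cong path_diff) auto
  finally show ?thesis .
qed

text \<open>Shift invariance makes \<open>p\<close> additive, so its value at
  \<open>- (real n * x)\<close> is \<open>n\<close> times that at \<open>- x\<close>. In the space
  with index \<open>1 - H\<close> the weight between 0 and \<open>- (real n * x)\<close> is of order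
  \<open>n powr ((1 + H) / 2)\<close>, and \<open>(1 + H) / 2 < 1\<close>.\<close>

lemma linear_path_eq_0:
  assumes p: "p \<in> holder_space (1 - H)" and shift: "\<And>u t. u > 0 \<Longrightarrow> past_shift u p t = p t"
  shows "p t = (0 :: real ^ 'n)"
proof (cases "t < 0")
  case False
  then show ?thesis using p by (simp add: holder_space_def)
next
  case True
  define x where "x = - t"
  have x: "x > 0" "t = - x" using True by (auto simp: x_def)
  have add: "p (s - u) = p s + p (- u)" if "u > 0" "s \<le> 0" for s u
    using shift[OF that(1), of s] that by (simp add: past_shift_def algebra_simps)
  have lin: "p (- (real n * x)) = real n *\<^sub>R p (- x)" for n
  proof (induction n)
    case 0
    then show ?case using p by (simp add: holder_space_def)
  next
    case (Suc n)
    have "- (real (Suc n) * x) = - (real n * x) - x" by (simp add: algebra_simps)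
    then have "p (- (real (Suc n) * x)) = p (- (real n * x)) + p (- x)"
      using add[of x "- (real n * x)"] x by simp
    then show ?case unfolding Suc by (simp add: scaleR_add_left)
  qed
  obtain C where C: "C \<ge> 0" "holder_bound (1 - H) C p"
    using p by (auto simp: holder_space_iff)
  have le: "norm (p t) \<le> (C * sqrt (1 + x) * x powr (H / 2)) * real (Suc n) powr (- ((1 - H) / 2))" for n
  proof -
    let ?n = "real (Suc n)"
    have "norm (p (- (?n * x)) - p 0) \<le> C * holder_weight (1 - H) 0 (- (?n * x))"
      using C(2) x unfolding holder_bound_def by (intro C(2)[unfolded holder_bound_def, rule_format]) auto
    then have "?n * norm (p t) \<le> C * (sqrt (1 + ?n * x) * (?n * x) powr (H / 2))"
      using p x unfolding lin by (simp add: holder_weight_def holder_space_def del: of_nat_Suc)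
    also have "\<dots> \<le> C * (sqrt (?n * (1 + x)) * (?n * x) powr (H / 2))"
      using C by (intro mult_left_mono mult_right_mono real_sqrt_le_mono) (auto simp: algebra_simps)
    also have "sqrt (?n * (1 + x)) = ?n powr (1/2) * sqrt (1 + x)"
      by (simp add: real_sqrt_mult powr_half_sqrt)
    also have "(?n * x) powr (H / 2) = ?n powr (H / 2) * x powr (H / 2)"
      using x by (simp add: powr_mult)
    finally have "?n * norm (p t)
        \<le> C * (?n powr (1/2) * sqrt (1 + x) * (?n powr (H / 2) * x powr (H / 2)))"
      .
    also have "\<dots> = (C * sqrt (1 + x) * x powr (H / 2)) * (?n powr (1/2) * ?n powr (H / 2))"
      by (simp add: mult_ac)
    also have "?n powr (1/2) * ?n powr (H / 2) = ?n * ?n powr (- ((1 - H) / 2))"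
    proof -
      have "?n powr (1/2) * ?n powr (H / 2) = ?n powr (1 + - ((1 - H) / 2))"
        by (subst powr_add[symmetric]) (simp add: field_simps)
      with powr_add[of ?n 1 "- ((1 - H) / 2)"] show ?thesis by (simp del: of_nat_Suc)
    qed
    finally have "?n * norm (p t) \<le> ?n * ((C * sqrt (1 + x) * x powr (H / 2)) * ?n powr (- ((1 - H) / 2)))"
      by (simp add: mult_ac)
    then show ?thesis
      by (rule mult_left_le_imp_le) simp
  qed
  have "(\<lambda>n. (C * sqrt (1 + x) * x powr (H / 2)) * real (Suc n) powr (- ((1 - H) / 2))) \<longlonglongrightarrow> 0"
    using H by (intro tendsto_mult_right_zero tendsto_neg_powr filterlim_compose[OF filterlim_real_sequentially filterlim_Suc]) auto
  then have "norm (p t) \<le> 0"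
    by (rule LIMSEQ_le_const) (use le in auto)
  then show ?thesis by simp
qed

text \<open>The commutator vanishes on paths with \<open>\<omega> (- u) = 0\<close>, where the integral formula applies to
  both sides. Hence it depends on \<open>\<omega> (- u)\<close> only and, by its cocycle property, is a path invariant
  under shifts; such a path is linear, and the weight excludes linear growth.\<close>

lemma D_past_shift:
  assumes "\<omega> \<in> paths" "u \<ge> 0"
  shows "D (past_shift u \<omega>) = past_shift u (D \<omega>)"
\<comment> \<open>At time 0 all paths vanish, so the lifts of \<open>path_value\<close> exist for
  \<open>u > 0\<close> only.\<close>
proof (cases "u = 0")
  case True
  have "past_shift 0 \<eta> = \<eta>" if "\<eta> \<in> path_space k" for \<eta> :: "real \<Rightarrow> real ^ 'n" and k
    using that by (auto simp: past_shift_def fun_eq_iff path_space_nonneg)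
  then show ?thesis using True assms D_path by metis
next
  case False
  then have u: "u > 0" using assms by simp
  have "defect u \<omega> \<in> holder_space (1 - H)"
  proof -
    have "past_shift u (D \<omega>) \<in> holder_space (1 - H)"
      using assms H by (intro path_operator_holder_space[OF path_operator_past_shift] path_space_holder D_path) auto
    moreover have "D (past_shift u \<omega>) \<in> holder_space (1 - H)"
      using assms by (intro path_space_holder D_path past_shift_path)
    moreover have "defect u \<omega> = (\<lambda>t. D (past_shift u \<omega>) t - past_shift u (D \<omega>) t)"
      by (simp add: defect_def fun_eq_iff)
    ultimately show ?thesis using holder_space_diff by auto
  qed
  then have "defect u \<omega> t = 0" for t
    by (rule linear_path_eq_0) (rule past_shift_defect[OF assms(1) _ u])
  then show ?thesis by (auto simp: defect_def fun_eq_iff)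
qed

end

section \<open>The pullback flow\<close>

lemma fractional_paths_intro:
  fixes P :: "(real \<Rightarrow> real ^ 'n) measure"
  assumes H: "0 < H" "H < 1" and P: "noise_measure H P" and D: "fractional_operator H P D"
    and dis: "disintegration P \<Phi> \<mu> B' \<kappa>"
  shows "fractional_paths H D"
proof
  interpret prob_space P using P by (simp add: noise_measure_def)
  have sp: "space P = path_space H" using P by (simp add: noise_measure_def)
  show "0 < H" "H < 1" by fact+
  show "continuous_map (path_topology H) (path_topology (1 - H)) D"
    using D by (simp add: fractional_operator_def)
  show "\<exists>\<alpha>>0. \<forall>\<omega>\<in>test_paths. \<forall>t\<le>0.
      D \<omega> t = (1 / \<alpha>) *\<^sub>R (LINT r:{..0}|lborel. fractional_integrand H \<omega> t r)"
    using D unfolding fractional_operator_def fractional_integrand_def by blast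
  have B': "B' \<in> sets P" "emeasure P B' = 1"
    and glue: "\<And>\<omega> \<eta> t. \<omega> \<in> B' \<Longrightarrow> \<eta> \<in> space P \<Longrightarrow> t \<ge> 0 \<Longrightarrow> glue t \<omega> \<eta> \<in> B'"
    using dis by (auto simp: disintegration_def)
  from B'(2) obtain \<omega>' where \<omega>': "\<omega>' \<in> B'" by fastforce
  have B'_path: "B' \<subseteq> path_space H" using sets.sets_into_space[OF B'(1)] sp by simp
  show "glue_future t \<omega> \<in> path_space H" if t: "t \<ge> 0" and \<omega>: "\<omega> \<in> path_space H"
    for t and \<omega> :: "real \<Rightarrow> real ^ 'n"
  proof -
    have z: "(\<lambda>_. 0) \<in> path_space H" by (rule path_space_zero)
    \<comment> \<open>Both glued paths lie in \<open>B'\<close> by the disintegration. They have the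
      same past \<omega>', and the zero path contributes nothing, so their difference is
      \<open>glue_future t \<omega>\<close>.\<close>
    have "(\<lambda>s. 1 *\<^sub>R glue t \<omega>' \<omega> s + (-1) *\<^sub>R glue t \<omega>' (\<lambda>_. 0) s) \<in> path_space H"
      using glue[OF \<omega>' _ t] \<omega> z B'_path sp by (intro path_space_lincomb) auto
    moreover have "glue t \<omega>' \<omega> = (\<lambda>s. glue_past t \<omega>' s + glue_future t \<omega> s)"
      "glue t \<omega>' (\<lambda>_. 0) = (\<lambda>s. glue_past t \<omega>' s + glue_future t (\<lambda>_. 0) s)"
      using \<omega>' B'_path \<omega> t by (auto intro!: glue_eq path_space_nonneg)
    moreover have "glue_future t (\<lambda>_. 0 :: real ^ 'n) s = 0" for s
      by (simp add: glue_future_def reparam_def)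
    ultimately show ?thesis by simp
  qed
  show "\<exists>\<eta> :: real \<Rightarrow> real ^ 'n. \<eta> \<in> test_paths \<and> \<eta> \<in> holder_space H \<and> (\<exists>i. \<eta> (- u) $ i \<noteq> 0)" if u: "u > 0" for u
  proof -
    fix i :: 'n
    \<comment> \<open>The variance \<open>u\<close> of Brownian motion at \<open>- u\<close> is
      positive, so some path has a nonzero component there; a test path close enough in norm
      inherits this.\<close>
    have "(LINT \<omega>|P. \<omega> (- u) $ i * \<omega> (- u) $ i) = u"
      using P u by (simp add: noise_measure_def reversed_brownian_motion_def centered_gaussian_process_cov_def)
    then obtain \<omega> where \<omega>: "\<omega> \<in> space P" "\<omega> (- u) $ i \<noteq> 0"
      using u Bochner_Integration.integral_cong[of P P "\<lambda>\<omega>. \<omega> (- u) $ i * \<omega> (- u) $ i" "\<lambda>_. 0"] by fastforce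
    let ?c = "holder_weight H 0 (- u) + 1"
    have c: "?c > 0" using holder_weight_nonneg[of H 0 "- u"] by linarith
    then have "\<bar>\<omega> (- u) $ i\<bar> / ?c > 0" using \<omega> by simp
    then obtain \<eta> where \<eta>: "\<eta> \<in> test_paths" "\<eta> \<in> holder_space H" "holder_dist H \<omega> \<eta> < \<bar>\<omega> (- u) $ i\<bar> / ?c"
      using \<omega>(1) unfolding sp path_space_iff by blast
    have "\<bar>(\<omega> (- u) - \<eta> (- u)) $ i\<bar> \<le> holder_dist H \<omega> \<eta> * holder_weight H 0 (- u)"
      using norm_diff_le_dist[of \<omega> H \<eta> "- u"] \<eta> \<omega> u sp component_le_norm_cart[of "\<omega> (- u) - \<eta> (- u)" i]
      by (auto simp: path_space_holder)
    also have "\<dots> \<le> holder_dist H \<omega> \<eta> * ?c"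
      by (intro mult_left_mono holder_dist_nonneg) simp
    also have "\<dots> < \<bar>\<omega> (- u) $ i\<bar>" using \<eta>(3) c by (simp add: pos_less_divide_eq)
    finally have "\<eta> (- u) $ i \<noteq> 0" by auto
    then show ?thesis using \<eta> by blast
  qed
qed

locale sde = fractional_paths H D for H and D :: "(real \<Rightarrow> real ^ 'n) \<Rightarrow> (real \<Rightarrow> real ^ 'n)" +
  fixes P :: "(real \<Rightarrow> real ^ 'n) measure" and F :: "real ^ 'n \<Rightarrow> real ^ 'n" and \<sigma> :: "real ^ 'n ^ 'n"
    and \<Phi> :: "real \<Rightarrow> (real \<Rightarrow> real ^ 'n) \<times> (real \<Rightarrow> real ^ 'n) \<Rightarrow> real ^ 'n \<Rightarrow> real ^ 'n"
  assumes P: "prob_space P" and space_P: "space P = path_space H" and sets_P: "sets P = sets (path_borel H)"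
    and standing: "standing_conditions H F \<sigma>" and flow: "solution_flow H D F \<sigma> \<Phi>"

sublocale sde \<subseteq> prob_space P by (rule P)

context sde
begin

lemma sets_P_sigma: "sets P = sigma_sets (path_space H) {U. openin (path_topology H) U}"
proof -
  have "{U. openin (path_topology H) U} \<subseteq> Pow (path_space H :: (real \<Rightarrow> real ^ 'n) set)"
    using openin_subset by fastforce
  then show ?thesis by (simp add: sets_P path_borel_def)
qed

lemma open_sets_P: "openin (path_topology H) U \<Longrightarrow> U \<in> sets P"
  by (simp add: sets_P_sigma)

lemma continuous_measurable_path:
  assumes "continuous_map (path_topology H) (path_topology H) T"
  shows "T \<in> P \<rightarrow>\<^sub>M P"
proof (rule measurable_sigma_sets[OF sets_P_sigma])
  show "{U. openin (path_topology H) U} \<subseteq> Pow (path_space H :: (real \<Rightarrow> real ^ 'n) set)"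
    using openin_subset by fastforce
  show "T \<in> space P \<rightarrow> path_space H"
    using continuous_map_image_subset_topspace[OF assms] by (auto simp: space_P)
  show "T -` U \<inter> space P \<in> sets P" if "U \<in> {U. openin (path_topology H) U}" for U
  proof -
    have "openin (path_topology H) {x \<in> topspace (path_topology H). T x \<in> U}"
      using that by (intro openin_continuous_map_preimage[OF assms]) auto
    moreover have "{x \<in> topspace (path_topology H). T x \<in> U} = T -` U \<inter> space P"
      by (auto simp: space_P)
    ultimately show ?thesis using open_sets_P by metis
  qed
qed

lemma continuous_measurable_real:
  fixes T :: "(real \<Rightarrow> real ^ 'n) \<Rightarrow> 'b :: topological_space"
  assumes "continuous_map (path_topology H) euclidean T"
  shows "T \<in> borel_measurable P"
proof (rule borel_measurableI)
  fix U :: "'b set" assume "open U"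
  then have "openin (path_topology H) {x \<in> topspace (path_topology H). T x \<in> U}"
    by (intro openin_continuous_map_preimage[OF assms]) (simp add: open_openin[symmetric])
  moreover have "{x \<in> topspace (path_topology H). T x \<in> U} = T -` U \<inter> space P"
    by (auto simp: space_P)
  ultimately show "T -` U \<inter> space P \<in> sets P" using open_sets_P by metis
qed

text \<open>This is \<sigma> applied to the forward noise at time \<open>s\<close> for the
  configuration shifted back by \<open>t\<close>: gluing the first \<open>s\<close> units of its
  future back to its past gives \<open>past_shift (t - s) \<omega>\<close>.\<close>

definition driver :: "real \<Rightarrow> (real \<Rightarrow> real ^ 'n) \<Rightarrow> real \<Rightarrow> real ^ 'n" where
  "driver t \<omega> s = - (\<sigma> *v D (past_shift (t - s) \<omega>) (- s))"

lemma past_shift_add: "u \<ge> 0 \<Longrightarrow> w \<ge> 0 \<Longrightarrow> past_shift u (past_shift w \<omega>) = past_shift (u + w) \<omega>"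
  by (auto simp: past_shift_def fun_eq_iff algebra_simps)

lemma driver_measurable:
  assumes "s \<in> {0..t}" shows "(\<lambda>\<omega>. driver t \<omega> s) \<in> borel_measurable P"
proof -
  have "continuous_map (path_topology H) (path_topology (1 - H)) (D \<circ> past_shift (t - s))"
    using assms by (intro continuous_map_compose[OF past_shift_continuous D_continuous]) auto
  from continuous_map_compose[OF this evaluation_continuous[of "1 - H" "- s"]]
  have "(\<lambda>\<omega>. D (past_shift (t - s) \<omega>) (- s)) \<in> borel_measurable P"
    by (intro continuous_measurable_real) (simp add: o_def)
  moreover have "continuous_on UNIV (\<lambda>x. - (\<sigma> *v x))"
    by (intro continuous_intros linear_continuous_on matrix_vector_mul_bounded_linear)
  ultimately show ?thesis
    unfolding driver_def by (rule borel_measurable_continuous_on[rotated])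
qed

lemma theta_minus:
  assumes "\<omega> \<in> paths" "t \<ge> 0"
  shows "theta (- t) (\<omega>, \<lambda>_. 0) = (past_shift t \<omega>, glue_future t \<omega>)"
\<comment> \<open>At time 0 the case distinction in \<open>theta\<close> takes its other
  branch.\<close>
proof (cases "t = 0")
  case True
  have "past_shift 0 \<omega> = \<omega>" "glue 0 \<omega> (\<lambda>_. 0) = \<omega>" "past_shift 0 (\<lambda>_. 0 :: real ^ 'n) = (\<lambda>_. 0)"
    "glue_future 0 \<omega> = (\<lambda>_. 0)"
    using path_space_nonneg[OF assms(1)]
    by (auto simp: past_shift_def glue_def glue_future_def reparam_def fun_eq_iff)
  then show ?thesis using True by (simp add: theta_def)
next
  case False
  have "glue t (\<lambda>_. 0) \<omega> = glue_future t \<omega>"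
    using glue_eq[of "\<lambda>_. 0" \<omega> t] assms path_space_nonneg[OF assms(1), of 0]
    by (simp add: glue_past_def reparam_def fun_eq_iff)
  then show ?thesis using False assms by (simp add: theta_def)
qed

lemma glue_past_shift:
  assumes "\<omega> \<in> paths" "0 \<le> s" "s \<le> t"
  shows "glue s (past_shift t \<omega>) (glue_future t \<omega>) = past_shift (t - s) \<omega>"
  using assms by (auto simp: glue_def past_shift_def glue_future_def reparam_def fun_eq_iff algebra_simps min_def)

lemma pullback_solution:
  assumes \<omega>: "\<omega> \<in> paths" and t: "t \<ge> 0"
  shows "ode_solution F (driver t \<omega>) x t (\<lambda>s. \<Phi> s (past_shift t \<omega>, glue_future t \<omega>) x)"
proof -
  have "(past_shift t \<omega>, glue_future t \<omega>) \<in> paths \<times> paths"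
    using \<omega> t by (simp add: past_shift_path glue_future_path)
  with flow have *: "continuous_on {0..} (\<lambda>s. \<Phi> s (past_shift t \<omega>, glue_future t \<omega>) x)"
    "\<And>s. s \<ge> 0 \<Longrightarrow> \<Phi> s (past_shift t \<omega>, glue_future t \<omega>) x
      = x + integral {0..s} (\<lambda>r. F (\<Phi> r (past_shift t \<omega>, glue_future t \<omega>) x))
        + \<sigma> *v forward_fbm D s (past_shift t \<omega>, glue_future t \<omega>)"
    unfolding solution_flow_def by blast+
  have "\<sigma> *v forward_fbm D s (past_shift t \<omega>, glue_future t \<omega>) = driver t \<omega> s" if "s \<in> {0..t}" for s
    using that \<omega> by (simp add: forward_fbm_def glue_past_shift driver_def matrix_vector_mult_def
        vec_eq_iff sum_negf)
  then show ?thesis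
    unfolding ode_solution_def using * by (auto intro: continuous_on_subset)
qed

lemma pullback_eq:
  "\<omega> \<in> paths \<Longrightarrow> t \<ge> 0 \<Longrightarrow> pullback \<Phi> t \<omega> x = \<Phi> t (past_shift t \<omega>, glue_future t \<omega>) x"
  by (simp add: pullback_def theta_minus)

lemma F_differentiable: "F differentiable (at \<xi>)"
  using standing by (simp add: standing_conditions_def)

lemma F_continuous: "continuous_on UNIV F"
  using F_differentiable
  by (simp add: continuous_at_imp_continuous_on differentiable_imp_continuous_within)

lemma F_derivative_bounded: "\<exists>C. \<forall>\<xi>. norm \<xi> \<le> R \<longrightarrow> onorm (frechet_derivative F (at \<xi>)) \<le> C"
proof -
  obtain CF N where CF: "CF > 0" "\<And>\<xi>. onorm (frechet_derivative F (at \<xi>)) \<le> CF * (1 + norm \<xi>) ^ N"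
    using standing unfolding standing_conditions_def by blast
  have "onorm (frechet_derivative F (at \<xi>)) \<le> CF * (1 + R) ^ N" if "norm \<xi> \<le> R" for \<xi>
    using CF that by (intro order_trans[OF CF(2)] mult_left_mono power_mono) auto
  then show ?thesis by blast
qed

text \<open>The starting point is made part of the random parameter, with \<open>X = fst\<close>,
  which gives joint measurability at once.\<close>

lemma pullback_measurable:
  assumes t: "t \<ge> 0"
  shows "(\<lambda>(x, \<omega>). pullback \<Phi> t \<omega> x) \<in> borel_measurable (borel \<Otimes>\<^sub>M P)"
proof -
  let ?Y = "\<lambda>z s. \<Phi> s (past_shift t (snd z), glue_future t (snd z)) (fst z)"
  have "(\<lambda>z. ?Y z t) \<in> borel_measurable (borel \<Otimes>\<^sub>M P)"
  proof (rule ode_solution_measurable[OF F_differentiable F_derivative_bounded t, where X = fst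
        and b = "\<lambda>s z. driver t (snd z) s" and Y = ?Y and N = "borel \<Otimes>\<^sub>M P"])
    show "(\<lambda>z. driver t (snd z) s) \<in> borel_measurable (borel \<Otimes>\<^sub>M P)" if "s \<in> {0..t}" for s
      using driver_measurable[OF that] by measurable
    show "ode_solution F (\<lambda>s. driver t (snd z) s) (fst z) t (?Y z)" if "z \<in> space (borel \<Otimes>\<^sub>M P)" for z
      using that t by (intro pullback_solution) (auto simp: space_pair_measure space_P)
  qed simp
  then show ?thesis
    by (rule measurable_cong[THEN iffD1, rotated]) (auto simp: space_pair_measure space_P pullback_eq t)
qed

lemma pullback_measurable'[measurable]: "t \<ge> 0 \<Longrightarrow> (\<lambda>\<omega>. pullback \<Phi> t \<omega> x) \<in> borel_measurable P"
  using measurable_compose[OF measurable_Pair1'[of x borel P] pullback_measurable[of t]] by simp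

lemma dissipative:
  "\<exists>C1>0. \<exists>C2>0. \<forall>\<xi> \<eta>. (F \<eta> - F \<xi>) \<bullet> (\<eta> - \<xi>) \<le> C1 - C2 * (norm (\<eta> - \<xi>))\<^sup>2"
  "\<exists>C>0. \<forall>\<xi> \<eta>. (F \<eta> - F \<xi>) \<bullet> (\<eta> - \<xi>) \<le> C * (norm (\<eta> - \<xi>))\<^sup>2"
  using standing unfolding standing_conditions_def min.bounded_iff by blast+

text \<open>The case \<open>k = 0\<close> of the contraction lemma. The growth of the constant in
  \<open>t\<close> does no harm, as it is applied for one fixed \<open>t\<close> at a time.\<close>

lemma pullback_lipschitz:
  obtains C where "C \<ge> 0" "\<And>t \<omega> x y. t \<ge> 0 \<Longrightarrow> \<omega> \<in> paths \<Longrightarrow>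
    norm (pullback \<Phi> t \<omega> x - pullback \<Phi> t \<omega> y) \<le> exp (C * t) * norm (x - y)"
proof -
  obtain C where C: "C > 0" "\<And>\<xi> \<eta>. (F \<eta> - F \<xi>) \<bullet> (\<eta> - \<xi>) \<le> C * (norm (\<eta> - \<xi>))\<^sup>2"
    using dissipative by blast
  have "norm (pullback \<Phi> t \<omega> x - pullback \<Phi> t \<omega> y) \<le> exp (C * t) * norm (x - y)"
    if t: "t \<ge> 0" and \<omega>: "\<omega> \<in> paths" for t \<omega> x y
  proof -
    have "(norm (pullback \<Phi> t \<omega> x - pullback \<Phi> t \<omega> y))\<^sup>2 - 0 \<le> exp (2 * C * t) * ((norm (x - y))\<^sup>2 - 0)"
      unfolding pullback_eq[OF \<omega> t]
      by (rule ode_solution_contraction[OF F_continuous _ pullback_solution pullback_solution])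
        (use C t \<omega> in auto)
    also have "\<dots> = (exp (C * t) * norm (x - y))\<^sup>2"
      by (simp add: power_mult_distrib exp_double[symmetric] mult_ac)
    finally have "(norm (pullback \<Phi> t \<omega> x - pullback \<Phi> t \<omega> y))\<^sup>2 \<le> (exp (C * t) * norm (x - y))\<^sup>2" by simp
    then show ?thesis by (rule power2_le_imp_le) simp
  qed
  then show ?thesis using that[of C] C(1) by simp
qed

text \<open>The case \<open>k = C1 / C2\<close> with rate \<open>- C2\<close>: beyond distance
  \<open>sqrt (C1 / C2)\<close> the drift pulls solutions together, so the excess over the initial
  distance is bounded uniformly in \<open>t\<close>. Tightness rests on this.\<close>

lemma pullback_bounded_distance:
  obtains c where "c \<ge> 0" "\<And>t \<omega> x y. t \<ge> 0 \<Longrightarrow> \<omega> \<in> paths \<Longrightarrow>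
    norm (pullback \<Phi> t \<omega> x - pullback \<Phi> t \<omega> y) \<le> norm (x - y) + c"
proof -
  obtain C1 C2 where C: "C1 > 0" "C2 > 0" "\<And>\<xi> \<eta>. (F \<eta> - F \<xi>) \<bullet> (\<eta> - \<xi>) \<le> C1 - C2 * (norm (\<eta> - \<xi>))\<^sup>2"
    using dissipative by blast
  let ?k = "C1 / C2"
  have "norm (pullback \<Phi> t \<omega> x - pullback \<Phi> t \<omega> y) \<le> norm (x - y) + sqrt ?k"
    if t: "t \<ge> 0" and \<omega>: "\<omega> \<in> paths" for t \<omega> x y
  proof -
    have "(norm (pullback \<Phi> t \<omega> x - pullback \<Phi> t \<omega> y))\<^sup>2 - ?k \<le> exp (2 * (- C2) * t) * ((norm (x - y))\<^sup>2 - ?k)"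
      unfolding pullback_eq[OF \<omega> t]
      by (rule ode_solution_contraction[OF F_continuous _ pullback_solution pullback_solution])
        (use C t \<omega> in \<open>auto simp: algebra_simps\<close>)
    also have "\<dots> \<le> exp (2 * (- C2) * t) * (norm (x - y))\<^sup>2"
      using C by (intro mult_left_mono) auto
    also have "\<dots> \<le> 1 * (norm (x - y))\<^sup>2"
      using C t by (intro mult_right_mono) auto
    finally have "(norm (pullback \<Phi> t \<omega> x - pullback \<Phi> t \<omega> y))\<^sup>2 \<le> (norm (x - y))\<^sup>2 + (sqrt ?k)\<^sup>2"
      using C by simp
    also have "\<dots> \<le> (norm (x - y) + sqrt ?k)\<^sup>2"
      using C by (simp add: power2_sum)
    finally show ?thesis
      by (rule power2_le_imp_le) (use C in auto)
  qed
  moreover have "sqrt ?k \<ge> 0" using C by simp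
  ultimately show ?thesis using that[of "sqrt ?k"] by simp
qed

lemma ode_unique:
  assumes "ode_solution F b x t Y" "ode_solution F b x t Z" "s \<in> {0..t}"
  shows "Y s = Z s"
proof -
  obtain C where C: "C > 0" "\<And>\<xi> \<eta>. (F \<eta> - F \<xi>) \<bullet> (\<eta> - \<xi>) \<le> C * (norm (\<eta> - \<xi>))\<^sup>2"
    using dissipative by blast
  have "(norm (Y s - Z s))\<^sup>2 - 0 \<le> exp (2 * C * s) * ((norm (x - x))\<^sup>2 - 0)"
    by (rule ode_solution_contraction[OF F_continuous _ assms]) (use C in auto)
  then show ?thesis by simp
qed

text \<open>Commutation of \<open>D\<close> with shifts enters here: it makes the increments of the driving path
  after time \<open>s\<close> those of the driving path of the later pullback.\<close>

lemma pullback_cocycle: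
  assumes \<omega>: "\<omega> \<in> paths" and st: "s \<ge> 0" "t \<ge> 0"
  shows "pullback \<Phi> t \<omega> (pullback \<Phi> s (past_shift t \<omega>) x) = pullback \<Phi> (s + t) \<omega> x"
proof -
  let ?\<omega>' = "past_shift t \<omega>"
  have \<omega>': "?\<omega>' \<in> paths" using \<omega> st by (simp add: past_shift_path)
  let ?V = "\<lambda>u. \<Phi> u (past_shift (s + t) \<omega>, glue_future (s + t) \<omega>) x"
  let ?Y = "\<lambda>u. \<Phi> u (past_shift s ?\<omega>', glue_future s ?\<omega>') x"
  have V: "ode_solution F (driver (s + t) \<omega>) x (s + t) ?V"
    using \<omega> st by (intro pullback_solution) auto
  \<comment> \<open>On the first leg both pullbacks see the same noise, since shifts add up.\<close>
  have d1: "driver (s + t) \<omega> u = driver s ?\<omega>' u" if "u \<in> {0..s}" for u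
    using that st past_shift_add[of "s - u" t \<omega>] by (simp add: driver_def algebra_simps)
  have d2: "driver (s + t) \<omega> (s + v) - driver (s + t) \<omega> s = driver t \<omega> v" if v: "v \<in> {0..t}" for v
  proof -
    let ?\<eta> = "past_shift (t - v) \<omega>"
    have "?\<eta> \<in> paths" using \<omega> v by (simp add: past_shift_path)
    then have "D (past_shift v ?\<eta>) = past_shift v (D ?\<eta>)"
      using v by (intro D_past_shift) auto
    moreover have "past_shift v ?\<eta> = past_shift t \<omega>"
      using v past_shift_add[of v "t - v" \<omega>] by simp
    ultimately have "D (past_shift t \<omega>) (- s) = D ?\<eta> (- s - v) - D ?\<eta> (- v)"
      using st by (simp add: past_shift_def)
    moreover have "s + t - (s + v) = t - v" "s + t - s = t" "- (s + v) = - s - v" by simp_all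
    ultimately show ?thesis
      by (simp add: driver_def matrix_vector_mult_diff_distrib)
  qed
  have "ode_solution F (driver (s + t) \<omega>) x s ?V"
    using V st by (auto simp: ode_solution_def intro: continuous_on_subset)
  then have "ode_solution F (driver s ?\<omega>') x s ?V"
    by (rule ode_solution_cong) (rule d1)
  from ode_unique[OF this pullback_solution[OF \<omega>' st(1)], of s] st
  have Vs: "?V s = pullback \<Phi> s ?\<omega>' x"
    by (simp add: pullback_eq[OF \<omega>' st(1)])
  have "ode_solution F (driver t \<omega>) (?V s) t (\<lambda>u. ?V (s + u))"
    by (rule ode_solution_cong[OF ode_solution_shift[OF F_continuous V st]]) (rule d2)
  from ode_unique[OF this pullback_solution[OF \<omega> st(2)], of t] st
  show ?thesis
    using \<omega> by (simp add: pullback_eq Vs)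
qed

text \<open>Together with the cocycle property this is the source of the Markov property: after a
  new stretch has been glued on, the first leg of the longer pullback depends on the old path
  only.\<close>

lemma past_shift_glue:
  "\<omega> \<in> paths \<Longrightarrow> \<eta> \<in> paths \<Longrightarrow> t \<ge> 0 \<Longrightarrow> past_shift t (glue t \<omega> \<eta>) = \<omega>"
  using path_space_nonneg[of \<omega> H] path_space_nonneg[of \<eta> H 0]
  by (auto simp: past_shift_def glue_def fun_eq_iff)


section \<open>The transition kernel\<close>

abbreviation M :: "((real ^ 'n) \<times> (real \<Rightarrow> real ^ 'n)) measure" where "M \<equiv> borel \<Otimes>\<^sub>M P"

lemma space_M: "space M = UNIV \<times> paths"
  by (simp add: space_pair_measure space_P)

lemma P_in_prob_algebra: "P \<in> space (prob_algebra P)"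
  by (simp add: space_prob_algebra P)

lemma glue_continuous:
  assumes \<omega>: "\<omega> \<in> paths" and t: "t \<ge> 0"
  shows "continuous_map (path_topology H) (path_topology H) (glue t \<omega>)"
proof (rule path_lipschitz_continuous)
  show "glue t \<omega> \<eta> \<in> paths" if "\<eta> \<in> paths" for \<eta> using \<omega> t that by (simp add: glue_path)
  fix \<eta> \<zeta> assume \<eta>: "\<eta> \<in> paths" and \<zeta>: "\<zeta> \<in> paths"
  have "holder_dist H (glue t \<omega> \<eta>) (glue t \<omega> \<zeta>) = holder_dist H (glue_future t \<eta>) (glue_future t \<zeta>)"
    using \<omega> \<eta> \<zeta> t by (simp add: glue_eq path_space_nonneg holder_dist_def)
  also have "\<dots> \<le> sqrt (1 + 2 * t) * holder_dist H \<eta> \<zeta>"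
    using \<eta> \<zeta> t H by (intro path_operator_dist[OF path_operator_glue_future] path_space_holder)
  finally show "holder_dist H (glue t \<omega> \<eta>) (glue t \<omega> \<zeta>) \<le> sqrt (1 + 2 * t) * holder_dist H \<eta> \<zeta>" .
qed (use t in simp)

lemma glue_measurable: "\<omega> \<in> paths \<Longrightarrow> t \<ge> 0 \<Longrightarrow> glue t \<omega> \<in> P \<rightarrow>\<^sub>M P"
  by (intro continuous_measurable_path glue_continuous)

text \<open>The law of the past as seen after time \<open>t\<close>, given the past \<omega>
  now.\<close>

definition glue_kernel :: "real \<Rightarrow> (real \<Rightarrow> real ^ 'n) \<Rightarrow> (real \<Rightarrow> real ^ 'n) measure" where
  "glue_kernel t \<omega> = distr P P (glue t \<omega>)"

text \<open>Continuity of the gluing map in each argument separately suffices, so that separability of the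
  path space is not needed for measurability of the kernel.\<close>

lemma glue_kernel_open:
  assumes t: "t \<ge> 0" and U: "openin (path_topology H) U"
  shows "(\<lambda>\<omega>. emeasure (glue_kernel t \<omega>) U) \<in> borel_measurable P"
proof (rule borel_measurableI_le)
  fix y :: ennreal
  interpret Metric_space paths "holder_dist H" by (rule Metric_space_path_space)
  let ?S = "{\<omega> \<in> paths. emeasure (glue_kernel t \<omega>) U \<le> y}"
  have em: "emeasure (glue_kernel t \<omega>) U = (\<integral>\<^sup>+ \<eta>. indicator U (glue t \<omega> \<eta>) \<partial>P)"
    "(\<lambda>\<eta>. indicator U (glue t \<omega> \<eta>) :: ennreal) \<in> borel_measurable P"
    if "\<omega> \<in> paths" for \<omega>
  proof -
    note [measurable] = glue_measurable[OF that t] open_sets_P[OF U]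
    show "(\<lambda>\<eta>. indicator U (glue t \<omega> \<eta>) :: ennreal) \<in> borel_measurable P" by measurable
    show "emeasure (glue_kernel t \<omega>) U = (\<integral>\<^sup>+ \<eta>. indicator U (glue t \<omega> \<eta>) \<partial>P)"
      by (simp add: glue_kernel_def nn_integral_indicator[symmetric] nn_integral_distr del: nn_integral_indicator)
  qed
  \<comment> \<open>The indicator of an open set is lower semicontinuous along convergent pasts;
    Fatou's lemma passes this to the integral, so sublevel sets are sequentially closed.\<close>
  have "closedin (path_topology H) ?S"
    unfolding path_topology_def metric_closedin_iff_sequentially_closed
  proof (intro conjI allI impI)
    fix \<xi> l assume "range \<xi> \<subseteq> ?S \<and> limitin mtopology \<xi> l sequentially"
    then have \<xi>: "\<And>n. \<xi> n \<in> paths" "\<And>n. emeasure (glue_kernel t (\<xi> n)) U \<le> y"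
      and l: "l \<in> paths" "(\<lambda>n. holder_dist H (\<xi> n) l) \<longlonglongrightarrow> 0"
      by (auto simp: limitin_metric_dist_null)
    have "indicator U (glue t l \<eta>) \<le> liminf (\<lambda>n. indicator U (glue t (\<xi> n) \<eta>) :: ennreal)"
      if \<eta>: "\<eta> \<in> paths" for \<eta>
    proof (cases "glue t l \<eta> \<in> U")
      case True
      have "(\<lambda>n. holder_dist H (glue t (\<xi> n) \<eta>) (glue t l \<eta>)) \<longlonglongrightarrow> 0"
      proof (rule tendsto_sandwich[OF _ _ tendsto_const])
        have "holder_dist H (glue t (\<xi> n) \<eta>) (glue t l \<eta>) \<le> sqrt (1 + 2 * t) * holder_dist H (\<xi> n) l" for n
        proof -
          have "holder_dist H (glue t (\<xi> n) \<eta>) (glue t l \<eta>) = holder_dist H (glue_past t (\<xi> n)) (glue_past t l)"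
            using \<xi>(1)[of n] l(1) \<eta> t by (simp add: glue_eq path_space_nonneg holder_dist_def)
          also have "\<dots> \<le> sqrt (1 + 2 * t) * holder_dist H (\<xi> n) l"
            using \<xi>(1) l(1) t H by (intro path_operator_dist[OF path_operator_glue_past] path_space_holder)
          finally show ?thesis .
        qed
        then show "\<forall>\<^sub>F n in sequentially. holder_dist H (glue t (\<xi> n) \<eta>) (glue t l \<eta>)
            \<le> sqrt (1 + 2 * t) * holder_dist H (\<xi> n) l"
          by (intro always_eventually allI)
        show "(\<lambda>n. sqrt (1 + 2 * t) * holder_dist H (\<xi> n) l) \<longlonglongrightarrow> 0"
          by (intro tendsto_mult_right_zero l)
      qed (simp add: holder_dist_nonneg)
      then have "limitin mtopology (\<lambda>n. glue t (\<xi> n) \<eta>) (glue t l \<eta>) sequentially"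
        unfolding limitin_metric_dist_null using \<xi>(1) l(1) \<eta> t by (simp add: glue_path)
      then have "\<forall>\<^sub>F n in sequentially. glue t (\<xi> n) \<eta> \<in> U"
        using U True unfolding limitin_def path_topology_def by blast
      then have "1 \<le> liminf (\<lambda>n. indicator U (glue t (\<xi> n) \<eta>) :: ennreal)"
        by (intro Liminf_bounded) (auto elim: eventually_mono)
      then show ?thesis using True by simp
    qed simp
    then have "emeasure (glue_kernel t l) U \<le> (\<integral>\<^sup>+ \<eta>. liminf (\<lambda>n. indicator U (glue t (\<xi> n) \<eta>)) \<partial>P)"
      unfolding em(1)[OF l(1)] by (intro nn_integral_mono) (simp add: space_P)
    also have "\<dots> \<le> liminf (\<lambda>n. \<integral>\<^sup>+ \<eta>. indicator U (glue t (\<xi> n) \<eta>) \<partial>P)"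
      by (intro nn_integral_liminf em(2) \<xi>)
    also have "\<dots> \<le> y"
      using \<xi> em(1) by (intro Liminf_le) auto
    finally show "l \<in> ?S" using l by simp
  qed auto
  then have "openin (path_topology H) (space P - ?S)"
    by (auto simp: closedin_def space_P)
  then have "space P - (space P - ?S) \<in> sets P"
    using open_sets_P by blast
  moreover have "space P - (space P - ?S) = {\<omega> \<in> space P. emeasure (glue_kernel t \<omega>) U \<le> y}"
    by (auto simp: space_P)
  ultimately show "{\<omega> \<in> space P. emeasure (glue_kernel t \<omega>) U \<le> y} \<in> sets P" by simp
qed

lemma glue_kernel_measurable:
  assumes t: "t \<ge> 0" shows "glue_kernel t \<in> P \<rightarrow>\<^sub>M prob_algebra P"
proof (rule measurable_prob_algebra_generated[OF sets_P_sigma])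
  show "Int_stable {U. openin (path_topology H) U}" by (auto simp: Int_stable_def)
  show "{U. openin (path_topology H) U} \<subseteq> Pow paths" using openin_subset by fastforce
  show "prob_space (glue_kernel t \<omega>)" if "\<omega> \<in> space P" for \<omega>
    unfolding glue_kernel_def using that t by (intro prob_space_distr glue_measurable) (auto simp: space_P)
  show "(\<lambda>\<omega>. emeasure (glue_kernel t \<omega>) U) \<in> borel_measurable P" if "U \<in> {U. openin (path_topology H) U}" for U
    using glue_kernel_open[OF t] that by simp
qed (simp add: glue_kernel_def)

definition flow_map :: "real \<Rightarrow> real ^ 'n \<Rightarrow> (real \<Rightarrow> real ^ 'n) \<Rightarrow> (real ^ 'n) \<times> (real \<Rightarrow> real ^ 'n)" where
  "flow_map t x \<omega> = (pullback \<Phi> t \<omega> x, \<omega>)"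

lemma flow_map_measurable2:
  assumes "t \<ge> 0" shows "(\<lambda>(x, \<omega>). flow_map t x \<omega>) \<in> M \<rightarrow>\<^sub>M M"
  using pullback_measurable[OF assms] unfolding flow_map_def by (simp add: split_beta)

lemma flow_map_measurable: "t \<ge> 0 \<Longrightarrow> flow_map t x \<in> P \<rightarrow>\<^sub>M M"
  using measurable_compose[OF measurable_Pair1'[of x borel P] flow_map_measurable2] by simp

text \<open>The randomness enters through the glued path alone, the starting point through
  \<open>flow_map\<close>; measurability in \<open>z\<close> is assembled from these two
  factors.\<close>

definition kernel :: "real \<Rightarrow> (real ^ 'n) \<times> (real \<Rightarrow> real ^ 'n) \<Rightarrow> ((real ^ 'n) \<times> (real \<Rightarrow> real ^ 'n)) measure" where
  "kernel t z = distr (glue_kernel t (snd z)) M (flow_map t (fst z))"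

lemma kernel_measurable: "t \<ge> 0 \<Longrightarrow> kernel t \<in> M \<rightarrow>\<^sub>M prob_algebra M"
  unfolding kernel_def
proof (rule measurable_distr_prob_space2[where M = P])
  assume t: "t \<ge> 0"
  show "(\<lambda>z. glue_kernel t (snd z)) \<in> M \<rightarrow>\<^sub>M prob_algebra P"
    by (rule measurable_compose[OF measurable_snd glue_kernel_measurable[OF t]])
  have "(\<lambda>(z, \<omega>). (fst z, \<omega>)) \<in> M \<Otimes>\<^sub>M P \<rightarrow>\<^sub>M M" by measurable
  from measurable_compose[OF this flow_map_measurable2[OF t]]
  show "(\<lambda>(z, \<omega>). flow_map t (fst z) \<omega>) \<in> M \<Otimes>\<^sub>M P \<rightarrow>\<^sub>M M"
    by (simp add: split_beta)
qed

lemma kernel_eq_distr: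
  assumes "t \<ge> 0" "\<omega> \<in> paths"
  shows "kernel t (x, \<omega>) = distr P M (\<lambda>\<eta>. flow_map t x (glue t \<omega> \<eta>))"
  unfolding kernel_def glue_kernel_def
  by (simp add: distr_distr flow_map_measurable glue_measurable assms o_def)

lemma transition_prob_eq:
  assumes t: "t \<ge> 0" and z: "z \<in> space M" and \<Gamma>: "\<Gamma> \<in> sets M"
  shows "transition_prob P \<Phi> t z \<Gamma> = emeasure (kernel t z) \<Gamma>"
proof -
  obtain x \<omega> where xw: "z = (x, \<omega>)" "\<omega> \<in> paths" using z by (auto simp: space_M)
  have m: "(\<lambda>\<eta>. flow_map t x (glue t \<omega> \<eta>)) \<in> P \<rightarrow>\<^sub>M M"
    by (rule measurable_compose[OF glue_measurable[OF xw(2) t] flow_map_measurable[OF t]])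
  have "emeasure (kernel t z) \<Gamma> = (\<integral>\<^sup>+ y. indicator \<Gamma> y \<partial>distr P M (\<lambda>\<eta>. flow_map t x (glue t \<omega> \<eta>)))"
    using \<Gamma> by (simp add: xw(1) kernel_eq_distr[OF t xw(2)])
  also have "\<dots> = (\<integral>\<^sup>+ \<eta>. indicator \<Gamma> (flow_map t x (glue t \<omega> \<eta>)) \<partial>P)"
    using \<Gamma> by (intro nn_integral_distr m) auto
  finally show ?thesis by (simp add: transition_prob_def xw(1) flow_map_def)
qed

text \<open>Recasts invariance as a fixed point of \<open>bind\<close>, where the calculus of
  kernels is available.\<close>

lemma invariant_measure_iff_bind:
  assumes "prob_space \<mu>" "sets \<mu> = sets M"
  shows "invariant_measure P \<Phi> \<mu> \<longleftrightarrow> distr \<mu> P snd = P \<and> (\<forall>t\<ge>0. bind \<mu> (kernel t) = \<mu>)"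
proof -
  have \<mu>: "\<mu> \<in> space (prob_algebra M)" using assms by (simp add: space_prob_algebra)
  have sp: "space \<mu> = space M" by (rule sets_eq_imp_space_eq[OF assms(2)])
  have "(\<forall>\<Gamma>\<in>sets \<mu>. emeasure \<mu> \<Gamma> = (\<integral>\<^sup>+ z. transition_prob P \<Phi> t z \<Gamma> \<partial>\<mu>)) \<longleftrightarrow> bind \<mu> (kernel t) = \<mu>"
    if t: "t \<ge> 0" for t
  proof -
    have eq: "(\<integral>\<^sup>+ z. transition_prob P \<Phi> t z \<Gamma> \<partial>\<mu>) = emeasure (bind \<mu> (kernel t)) \<Gamma>"
      if "\<Gamma> \<in> sets \<mu>" for \<Gamma>
    proof -
      have "(\<integral>\<^sup>+ z. transition_prob P \<Phi> t z \<Gamma> \<partial>\<mu>) = (\<integral>\<^sup>+ z. emeasure (kernel t z) \<Gamma> \<partial>\<mu>)"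
        using that t assms(2) sp by (intro nn_integral_cong transition_prob_eq) auto
      then show ?thesis
        using emeasure_bind_prob_algebra[OF \<mu> kernel_measurable[OF t]] that assms(2) by simp
    qed
    have "sets (bind \<mu> (kernel t)) = sets \<mu>"
      using sets_bind'[OF \<mu> kernel_measurable[OF t]] assms(2) by simp
    then show ?thesis
      using eq by (auto intro!: measure_eqI)
  qed
  then show ?thesis
    using assms unfolding invariant_measure_def by auto
qed

text \<open>The second marginal of \<open>kernel t z\<close> is
  \<open>glue_kernel t (snd z)\<close>, so projecting the invariance of \<mu> to paths gives
  stationarity of \<open>P\<close> under gluing. Stationarity of the increments thus enters without
  any computation with Gaussian laws.\<close>

lemma glue_preserves_P:
  assumes "invariant_measure P \<Phi> \<mu>" and t: "t \<ge> 0"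
  shows "bind P (glue_kernel t) = P"
proof (rule measure_eqI)
  show "sets (bind P (glue_kernel t)) = sets P"
    by (rule sets_bind'[OF P_in_prob_algebra glue_kernel_measurable[OF t]])
  fix E assume "E \<in> sets (bind P (glue_kernel t))"
  then have E: "E \<in> sets P" by (simp add: sets_bind'[OF P_in_prob_algebra glue_kernel_measurable[OF t]])
  have \<mu>: "prob_space \<mu>" "sets \<mu> = sets M" "distr \<mu> P snd = P" "bind \<mu> (kernel t) = \<mu>"
    using assms invariant_measure_iff_bind[of \<mu>] by (auto simp: invariant_measure_def)
  have \<mu>p: "\<mu> \<in> space (prob_algebra M)" using \<mu> by (simp add: space_prob_algebra)
  have sp: "space \<mu> = UNIV \<times> paths" using sets_eq_imp_space_eq[OF \<mu>(2)] by (simp add: space_M)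
  have snd: "snd \<in> \<mu> \<rightarrow>\<^sub>M P" using \<mu>(2) by (simp add: measurable_cong_sets[OF \<mu>(2) refl])
  have UE: "UNIV \<times> E \<in> sets M" using E by auto
  have "emeasure P E = emeasure (distr \<mu> P snd) E" by (simp add: \<mu>(3))
  also have "\<dots> = emeasure \<mu> (UNIV \<times> E)"
  proof -
    have sub: "E \<subseteq> paths" using sets.sets_into_space[OF E] by (simp add: space_P)
    have "snd -` E \<inter> space \<mu> = UNIV \<times> E"
    proof (rule set_eqI)
      fix z show "z \<in> snd -` E \<inter> space \<mu> \<longleftrightarrow> z \<in> UNIV \<times> E"
        using subsetD[OF sub, of "snd z"] by (simp add: sp mem_Times_iff) metis
    qed
    then show ?thesis by (simp add: emeasure_distr[OF snd E])
  qed
  also have "\<dots> = (\<integral>\<^sup>+ z. emeasure (kernel t z) (UNIV \<times> E) \<partial>\<mu>)"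
    by (rule emeasure_bind_prob_algebra[OF \<mu>p kernel_measurable[OF t] UE, unfolded \<mu>(4)])
  also have "\<dots> = (\<integral>\<^sup>+ z. emeasure (glue_kernel t (snd z)) E \<partial>\<mu>)"
  proof (rule nn_integral_cong)
    fix z
    have "flow_map t (fst z) \<in> glue_kernel t (snd z) \<rightarrow>\<^sub>M M"
      using flow_map_measurable[OF t] by (simp add: glue_kernel_def)
    moreover have "flow_map t (fst z) -` (UNIV \<times> E) \<inter> space (glue_kernel t (snd z)) = E"
      using sets.sets_into_space[OF E] unfolding flow_map_def glue_kernel_def space_distr by blast
    ultimately show "emeasure (kernel t z) (UNIV \<times> E) = emeasure (glue_kernel t (snd z)) E"
      unfolding kernel_def using UE by (simp add: emeasure_distr)
  qed
  also have "\<dots> = (\<integral>\<^sup>+ \<omega>. emeasure (glue_kernel t \<omega>) E \<partial>distr \<mu> P snd)"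
    using measurable_emeasure_kernel[OF measurable_prob_algebraD[OF glue_kernel_measurable[OF t]] E]
    by (simp add: nn_integral_distr[OF snd])
  also have "\<dots> = emeasure (bind P (glue_kernel t)) E"
    using emeasure_bind_prob_algebra[OF P_in_prob_algebra glue_kernel_measurable[OF t] E] by (simp add: \<mu>(3))
  finally show "emeasure (bind P (glue_kernel t)) E = emeasure P E" by simp
qed


section \<open>Invariance of the mean functional\<close>

lemma kernel_prob: "t \<ge> 0 \<Longrightarrow> z \<in> space M \<Longrightarrow> prob_space (kernel t z)"
  "t \<ge> 0 \<Longrightarrow> z \<in> space M \<Longrightarrow> sets (kernel t z) = sets M"
  using measurable_space[OF kernel_measurable] by (auto simp: space_prob_algebra)

definition time_mean :: "(real \<Rightarrow> real) \<Rightarrow> real" where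
  "time_mean = (SOME m. invariant_mean m)"

lemma invariant_mean: "invariant_mean time_mean"
  unfolding time_mean_def by (rule someI_ex[OF invariant_mean_exists])

definition time_marginal :: "((real ^ 'n) \<times> (real \<Rightarrow> real ^ 'n) \<Rightarrow> real) \<Rightarrow> real \<Rightarrow> real" where
  "time_marginal h s = (LINT \<omega>|P. h (flow_map s 0 \<omega>))"

definition mean_functional :: "((real ^ 'n) \<times> (real \<Rightarrow> real ^ 'n) \<Rightarrow> real) \<Rightarrow> real" where
  "mean_functional h = time_mean (time_marginal h)"

abbreviation "bdm \<equiv> bounded_measurable M"

lemma bounded_measurable_flow:
  assumes "bdm h" "t \<ge> 0" shows "bounded_measurable P (\<lambda>\<omega>. h (flow_map t x \<omega>))"
proof -
  obtain B where h: "h \<in> borel_measurable M" "\<And>z. z \<in> space M \<Longrightarrow> \<bar>h z\<bar> \<le> B"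
    using bounded_measurableE[OF assms(1)] by blast
  note [measurable] = h(1) flow_map_measurable[OF assms(2)]
  show ?thesis
    using measurable_space[OF flow_map_measurable[OF assms(2), of x]]
    by (intro bounded_measurableI[where B = B] h(2)) auto
qed

lemma integrable_flow: "bdm h \<Longrightarrow> t \<ge> 0 \<Longrightarrow> integrable P (\<lambda>\<omega>. h (flow_map t x \<omega>))"
  by (intro integrable_bounded_measurable bounded_measurable_flow)

lemma time_marginal_bounded:
  assumes "bdm h" shows "bounded (time_marginal h ` {0..})"
proof -
  obtain B where h: "h \<in> borel_measurable M" "\<And>z. z \<in> space M \<Longrightarrow> \<bar>h z\<bar> \<le> B"
    using bounded_measurableE[OF assms(1)] by blast
  have "\<bar>time_marginal h s - (LINT \<omega>|P. 0)\<bar> \<le> B" if s: "s \<ge> 0" for s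
    unfolding time_marginal_def using measurable_space[OF flow_map_measurable[OF s, of 0]]
    by (intro abs_integral_diff_le[OF integrable_flow[OF assms s]]) (auto intro: h(2))
  then have "norm y \<le> B" if "y \<in> time_marginal h ` {0..}" for y
    using that by auto
  then show ?thesis unfolding bounded_iff by blast
qed

definition transition :: "real \<Rightarrow> ((real ^ 'n) \<times> (real \<Rightarrow> real ^ 'n) \<Rightarrow> real) \<Rightarrow> (real ^ 'n) \<times> (real \<Rightarrow> real ^ 'n) \<Rightarrow> real" where
  "transition t h z = (LINT y|kernel t z. h y)"

lemma transition_eq:
  assumes h: "h \<in> borel_measurable M" and t: "t \<ge> 0" and \<omega>: "\<omega> \<in> paths"
  shows "transition t h (x, \<omega>) = (LINT \<eta>|P. h (flow_map t x (glue t \<omega> \<eta>)))"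
  unfolding transition_def kernel_eq_distr[OF t \<omega>]
  by (rule integral_distr[OF measurable_compose[OF glue_measurable[OF \<omega> t] flow_map_measurable[OF t]] h])

lemma transition_bounded_measurable:
  assumes "bdm h" "t \<ge> 0" shows "bdm (transition t h)"
proof -
  obtain B where h: "h \<in> borel_measurable M" "\<And>z. z \<in> space M \<Longrightarrow> \<bar>h z\<bar> \<le> B"
    using bounded_measurableE[OF assms(1)] by blast
  show ?thesis
  proof (rule bounded_measurableI[where B = B])
    show "transition t h \<in> borel_measurable M"
      unfolding transition_def
      by (rule measurable_compose[OF measurable_prob_algebraD[OF kernel_measurable[OF assms(2)]]
            integral_measurable_subprob_algebra[OF h(1)]])
    fix z assume z: "z \<in> space M"
    interpret K: prob_space "kernel t z" by (rule kernel_prob[OF assms(2) z])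
    note se = kernel_prob(2)[OF assms(2) z]
    have hm: "h \<in> borel_measurable (kernel t z)"
      using h(1) by (simp add: measurable_cong_sets[OF se refl])
    have "bounded_measurable (kernel t z) h"
      by (rule bounded_measurableI[OF hm, where B = B]) (use h(2) sets_eq_imp_space_eq[OF se] in auto)
    then have "\<bar>integral\<^sup>L (kernel t z) h - integral\<^sup>L (kernel t z) (\<lambda>_. 0)\<bar> \<le> B"
      using h(2) sets_eq_imp_space_eq[OF se]
      by (intro K.abs_integral_diff_le K.integrable_bounded_measurable[of h]) auto
    then show "\<bar>transition t h z\<bar> \<le> B" by (simp add: transition_def)
  qed
qed

text \<open>Keeps \<open>transition t h\<close> in the class on which the mean and its representing
  measure agree, so that invariance can be transferred from one to the other.\<close>

lemma transition_lipschitz: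
  assumes h: "bdm h" and lip: "\<And>x y \<omega>. \<omega> \<in> paths \<Longrightarrow> \<bar>h (x, \<omega>) - h (y, \<omega>)\<bar> \<le> C * norm (x - y)"
    and t: "t \<ge> 0" and C: "C \<ge> 0"
  shows "\<exists>C'. \<forall>x y \<omega>. \<omega> \<in> paths \<longrightarrow> \<bar>transition t h (x, \<omega>) - transition t h (y, \<omega>)\<bar> \<le> C' * norm (x - y)"
proof -
  obtain K where K: "\<And>t \<omega> x y. t \<ge> 0 \<Longrightarrow> \<omega> \<in> paths \<Longrightarrow>
    norm (pullback \<Phi> t \<omega> x - pullback \<Phi> t \<omega> y) \<le> exp (K * t) * norm (x - y)"
    using pullback_lipschitz by metis
  have hm: "h \<in> borel_measurable M" using h by (simp add: bounded_measurable_def)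
  have "\<bar>transition t h (x, \<omega>) - transition t h (y, \<omega>)\<bar> \<le> C * exp (K * t) * norm (x - y)"
    if \<omega>: "\<omega> \<in> paths" for x y \<omega>
  proof -
    have int: "integrable P (\<lambda>\<eta>. h (flow_map t x (glue t \<omega> \<eta>)))" for x
    proof (rule integrable_bounded_measurable)
      obtain B where B: "\<And>z. z \<in> space M \<Longrightarrow> \<bar>h z\<bar> \<le> B"
        using bounded_measurableE[OF h] by blast
      have m: "(\<lambda>\<eta>. flow_map t x (glue t \<omega> \<eta>)) \<in> P \<rightarrow>\<^sub>M M"
        by (rule measurable_compose[OF glue_measurable[OF \<omega> t] flow_map_measurable[OF t]])
      show "bounded_measurable P (\<lambda>\<eta>. h (flow_map t x (glue t \<omega> \<eta>)))"
        using measurable_space[OF m] by (intro bounded_measurableI[where B = B] measurable_compose[OF m hm] B) auto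
    qed
    show ?thesis
      unfolding transition_eq[OF hm t \<omega>]
    proof (rule abs_integral_diff_le[OF int int])
    fix \<eta> assume "\<eta> \<in> space P"
    then have g: "glue t \<omega> \<eta> \<in> paths" using \<omega> t by (simp add: space_P glue_path)
    have "\<bar>h (flow_map t x (glue t \<omega> \<eta>)) - h (flow_map t y (glue t \<omega> \<eta>))\<bar>
        \<le> C * norm (pullback \<Phi> t (glue t \<omega> \<eta>) x - pullback \<Phi> t (glue t \<omega> \<eta>) y)"
      unfolding flow_map_def by (rule lip[OF g])
    also have "\<dots> \<le> C * (exp (K * t) * norm (x - y))"
      by (intro mult_left_mono K t g C)
    finally show "\<bar>h (flow_map t x (glue t \<omega> \<eta>)) - h (flow_map t y (glue t \<omega> \<eta>))\<bar> \<le> C * exp (K * t) * norm (x - y)"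
      by (simp add: mult.assoc)
    qed
  qed
  then show ?thesis by blast
qed

end

locale sde_invariant = sde H D P F \<sigma> \<Phi>
  for H and D :: "(real \<Rightarrow> real ^ 'n) \<Rightarrow> (real \<Rightarrow> real ^ 'n)" and P F \<sigma> \<Phi> +
  fixes \<mu> :: "((real ^ 'n) \<times> (real \<Rightarrow> real ^ 'n)) measure"
  assumes \<mu>: "invariant_measure P \<Phi> \<mu>"
begin

lemma \<mu>_props: "prob_space \<mu>" "sets \<mu> = sets M" "distr \<mu> P snd = P" "t \<ge> 0 \<Longrightarrow> bind \<mu> (kernel t) = \<mu>"
  using \<mu> invariant_measure_iff_bind[of \<mu>] by (auto simp: invariant_measure_def)

lemma bind_glue: "t \<ge> 0 \<Longrightarrow> bind P (glue_kernel t) = P"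
  by (rule glue_preserves_P[OF \<mu>])

text \<open>By the cocycle property, continuing for time \<open>t\<close> over a glued path gives
  the pullback of length \<open>s + t\<close> along that path, and the glued path has law
  \<open>P\<close> again by \<open>bind_glue\<close>.\<close>

lemma time_marginal_transition:
  assumes h: "bdm h" and st: "s \<ge> 0" "t \<ge> 0"
  shows "time_marginal (transition t h) s = time_marginal h (s + t)"
proof -
  have hm: "h \<in> borel_measurable M" using h by (simp add: bounded_measurable_def)
  have st0: "s + t \<ge> 0" using st by simp
  obtain B where B: "(\<lambda>\<omega>. h (flow_map (s + t) 0 \<omega>)) \<in> borel_measurable P"
      "\<And>\<omega>. \<omega> \<in> space P \<Longrightarrow> \<bar>h (flow_map (s + t) 0 \<omega>)\<bar> \<le> B"
    using bounded_measurableE[OF bounded_measurable_flow[OF h st0, of 0]] by blast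
  have "time_marginal (transition t h) s = (LINT \<omega>|P. LINT \<omega>'|glue_kernel t \<omega>. h (flow_map (s + t) 0 \<omega>'))"
    unfolding time_marginal_def
  proof (rule Bochner_Integration.integral_cong[OF refl])
    fix \<omega> assume "\<omega> \<in> space P"
    then have \<omega>: "\<omega> \<in> paths" by (simp add: space_P)
    have "transition t h (flow_map s 0 \<omega>) = (LINT \<eta>|P. h (flow_map t (pullback \<Phi> s \<omega> 0) (glue t \<omega> \<eta>)))"
      unfolding flow_map_def[of s] by (rule transition_eq[OF hm st(2) \<omega>])
    also have "\<dots> = (LINT \<eta>|P. h (flow_map (s + t) 0 (glue t \<omega> \<eta>)))"
    proof (rule Bochner_Integration.integral_cong[OF refl])
      fix \<eta> assume "\<eta> \<in> space P"
      then have \<eta>: "\<eta> \<in> paths" by (simp add: space_P)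
      have g: "glue t \<omega> \<eta> \<in> paths" using \<omega> \<eta> st by (simp add: glue_path)
      show "h (flow_map t (pullback \<Phi> s \<omega> 0) (glue t \<omega> \<eta>)) = h (flow_map (s + t) 0 (glue t \<omega> \<eta>))"
        using pullback_cocycle[OF g st, of 0] past_shift_glue[OF \<omega> \<eta> st(2)] by (simp add: flow_map_def)
    qed
    also have "\<dots> = (LINT \<omega>'|glue_kernel t \<omega>. h (flow_map (s + t) 0 \<omega>'))"
      unfolding glue_kernel_def
      by (rule integral_distr[symmetric, OF glue_measurable[OF \<omega> st(2)]]) (rule B(1))
    finally show "transition t h (flow_map s 0 \<omega>) = (LINT \<omega>'|glue_kernel t \<omega>. h (flow_map (s + t) 0 \<omega>'))" .
  qed
  also have "\<dots> = (LINT \<omega>'|bind P (glue_kernel t). h (flow_map (s + t) 0 \<omega>'))"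
  proof (rule integral_bind[symmetric, OF B measurable_prob_algebraD[OF glue_kernel_measurable[OF st(2)]] finite_measure_axioms, where B' = 1])
    show "AE \<omega> in P. emeasure (glue_kernel t \<omega>) (space (glue_kernel t \<omega>)) \<le> ennreal 1"
    proof (rule AE_I2)
      fix \<omega> assume "\<omega> \<in> space P"
      then have "prob_space (glue_kernel t \<omega>)"
        using measurable_space[OF glue_kernel_measurable[OF st(2)]] by (auto simp: space_prob_algebra)
      then show "emeasure (glue_kernel t \<omega>) (space (glue_kernel t \<omega>)) \<le> ennreal 1"
        by (simp add: prob_space.emeasure_space_1)
    qed
  qed
  also have "\<dots> = time_marginal h (s + t)"
    unfolding bind_glue[OF st(2)] time_marginal_def ..
  finally show ?thesis .
qed

lemma mean_functional_transition:
  assumes h: "bdm h" and t: "t \<ge> 0"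
  shows "mean_functional (transition t h) = mean_functional h"
proof -
  have "mean_functional (transition t h) = time_mean (\<lambda>s. time_marginal h (s + t))"
    unfolding mean_functional_def
    by (rule mean_cong[OF invariant_mean time_marginal_bounded[OF transition_bounded_measurable[OF h t]]])
      (rule time_marginal_transition[OF h _ t])
  also have "\<dots> = mean_functional h"
    unfolding mean_functional_def by (rule mean_shift[OF invariant_mean t time_marginal_bounded[OF h]])
  finally show ?thesis .
qed

end

section \<open>The attractor carries the invariant measure\<close>

text \<open>The distance to a set is 1-Lipschitz in the point, so its strict sublevel sets are
  countable unions over a dense set of centres \<open>q\<close>.\<close>

lemma infdist_jointly_measurable:
  fixes A :: "'w \<Rightarrow> ('a::euclidean_space) set"
  assumes m: "\<And>x. (\<lambda>\<omega>. infdist x (A \<omega>)) \<in> borel_measurable P"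
  shows "(\<lambda>z. infdist (fst z) (A (snd z))) \<in> borel_measurable (borel \<Otimes>\<^sub>M P)"
proof -
  obtain Q :: "'a set" where Q: "countable Q" "\<And>X. open X \<Longrightarrow> X \<noteq> {} \<Longrightarrow> \<exists>d\<in>Q. d \<in> X"
    using countable_dense_setE by metis
  have "{z \<in> space (borel \<Otimes>\<^sub>M P). infdist (fst z) (A (snd z)) < a} \<in> sets (borel \<Otimes>\<^sub>M P)" for a
  proof -
    have "{z \<in> space (borel \<Otimes>\<^sub>M P). infdist (fst z) (A (snd z)) < a}
        = (\<Union>q\<in>Q. {z \<in> space (borel \<Otimes>\<^sub>M P). dist (fst z) q + infdist q (A (snd z)) < a})"
    proof (intro set_eqI iffI)
      fix z assume z: "z \<in> {z \<in> space (borel \<Otimes>\<^sub>M P). infdist (fst z) (A (snd z)) < a}"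
      \<comment> \<open>Half the slack, because the distance to \<open>q\<close> is spent
        twice.\<close>
      let ?d = "(a - infdist (fst z) (A (snd z))) / 2"
      have "?d > 0" using z by simp
      then obtain q where q: "q \<in> Q" "dist (fst z) q < ?d"
        using Q(2)[of "ball (fst z) ?d"] by auto
      have "infdist q (A (snd z)) \<le> infdist (fst z) (A (snd z)) + dist q (fst z)"
        by (rule infdist_triangle)
      with q have "dist (fst z) q + infdist q (A (snd z)) < a"
        by (simp add: dist_commute)
      with q z show "z \<in> (\<Union>q\<in>Q. {z \<in> space (borel \<Otimes>\<^sub>M P). dist (fst z) q + infdist q (A (snd z)) < a})"
        by blast
    next
      fix z assume "z \<in> (\<Union>q\<in>Q. {z \<in> space (borel \<Otimes>\<^sub>M P). dist (fst z) q + infdist q (A (snd z)) < a})"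
      then obtain q where q: "z \<in> space (borel \<Otimes>\<^sub>M P)" "dist (fst z) q + infdist q (A (snd z)) < a" by blast
      have "infdist (fst z) (A (snd z)) \<le> infdist q (A (snd z)) + dist (fst z) q"
        by (rule infdist_triangle)
      with q show "z \<in> {z \<in> space (borel \<Otimes>\<^sub>M P). infdist (fst z) (A (snd z)) < a}" by simp
    qed
    also have "\<dots> \<in> sets (borel \<Otimes>\<^sub>M P)"
    proof (intro sets.countable_UN'' Q)
      fix q
      note [measurable] = m[of q]
      show "{z \<in> space (borel \<Otimes>\<^sub>M P). dist (fst z) q + infdist q (A (snd z)) < a} \<in> sets (borel \<Otimes>\<^sub>M P)"
        by measurable
    qed
    finally show ?thesis .
  qed
  then show ?thesis unfolding borel_measurable_iff_less by blast
qed

context sde_invariant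
begin

text \<open>If the pullback from 0 is far out, so is the pullback from any starting point of
  moderate size. Drawing that starting point from \<mu> turns the latter into an event of small
  stationary probability.\<close>

lemma pullback_tight:
  assumes e: "e > 0"
  shows "\<exists>R. \<forall>s\<ge>0. 1 - e \<le> measure P {\<omega> \<in> space P. norm (pullback \<Phi> s \<omega> 0) \<le> R}"
proof -
  obtain c where c: "c \<ge> 0" "\<And>t \<omega> x y. t \<ge> 0 \<Longrightarrow> \<omega> \<in> paths \<Longrightarrow>
    norm (pullback \<Phi> t \<omega> x - pullback \<Phi> t \<omega> y) \<le> norm (x - y) + c"
    using pullback_bounded_distance by metis
  interpret \<mu>: prob_space \<mu> by (rule \<mu>_props(1))
  have sp: "space \<mu> = space M" by (rule sets_eq_imp_space_eq[OF \<mu>_props(2)])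
  define G where "G r = {z \<in> space M. norm (fst z) > r}" for r
  have G[measurable]: "G r \<in> sets M" for r unfolding G_def by measurable
  have "(\<lambda>n. measure \<mu> (G (real n))) \<longlonglongrightarrow> measure \<mu> (\<Inter>n. G (real n))"
    by (rule \<mu>.finite_Lim_measure_decseq) (auto simp: \<mu>_props(2) decseq_def, auto simp: G_def)
  moreover have "(\<Inter>n. G (real n)) = {}"
  proof -
    have "z \<notin> (\<Inter>n. G (real n))" for z
      using real_arch_simple[of "norm (fst z)"] by (auto simp: G_def not_less)
    then show ?thesis by blast
  qed
  ultimately have "\<forall>\<^sub>F n in sequentially. measure \<mu> (G (real n)) < e / 2"
    using e by (intro order_tendstoD(2)[where y = 0]) auto
  then obtain n where n: "measure \<mu> (G (real n)) < e / 2"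
    unfolding eventually_sequentially by blast
  \<comment> \<open>\<open>n + c\<close> bounds the distance between the two pullbacks; another
    \<open>n\<close> ensures that the stationary one still leaves the ball of radius
    \<open>n\<close>.\<close>
  define R where "R = 2 * real n + c"
  have "1 - e \<le> measure P {\<omega> \<in> space P. norm (pullback \<Phi> s \<omega> 0) \<le> R}" if s: "s \<ge> 0" for s
  proof -
    note [measurable] = pullback_measurable'[OF s]
    define A where "A = {\<omega> \<in> space P. norm (pullback \<Phi> s \<omega> 0) > R}"
    have A[measurable]: "A \<in> sets P" unfolding A_def by measurable
    have "emeasure P A = (\<integral>\<^sup>+ \<omega>. emeasure (glue_kernel s \<omega>) A \<partial>P)"
      using emeasure_bind_prob_algebra[OF P_in_prob_algebra glue_kernel_measurable[OF s] A]
      by (simp only: bind_glue[OF s])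
    also have "\<dots> = (\<integral>\<^sup>+ \<omega>. emeasure (glue_kernel s \<omega>) A \<partial>distr \<mu> P snd)"
      by (simp only: \<mu>_props(3))
    also have "\<dots> = (\<integral>\<^sup>+ z. emeasure (glue_kernel s (snd z)) A \<partial>\<mu>)"
    proof (rule nn_integral_distr)
      show "snd \<in> \<mu> \<rightarrow>\<^sub>M P" by (simp add: measurable_cong_sets[OF \<mu>_props(2) refl])
      show "(\<lambda>\<omega>. emeasure (glue_kernel s \<omega>) A) \<in> borel_measurable (distr \<mu> P snd)"
        using measurable_emeasure_kernel[OF measurable_prob_algebraD[OF glue_kernel_measurable[OF s]] A] by simp
    qed
    \<comment> \<open>Either the stationary start is already large or its image is; by invariance
      both events have the same probability, which is below \<open>e / 2\<close>.\<close>
    also have "\<dots> \<le> (\<integral>\<^sup>+ z. indicator (G (real n)) z + emeasure (kernel s z) (G (real n)) \<partial>\<mu>)"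
    proof (rule nn_integral_mono)
      fix z assume "z \<in> space \<mu>"
      then have z: "z \<in> space M" and zp: "snd z \<in> space P" by (auto simp: sp space_pair_measure)
      have gk: "prob_space (glue_kernel s (snd z))" "sets (glue_kernel s (snd z)) = sets P"
        using measurable_space[OF glue_kernel_measurable[OF s] zp] by (auto simp: space_prob_algebra)
      interpret K: prob_space "glue_kernel s (snd z)" by (rule gk(1))
      show "emeasure (glue_kernel s (snd z)) A \<le> indicator (G (real n)) z + emeasure (kernel s z) (G (real n))"
      proof (cases "z \<in> G (real n)")
        case True
        then show ?thesis using K.emeasure_le_1[of A] by (simp add: add_increasing2)
      next
        case False
        then have x: "norm (fst z) \<le> real n" using z by (simp add: G_def)
        have fm: "flow_map s (fst z) \<in> glue_kernel s (snd z) \<rightarrow>\<^sub>M M"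
          using flow_map_measurable[OF s] by (simp add: measurable_cong_sets[OF gk(2) refl])
        have "A \<subseteq> flow_map s (fst z) -` G (real n) \<inter> space (glue_kernel s (snd z))"
        proof
          fix \<omega> assume "\<omega> \<in> A"
          then have \<omega>: "\<omega> \<in> paths" "norm (pullback \<Phi> s \<omega> 0) > R" by (auto simp: A_def space_P)
          have "norm (pullback \<Phi> s \<omega> 0 - pullback \<Phi> s \<omega> (fst z)) \<le> norm (0 - fst z) + c"
            by (rule c(2)[OF s \<omega>(1)])
          moreover have "norm (pullback \<Phi> s \<omega> 0)
              \<le> norm (pullback \<Phi> s \<omega> 0 - pullback \<Phi> s \<omega> (fst z)) + norm (pullback \<Phi> s \<omega> (fst z))"
            using norm_triangle_sub by (simp add: add.commute)
          ultimately have "norm (pullback \<Phi> s \<omega> (fst z)) > real n"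
            using \<omega>(2) x by (simp add: R_def)
          then show "\<omega> \<in> flow_map s (fst z) -` G (real n) \<inter> space (glue_kernel s (snd z))"
            using \<omega>(1) sets_eq_imp_space_eq[OF gk(2)] by (simp add: G_def flow_map_def space_M space_P)
        qed
        then have "emeasure (glue_kernel s (snd z)) A
            \<le> emeasure (glue_kernel s (snd z)) (flow_map s (fst z) -` G (real n) \<inter> space (glue_kernel s (snd z)))"
          by (intro emeasure_mono measurable_sets[OF fm G])
        also have "\<dots> = emeasure (kernel s z) (G (real n))"
          unfolding kernel_def by (rule emeasure_distr[OF fm G, symmetric])
        finally show ?thesis by (simp add: add_increasing)
      qed
    qed
    also have "\<dots> = emeasure \<mu> (G (real n)) + (\<integral>\<^sup>+ z. emeasure (kernel s z) (G (real n)) \<partial>\<mu>)"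
    proof (subst nn_integral_add)
      show "(\<lambda>z. indicator (G (real n)) z :: ennreal) \<in> borel_measurable \<mu>"
        by (intro borel_measurable_indicator) (simp add: \<mu>_props(2))
      show "(\<lambda>z. emeasure (kernel s z) (G (real n))) \<in> borel_measurable \<mu>"
        using measurable_emeasure_kernel[OF measurable_prob_algebraD[OF kernel_measurable[OF s]] G]
        by (simp add: measurable_cong_sets[OF \<mu>_props(2) refl])
    qed (simp add: \<mu>_props(2))
    also have "(\<integral>\<^sup>+ z. emeasure (kernel s z) (G (real n)) \<partial>\<mu>) = emeasure \<mu> (G (real n))"
    proof -
      have "\<mu> \<in> space (prob_algebra M)" using \<mu>_props by (simp add: space_prob_algebra)
      from emeasure_bind_prob_algebra[OF this kernel_measurable[OF s] G]
      show ?thesis by (simp only: \<mu>_props(4)[OF s])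
    qed
    finally have "measure P A \<le> measure \<mu> (G (real n)) + measure \<mu> (G (real n))"
      by (simp add: emeasure_eq_measure \<mu>.emeasure_eq_measure ennreal_plus[symmetric] del: ennreal_plus)
    then have "measure P A \<le> e" using n by simp
    moreover have "{\<omega> \<in> space P. norm (pullback \<Phi> s \<omega> 0) \<le> R} = space P - A"
      by (auto simp: A_def)
    ultimately show ?thesis by (simp add: prob_compl)
  qed
  then show ?thesis by blast
qed

text \<open>The second component of \<open>flow_map\<close> is the path itself, so the path marginal
  is \<open>P\<close> at every time and hence for the mean. Tightness is uniform in time and
  survives averaging.\<close>

lemma finitely_additive_mean: "finitely_additive_mean P mean_functional"
proof
  note bounded = time_marginal_bounded
  have sp: "s \<ge> 0 \<Longrightarrow> \<omega> \<in> space P \<Longrightarrow> flow_map s x \<omega> \<in> space M" for s x \<omega>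
    using measurable_space[OF flow_map_measurable] by blast
  fix f g :: "(real ^ 'n) \<times> (real \<Rightarrow> real ^ 'n) \<Rightarrow> real"
  assume f: "bdm f"
  show "mean_functional (\<lambda>z. c * f z) = c * mean_functional f" for c
    unfolding mean_functional_def mean_mult[OF invariant_mean bounded[OF f], symmetric]
    by (rule mean_cong[OF invariant_mean bounded[OF bounded_measurable_mult[OF f]]])
      (simp add: time_marginal_def)
  assume g: "bdm g"
  show "mean_functional (\<lambda>z. f z + g z) = mean_functional f + mean_functional g"
    unfolding mean_functional_def mean_add[OF invariant_mean bounded[OF f] bounded[OF g], symmetric]
    by (rule mean_cong[OF invariant_mean bounded[OF bounded_measurable_add[OF f g]]])
      (simp add: time_marginal_def integrable_flow f g)
  assume le: "\<And>z. z \<in> space M \<Longrightarrow> f z \<le> g z"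
  show "mean_functional f \<le> mean_functional g"
    unfolding mean_functional_def
  proof (rule mean_mono[OF invariant_mean bounded[OF f] bounded[OF g]])
    fix s :: real assume s: "s \<ge> 0"
    show "time_marginal f s \<le> time_marginal g s"
      unfolding time_marginal_def by (intro integral_mono integrable_flow f g s le sp)
  qed
next
  fix E assume E: "E \<in> sets P"
  have b: "bdm (indicator (UNIV \<times> E))"
    by (intro bounded_measurable_indicator pair_measureI E) simp
  have "mean_functional (indicator (UNIV \<times> E)) = time_mean (\<lambda>_. measure P E)"
    unfolding mean_functional_def
  proof (rule mean_cong[OF invariant_mean time_marginal_bounded[OF b]])
    fix s :: real
    have "time_marginal (indicator (UNIV \<times> E)) s = (LINT \<omega>|P. indicator E \<omega>)"
      by (simp add: time_marginal_def flow_map_def indicator_times)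
    then show "time_marginal (indicator (UNIV \<times> E)) s = measure P E"
      using sets.sets_into_space[OF E] by (simp add: Int_absorb2 Int_absorb1)
  qed
  then show "mean_functional (indicator (UNIV \<times> E)) = measure P E"
    by (simp add: mean_const[OF invariant_mean])
next
  fix e :: real assume "e > 0"
  then obtain R where R: "\<And>s. s \<ge> 0 \<Longrightarrow> 1 - e \<le> measure P {\<omega> \<in> space P. norm (pullback \<Phi> s \<omega> 0) \<le> R}"
    using pullback_tight by blast
  have b: "bdm (indicator (cball 0 R \<times> space P))"
    by (intro bounded_measurable_indicator pair_measureI) auto
  have "1 - e = time_mean (\<lambda>_. 1 - e)" by (simp add: mean_const[OF invariant_mean])
  also have "\<dots> \<le> mean_functional (indicator (cball 0 R \<times> space P))"
    unfolding mean_functional_def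
  proof (rule mean_mono[OF invariant_mean _ time_marginal_bounded[OF b]])
    fix s :: real assume s: "s \<ge> 0"
    let ?A = "{\<omega> \<in> space P. norm (pullback \<Phi> s \<omega> 0) \<le> R}"
    have "time_marginal (indicator (cball 0 R \<times> space P)) s = (LINT \<omega>|P. indicator ?A \<omega>)"
      unfolding time_marginal_def
      by (rule Bochner_Integration.integral_cong[OF refl]) (simp add: flow_map_def indicator_def)
    also have "\<dots> = measure P ?A"
      by (simp add: Int_def conj_commute cong: conj_cong)
    finally show "1 - e \<le> time_marginal (indicator (cball 0 R \<times> space P)) s"
      using R[OF s] by simp
  qed (simp add: image_constant_conv)
  finally show "\<exists>R. 1 - e \<le> mean_functional (indicator (cball 0 R \<times> space P))" by blast
qed


text \<open>Invariance of \<nu> is tested on products of Lipschitz functions and indicators: such a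
  product and its image under \<open>transition t\<close> are both admissible for
  \<open>rep\<close>, and the mean does not distinguish them.\<close>

lemma integral_eq_mean_functional:
  assumes unique: "\<And>\<nu>. invariant_measure P \<Phi> \<nu> \<Longrightarrow> \<nu> = \<mu>"
    and h: "bdm h" and lip: "\<And>x y \<omega>. \<omega> \<in> paths \<Longrightarrow> \<bar>h (x, \<omega>) - h (y, \<omega>)\<bar> \<le> C * norm (x - y)"
  shows "integral\<^sup>L \<mu> h = mean_functional h"
proof -
  interpret fam: finitely_additive_mean P mean_functional by (rule finitely_additive_mean)
  obtain \<nu> where \<nu>: "prob_space \<nu>" "sets \<nu> = sets M"
    and rep: "\<And>h C. bdm h \<Longrightarrow> (\<And>x y \<omega>. \<omega> \<in> space P \<Longrightarrow> \<bar>h (x, \<omega>) - h (y, \<omega>)\<bar> \<le> C * norm (x - y)) \<Longrightarrow>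
       integral\<^sup>L \<nu> h = mean_functional h"
    using fam.representing_measure_exists by blast
  interpret \<nu>: prob_space \<nu> by (rule \<nu>(1))
  have \<nu>p: "\<nu> \<in> space (prob_algebra M)" using \<nu> by (simp add: space_prob_algebra)
  have sp: "space \<nu> = space M" by (rule sets_eq_imp_space_eq[OF \<nu>(2)])
  have "distr \<nu> P snd = P"
  proof (rule measure_eqI)
    fix E assume "E \<in> sets (distr \<nu> P snd)"
    then have E: "E \<in> sets P" by simp
    then have UE: "UNIV \<times> E \<in> sets M" by (intro pair_measureI) auto
    have snd: "snd \<in> \<nu> \<rightarrow>\<^sub>M P" by (simp add: measurable_cong_sets[OF \<nu>(2) refl])
    have "snd -` E \<inter> space \<nu> = UNIV \<times> E"
    proof (rule set_eqI)
      fix z show "z \<in> snd -` E \<inter> space \<nu> \<longleftrightarrow> z \<in> UNIV \<times> E"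
        using subsetD[OF sets.sets_into_space[OF E], of "snd z"]
        by (simp add: sp space_M space_P mem_Times_iff) metis
    qed
    then have "emeasure (distr \<nu> P snd) E = ennreal (integral\<^sup>L \<nu> (indicator (UNIV \<times> E)))"
      using UE sets.sets_into_space[OF UE] sp
      by (simp add: emeasure_distr[OF snd E] \<nu>.emeasure_eq_measure Int_absorb2)
    also have "integral\<^sup>L \<nu> (indicator (UNIV \<times> E)) = mean_functional (indicator (UNIV \<times> E))"
      by (rule rep[of _ 0]) (simp_all add: bounded_measurable_indicator UE indicator_times)
    also have "\<dots> = measure P E" by (rule fam.L_marginal[OF E])
    finally show "emeasure (distr \<nu> P snd) E = emeasure P E" by (simp add: emeasure_eq_measure)
  qed simp
  moreover have "bind \<nu> (kernel t) = \<nu>" if t: "t \<ge> 0" for t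
  proof (rule lipschitz_test_functions_determine)
    show "prob_space (bind \<nu> (kernel t))" by (rule prob_space_bind'[OF \<nu>p kernel_measurable[OF t]])
    show "sets (bind \<nu> (kernel t)) = sets M" by (rule sets_bind'[OF \<nu>p kernel_measurable[OF t]])
    fix g :: "real ^ 'n \<Rightarrow> real" and E and C
    assume E: "E \<in> sets P" and g: "\<And>x. 0 \<le> g x \<and> g x \<le> 1" and lip: "\<And>x y. \<bar>g x - g y\<bar> \<le> C * norm (x - y)"
    define h where "h z = g (fst z) * indicator E (snd z)" for z
    have C: "C \<ge> 0"
      using order_trans[OF abs_ge_zero lip[of "axis undefined 1" 0]] by (simp add: norm_axis_1)
    have gm[measurable]: "g \<in> borel_measurable borel"
      by (intro borel_measurable_continuous_onI lipschitz_on_continuous_on[of C])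
        (use lip C in \<open>auto simp: lipschitz_on_def dist_norm\<close>)
    have hm[measurable]: "h \<in> borel_measurable M"
      unfolding h_def using E by measurable
    have h1: "\<bar>h z\<bar> \<le> 1" for z using g by (auto simp: h_def indicator_def)
    have h: "bdm h" by (rule bounded_measurableI[OF hm h1])
    have hl: "\<bar>h (x, \<omega>) - h (y, \<omega>)\<bar> \<le> C * norm (x - y)" for x y \<omega>
      using lip[of x y] C by (auto simp: h_def indicator_def)
    obtain C' where C': "\<And>x y \<omega>. \<omega> \<in> paths \<Longrightarrow> \<bar>transition t h (x, \<omega>) - transition t h (y, \<omega>)\<bar> \<le> C' * norm (x - y)"
      using transition_lipschitz[OF h hl t C] by blast
    have "integral\<^sup>L (bind \<nu> (kernel t)) h = (LINT z|\<nu>. transition t h z)"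
      unfolding transition_def
    proof (rule integral_bind[where B = 1 and B' = 1 and K = M])
      show "kernel t \<in> \<nu> \<rightarrow>\<^sub>M subprob_algebra M"
        using measurable_prob_algebraD[OF kernel_measurable[OF t]] by (simp add: measurable_cong_sets[OF \<nu>(2) refl])
      show "finite_measure \<nu>" by (rule \<nu>.finite_measure_axioms)
      show "AE z in \<nu>. emeasure (kernel t z) (space (kernel t z)) \<le> ennreal 1"
        using kernel_prob(1)[OF t] sp by (auto intro!: AE_I2 simp: prob_space.emeasure_space_1)
    qed (use h1 hm in auto)
    also have "\<dots> = mean_functional (transition t h)"
      by (rule rep[OF transition_bounded_measurable[OF h t]]) (rule C', simp add: space_P)
    also have "\<dots> = mean_functional h" by (rule mean_functional_transition[OF h t])
    also have "\<dots> = integral\<^sup>L \<nu> h" by (rule rep[OF h hl, symmetric])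
    finally show "(LINT z|bind \<nu> (kernel t). g (fst z) * indicator E (snd z))
        = (LINT z|\<nu>. g (fst z) * indicator E (snd z))"
      unfolding h_def .
  qed (use \<nu> in auto)
  ultimately have "invariant_measure P \<Phi> \<nu>"
    by (simp add: invariant_measure_iff_bind[OF \<nu>])
  then have "\<nu> = \<mu>" by (rule unique)
  then show ?thesis
    using rep[OF h lip] by (simp add: space_P)
qed

lemma attractor_infdist_AE:
  assumes unique: "\<And>\<nu>. invariant_measure P \<Phi> \<nu> \<Longrightarrow> \<nu> = \<mu>"
    and meas: "\<And>x. (\<lambda>\<omega>. infdist x (A \<omega>)) \<in> borel_measurable P"
    and attr: "\<And>\<epsilon>. \<epsilon> > 0 \<Longrightarrow>
      ((\<lambda>t. measure P {\<omega>\<in>space P. infdist (pullback \<Phi> t \<omega> 0) (A \<omega>) > \<epsilon>}) \<longlongrightarrow> 0) at_top"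
  shows "AE z in \<mu>. infdist (fst z) (A (snd z)) = 0"
proof -
  interpret \<mu>: prob_space \<mu> by (rule \<mu>_props(1))
  note [measurable] = infdist_jointly_measurable[of A P, OF meas]
  \<comment> \<open>Truncation makes the distance bounded, so that convergence in probability
    becomes convergence of means, and keeps it 1-Lipschitz in the first variable.\<close>
  define h where "h z = min 1 (infdist (fst z) (A (snd z)))" for z
  have hm[measurable]: "h \<in> borel_measurable M" unfolding h_def by measurable
  have h01: "0 \<le> h z" "h z \<le> 1" for z by (auto simp: h_def infdist_nonneg)
  have h: "bdm h" by (rule bounded_measurableI[OF hm, where B = 1]) (use h01 in auto)
  have lip: "\<bar>h (x, \<omega>) - h (y, \<omega>)\<bar> \<le> 1 * norm (x - y)" for x y \<omega>
    using infdist_triangle_abs[of x "A \<omega>" y] by (simp add: h_def dist_norm)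
  have "(time_marginal h \<longlongrightarrow> 0) at_top"
  proof (rule tendstoI)
    fix e :: real assume e: "e > 0"
    have "\<forall>\<^sub>F s in at_top. measure P {\<omega>\<in>space P. infdist (pullback \<Phi> s \<omega> 0) (A \<omega>) > e / 2} < e / 2"
      using attr[of "e / 2"] e by (intro order_tendstoD(2)) auto
    then show "\<forall>\<^sub>F s in at_top. dist (time_marginal h s) 0 < e"
    proof (rule eventually_mono[OF eventually_conj[OF _ eventually_ge_at_top[of 0]]])
      fix s :: real
      let ?S = "{\<omega>\<in>space P. infdist (pullback \<Phi> s \<omega> 0) (A \<omega>) > e / 2}"
      assume "measure P ?S < e / 2 \<and> 0 \<le> s"
      then have s: "measure P ?S < e / 2" "s \<ge> 0" by auto
      have [measurable]: "(\<lambda>\<omega>. infdist (pullback \<Phi> s \<omega> 0) (A \<omega>)) \<in> borel_measurable P"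
        using measurable_compose[OF flow_map_measurable[OF s(2), of 0] infdist_jointly_measurable[of A P, OF meas]]
        by (simp add: flow_map_def)
      have S: "?S \<in> sets P" by measurable
      have iS: "integrable P (indicator ?S :: _ \<Rightarrow> real)"
        using S by (simp add: emeasure_eq_measure)
      have "time_marginal h s \<le> (LINT \<omega>|P. e / 2 + indicator ?S \<omega>)"
        unfolding time_marginal_def
      proof (rule integral_mono[OF integrable_flow[OF h s(2)]])
        show "integrable P (\<lambda>\<omega>. e / 2 + indicator ?S \<omega>)" using iS by simp
        show "h (flow_map s 0 \<omega>) \<le> e / 2 + indicator ?S \<omega>" if "\<omega> \<in> space P" for \<omega>
          using that e by (auto simp: h_def flow_map_def indicator_def)
      qed
      also have "\<dots> = e / 2 + measure P ?S"
        using iS S sets.sets_into_space[OF S] by (simp add: prob_space Int_absorb2)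
      also have "\<dots> < e" using s by simp
      finally have "time_marginal h s < e" .
      moreover have "0 \<le> time_marginal h s"
        unfolding time_marginal_def by (intro integral_nonneg_AE) (simp add: h01)
      ultimately show "dist (time_marginal h s) 0 < e" by simp
    qed
  qed
  then have "mean_functional h = 0"
    unfolding mean_functional_def by (rule mean_tendsto_0[OF invariant_mean time_marginal_bounded[OF h]])
  then have 0: "integral\<^sup>L \<mu> h = 0"
    using integral_eq_mean_functional[OF unique h lip] by simp
  have "integrable \<mu> h"
    using h \<mu>_props(2) sets_eq_imp_space_eq[OF \<mu>_props(2)]
    by (intro \<mu>.integrable_bounded_measurable)
      (simp add: bounded_measurable_def measurable_cong_sets[OF \<mu>_props(2) refl])
  then have "AE z in \<mu>. h z = 0"
    using 0 h01 by (subst (asm) integral_nonneg_eq_0_iff_AE) auto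
  then show ?thesis
    by (rule AE_mp) (auto intro!: AE_I2 simp: h_def min_def split: if_splits)
qed

text \<open>The disintegration formula speaks of rectangles, so the exceptional set is covered by
  countably many of them: a ball of radius \<open>r\<close> around \<open>q\<close>, over the paths
  for which \<open>A \<omega>\<close> is farther than \<open>r\<close> from \<open>q\<close>. Points
  of such a rectangle have positive distance to \<open>A \<omega>\<close>, so each rectangle is a
  null set of \<mu>.\<close>

lemma disintegration_null:
  assumes dis: "disintegration P \<Phi> \<mu> B' \<kappa>"
    and meas: "\<And>x. (\<lambda>\<omega>. infdist x (A \<omega>)) \<in> borel_measurable P"
    and zero: "AE z in \<mu>. infdist (fst z) (A (snd z)) = 0"
  shows "AE \<omega> in P. emeasure (\<kappa> \<omega>) {x. infdist x (A \<omega>) \<noteq> 0} = 0"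
proof -
  have \<kappa>: "\<And>\<omega>. \<omega> \<in> space P \<Longrightarrow> prob_space (\<kappa> \<omega>) \<and> sets (\<kappa> \<omega>) = sets borel"
    "\<And>X. X \<in> sets borel \<Longrightarrow> (\<lambda>\<omega>. emeasure (\<kappa> \<omega>) X) \<in> borel_measurable P"
    "\<And>X E. X \<in> sets borel \<Longrightarrow> E \<in> sets P \<Longrightarrow> emeasure \<mu> (X \<times> E) = (\<integral>\<^sup>+ \<omega>\<in>E. emeasure (\<kappa> \<omega>) X \<partial>P)"
    using dis unfolding disintegration_def by blast+
  obtain Q :: "(real ^ 'n) set" where Q: "countable Q" "\<And>X. open X \<Longrightarrow> X \<noteq> {} \<Longrightarrow> \<exists>d\<in>Q. d \<in> X"
    using countable_dense_setE by metis
  let ?r = "\<lambda>k. 1 / real (Suc k)"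
  define E where "E q k = {\<omega> \<in> space P. infdist q (A \<omega>) > ?r k}" for q :: "real ^ 'n" and k
  have E[measurable]: "E q k \<in> sets P" for q k
  proof -
    note [measurable] = meas[of q]
    show ?thesis unfolding E_def by measurable
  qed
  have null: "AE \<omega> in P. \<omega> \<in> E q k \<longrightarrow> emeasure (\<kappa> \<omega>) (ball q (?r k)) = 0" for q k
  proof -
    have "emeasure \<mu> (ball q (?r k) \<times> E q k) = 0"
    proof -
      have "AE z in \<mu>. z \<notin> ball q (?r k) \<times> E q k"
      proof (rule AE_mp[OF zero AE_I2], intro impI notI)
        fix z assume z: "infdist (fst z) (A (snd z)) = 0" "z \<in> ball q (?r k) \<times> E q k"
        have "infdist q (A (snd z)) \<le> infdist (fst z) (A (snd z)) + dist q (fst z)"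
          by (rule infdist_triangle)
        with z show False by (auto simp: E_def)
      qed
      moreover have "ball q (?r k) \<times> E q k \<in> sets \<mu>"
        unfolding \<mu>_props(2) by (intro pair_measureI E) auto
      ultimately have "ball q (?r k) \<times> E q k \<in> null_sets \<mu>"
        using AE_iff_null_sets by blast
      then show ?thesis by blast
    qed
    then have "(\<integral>\<^sup>+ \<omega>. emeasure (\<kappa> \<omega>) (ball q (?r k)) * indicator (E q k) \<omega> \<partial>P) = 0"
      using \<kappa>(3)[OF _ E, of "ball q (?r k)" q k] by simp
    then have "AE \<omega> in P. emeasure (\<kappa> \<omega>) (ball q (?r k)) * indicator (E q k) \<omega> = 0"
      using \<kappa>(2)[of "ball q (?r k)"] by (subst (asm) nn_integral_0_iff_AE) auto
    then show ?thesis by (rule AE_mp) (auto intro!: AE_I2)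
  qed
  then have "AE \<omega> in P. \<forall>q\<in>Q. \<forall>k. \<omega> \<in> E q k \<longrightarrow> emeasure (\<kappa> \<omega>) (ball q (?r k)) = 0"
    by (simp add: AE_ball_countable[OF Q(1)] AE_all_countable)
  then show ?thesis
  proof (rule AE_mp, intro AE_I2 impI)
    fix \<omega> assume \<omega>: "\<omega> \<in> space P" and n: "\<forall>q\<in>Q. \<forall>k. \<omega> \<in> E q k \<longrightarrow> emeasure (\<kappa> \<omega>) (ball q (?r k)) = 0"
    have s\<kappa>: "sets (\<kappa> \<omega>) = sets borel" using \<kappa>(1)[OF \<omega>] by simp
    let ?I = "{(q, k). q \<in> Q \<and> \<omega> \<in> E q k}"
    have "countable ?I"
      by (rule countable_subset[of _ "Q \<times> UNIV"]) (auto intro: Q(1))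
    then have N: "(\<Union>(q, k)\<in>?I. ball q (?r k)) \<in> null_sets (\<kappa> \<omega>)"
      using n by (intro null_sets_UN') (auto simp: null_sets_def s\<kappa>)
    have "{x. infdist x (A \<omega>) \<noteq> 0} \<subseteq> (\<Union>(q, k)\<in>?I. ball q (?r k))"
    proof
      fix x assume "x \<in> {x. infdist x (A \<omega>) \<noteq> 0}"
      then have d: "infdist x (A \<omega>) / 2 > 0" using infdist_nonneg[of x "A \<omega>"] by simp
      \<comment> \<open>The radius is below half the distance, so a centre within
        \<open>?r k\<close> of \<open>x\<close> is still farther than \<open>?r k\<close> from
        \<open>A \<omega>\<close>.\<close>
      then obtain k where k: "?r k < infdist x (A \<omega>) / 2"
        using nat_approx_posE by blast
      obtain q where q: "q \<in> Q" "q \<in> ball x (?r k)"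
        using Q(2)[of "ball x (?r k)"] by auto
      have "infdist x (A \<omega>) \<le> infdist q (A \<omega>) + dist x q" by (rule infdist_triangle)
      then have "\<omega> \<in> E q k" using q k \<omega> by (simp add: E_def)
      moreover have "x \<in> ball q (?r k)" using q by (simp add: dist_commute)
      ultimately show "x \<in> (\<Union>(q, k)\<in>?I. ball q (?r k))" using q by blast
    qed
    moreover have "{x. infdist x (A \<omega>) \<noteq> 0} \<in> sets (\<kappa> \<omega>)"
    proof -
      have "open {x. infdist x (A \<omega>) \<noteq> 0}"
        by (intro open_Collect_neq continuous_intros)
      then show ?thesis by (simp add: s\<kappa>)
    qed
    ultimately have "{x. infdist x (A \<omega>) \<noteq> 0} \<in> null_sets (\<kappa> \<omega>)"
      using N null_sets_subset by blast
    then show "emeasure (\<kappa> \<omega>) {x. infdist x (A \<omega>) \<noteq> 0} = 0" by blast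
  qed
qed

end

theorem proposition4p3:
  fixes H :: real
    and P :: "(real \<Rightarrow> real ^ 'n) measure"
    and D :: "(real \<Rightarrow> real ^ 'n) \<Rightarrow> (real \<Rightarrow> real ^ 'n)"
    and F :: "real ^ 'n \<Rightarrow> real ^ 'n"
    and \<sigma> :: "real ^ 'n ^ 'n"
    and \<Phi> :: "real \<Rightarrow> (real \<Rightarrow> real ^ 'n) \<times> (real \<Rightarrow> real ^ 'n) \<Rightarrow> real ^ 'n \<Rightarrow> real ^ 'n"
    and \<mu> :: "((real ^ 'n) \<times> (real \<Rightarrow> real ^ 'n)) measure"
    and B' :: "(real \<Rightarrow> real ^ 'n) set"
    and \<kappa> :: "(real \<Rightarrow> real ^ 'n) \<Rightarrow> (real ^ 'n) measure"
    and A :: "(real \<Rightarrow> real ^ 'n) \<Rightarrow> (real ^ 'n) set"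
  assumes "0 < H" and "H < 1"
    and "noise_measure H P"
    and "fractional_operator H P D"
    and "standing_conditions H F \<sigma>"
    and "solution_flow H D F \<sigma> \<Phi>"
    and "the_invariant_measure P \<Phi> \<mu>"
    and "disintegration P \<Phi> \<mu> B' \<kappa>"
    and "weak_point_attractor P \<Phi> A"
  shows "(AE \<omega> in P. emeasure (\<kappa> \<omega>) (A \<omega>) = 1) \<and>
         (AE \<omega> in P. measure_support (\<kappa> \<omega>) \<subseteq> A \<omega>)"
proof -
  interpret fractional_paths H D
    by (rule fractional_paths_intro[OF assms(1-4,8)])
  interpret sde_invariant H D P F \<sigma> \<Phi> \<mu>
  proof (intro sde_invariant.intro sde.intro sde_axioms.intro sde_invariant_axioms.intro)
    show "fractional_paths H D" by (rule fractional_paths_axioms)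
    show "prob_space P" "space P = path_space H" "sets P = sets (path_borel H)"
      using assms(3) unfolding noise_measure_def by blast+
    show "standing_conditions H F \<sigma>" "solution_flow H D F \<sigma> \<Phi>" by (rule assms(5) assms(6))+
    show "invariant_measure P \<Phi> \<mu>"
      using assms(7) unfolding the_invariant_measure_def by blast
  qed
  have A: "\<And>\<omega>. \<omega> \<in> space P \<Longrightarrow> A \<omega> \<noteq> {}" "AE \<omega> in P. compact (A \<omega>)"
    "\<And>x. (\<lambda>\<omega>. infdist x (A \<omega>)) \<in> borel_measurable P"
    using assms(9) unfolding weak_point_attractor_def random_compact_set_def by blast+
  have "AE z in \<mu>. infdist (fst z) (A (snd z)) = 0"
  proof (rule attractor_infdist_AE[OF _ A(3)])
    show "\<nu> = \<mu>" if "invariant_measure P \<Phi> \<nu>" for \<nu>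
      using assms(7) that by (simp add: the_invariant_measure_def)
  qed (use assms(9) in \<open>simp add: weak_point_attractor_def\<close>)
  then have "AE \<omega> in P. emeasure (\<kappa> \<omega>) {x. infdist x (A \<omega>) \<noteq> 0} = 0"
    by (rule disintegration_null[OF assms(8) A(3)])
  with A(2) AE_space have "AE \<omega> in P. emeasure (\<kappa> \<omega>) (A \<omega>) = 1 \<and> measure_support (\<kappa> \<omega>) \<subseteq> A \<omega>"
  proof eventually_elim
    case (elim \<omega>)
    have \<kappa>: "prob_space (\<kappa> \<omega>)" "sets (\<kappa> \<omega>) = sets borel"
      using assms(8) elim(2) unfolding disintegration_def by blast+
    interpret K: prob_space "\<kappa> \<omega>" by (rule \<kappa>(1))
    have closed: "closed (A \<omega>)" using elim(1) by (rule compact_imp_closed)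
    \<comment> \<open>Zero distance means membership because the set is closed and nonempty; from
      the empty set \<open>infdist\<close> would be 0 everywhere.\<close>
    then have compl: "{x. infdist x (A \<omega>) \<noteq> 0} = - A \<omega>"
      using in_closed_iff_infdist_zero[OF closed A(1)[OF elim(2)]] by blast
    have "- A \<omega> \<in> null_sets (\<kappa> \<omega>)"
      using elim(3) closed unfolding compl by (simp add: null_sets_def \<kappa>(2))
    then have "AE x in \<kappa> \<omega>. x \<in> A \<omega>" by (rule AE_I') auto
    then have "emeasure (\<kappa> \<omega>) (A \<omega>) = 1"
      using closed by (intro K.emeasure_eq_1_AE) (simp_all add: \<kappa>(2))
    moreover have "measure_support (\<kappa> \<omega>) \<subseteq> A \<omega>"
    proof
      fix x assume x: "x \<in> measure_support (\<kappa> \<omega>)"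
      show "x \<in> A \<omega>"
      proof (rule ccontr)
        assume "x \<notin> A \<omega>"
        moreover have "open (- A \<omega>)" using closed by (simp add: open_Compl)
        ultimately have "emeasure (\<kappa> \<omega>) (- A \<omega>) > 0"
          using x by (simp add: measure_support_def)
        with elim(3) show False by (simp add: compl)
      qed
    qed
    ultimately show ?case by blast
  qed
  then show ?thesis by simp
qed

end
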